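(* Let $(N,C,A_1,A_2,\ldots)$ be a random vector with values in $\{0,1,2,\ldots\}\times\mathbb{R}\times(0,\infty)^{\mathbb{N}}$ such that (i) $\int_{1-\varepsilon}^1 \frac{\mathrm{d}s}{s-\mathbb{E}[s^N]}=\infty$ for all sufficiently small $\varepsilon>0$; (ii) $\mathbb{P}[A_1>0,\ldots,A_m>0\mid N=m]=1$ for every $m\in\mathbb{N}$; (iii) for some $m$ with $\mathbb{P}[N=m]>0$ one has $\mathbb{P}[A_1=1,\ldots,A_m=1\mid N=m]<1$; (iv) $\mathbb{E}[N]\in(1,\infty]$. With $C_t$, $\Phi$, $\mu$, $\mathcal{D}$, $M_\infty(2)$, $C_\infty$ as defined in the context, the following hold as $t\to\infty$. (d) If $\mathbb{E}[C]=0$, $\mu'(1)<0$, and for some $p\in(1,2]$ both $\mathbb{E}[|C|^p]<\infty$ and $\Phi(p)<0$, then $C_t\to C_\infty$ in probability. (e) If $\mathbb{E}[C]=0$, $2\in\mathrm{int}(\mathcal{D})$, $\Phi(2)>0$, $\mu'(2)<0$ and $\mathbb{E}[C^2]\in(0,\infty)$, then $$e^{-\mu(2)t}C_t\overset{d}{\to}\sqrt{M_\infty(2)\,\mathbb{E}[C^2]/\Phi(2)}\;\mathrm{N},$$ where $\mathrm{N}$ is a standard normal random variable independent of $M_\infty(2)$.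
   Context: Notation: $\Phi(s)=\mathbb{E}\big[\sum_{k=1}^N A_k^s\big]-1$ for $s\ge0$; $\mathcal{D}=\{s>0:\mathbb{E}[\sum_{k=1}^N A_k^s]<\infty\}$; $\mu(s)=\Phi(s)/s$ for $s\in\mathcal{D}$. Writing $\mu'(s)<0$ presupposes that $s\in\mathcal{D}$ and that this derivative exists. Marked continuous-time branching random walk. Let $E$ be a unit mean exponential random variable independent of $(N,C,A_1,A_2,\ldots)$. Let $\bigcup_{n\ge0}\mathbb{N}^n$ ($\mathbb{N}^0=\{\varnothing\}$) be the set of Ulam-Harris labels and equip the vertices $x$ with independent copies $(E(x),N(x),C(x),A_1(x),A_2(x),\ldots)$ of $(E,N,C,A_1,A_2,\ldots)$. The full Galton-Watson tree $\mathcal{T}_\infty$ contains $\varnothing$, and for each $x\in\mathcal{T}_\infty$ the children of $x$ in $\mathcal{T}_\infty$ are $xi$, $1\le i\le N(x)$. Birth times $B$, death times $D$ and positions $V$ are defined by $B(\varnothing)=0$, $D(x)=B(x)+E(x)$, $B(xi)=D(x)$, $V(\varnothing)=0$, $V(xi)=V(x)+\log A_i(x)$. For $t\ge0$ let $\partial\mathcal{T}_t=\{x\in\mathcal{T}_\infty: B(x)\le t<D(x)\}$ and $\mathcal{T}_t^o=\{x\in\mathcal{T}_\infty: D(x)\le t\}$. Put $$C_t=\sum_{x\in\mathcal{T}_t^o}e^{V(x)}C(x),\qquad M_t(\gamma)=e^{-\Phi(\gamma)t}\sum_{x\in\partial\mathcal{T}_t}e^{\gamma V(x)},\quad\gamma\in\mathcal{D}.$$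 $(M_t(\gamma))_{t\ge0}$ is a nonnegative martingale and $M_\infty(\gamma)$ denotes its a.s. limit as $t\to\infty$. In (d), $C_\infty=\sum_{x\in\mathcal{T}_\infty}e^{V(x)}C(x)$, where the (not necessarily absolutely convergent) series is understood as the limit in probability of the partial sums over the increasing finite sets $\mathcal{T}_t^o$ as $t\to\infty$; thus (d) asserts that this limit exists as an a.s. finite random variable. *)

theory Defs
  imports "HOL-Probability.Probability"
begin

section \<open>Modes of convergence along a filter\<close>

text \<open>Both notions demand measurability: \<^const>\<open>measure\<close> and \<^const>\<open>distr\<close> return
  junk values on non-measurable sets and functions.\<close>

definition tendsto_in_prob ::
    "'b measure \<Rightarrow> ('t \<Rightarrow> 'b \<Rightarrow> real) \<Rightarrow> ('b \<Rightarrow> real) \<Rightarrow> 't filter \<Rightarrow> bool" where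
  "tendsto_in_prob M X Y F \<longleftrightarrow>
     (\<forall>\<^sub>F t in F. X t \<in> borel_measurable M) \<and> Y \<in> borel_measurable M \<and>
     (\<forall>\<delta>>0. ((\<lambda>t. measure M {\<omega> \<in> space M. \<delta> < \<bar>X t \<omega> - Y \<omega>\<bar>}) \<longlongrightarrow> 0) F)"

text \<open>The library's \<^const>\<open>weak_conv_m\<close>, for families indexed along an arbitrary filter.\<close>

definition tendsto_in_distr ::
    "'b measure \<Rightarrow> ('t \<Rightarrow> 'b \<Rightarrow> real) \<Rightarrow> real measure \<Rightarrow> 't filter \<Rightarrow> bool" where
  "tendsto_in_distr M X L F \<longleftrightarrow>
     (\<forall>\<^sub>F t in F. X t \<in> borel_measurable M) \<and>
     (\<forall>x. isCont (cdf L) x \<longrightarrow> ((\<lambda>t. cdf (distr M borel (X t)) x) \<longlongrightarrow> cdf L x) F)"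

section \<open>The generic vector (N, C, A)\<close>

text \<open>The sequence \<open>A\<close> is indexed from 0: \<open>A \<omega> k\<close> is the \<open>k+1\<close>-st entry of the sequence, so that the
  entries with indices \<open>k < N \<omega>\<close> are the first \<open>N \<omega>\<close> ones. Measurability into the
  following space includes that all entries of the sequence are strictly positive.\<close>

definition mark_space :: "(nat \<times> real \<times> (nat \<Rightarrow> real)) measure" where
  "mark_space = count_space UNIV \<Otimes>\<^sub>M borel \<Otimes>\<^sub>M (\<Pi>\<^sub>M k\<in>UNIV. restrict_space borel {0<..})"

definition moment :: "'a measure \<Rightarrow> ('a \<Rightarrow> nat) \<Rightarrow> ('a \<Rightarrow> nat \<Rightarrow> real) \<Rightarrow> real \<Rightarrow> ennreal" where
  "moment P N A s = (\<integral>\<^sup>+ \<omega>. ennreal (\<Sum>k<N \<omega>. A \<omega> k powr s) \<partial>P)"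

definition Phi :: "'a measure \<Rightarrow> ('a \<Rightarrow> nat) \<Rightarrow> ('a \<Rightarrow> nat \<Rightarrow> real) \<Rightarrow> real \<Rightarrow> ereal" where
  "Phi P N A s = enn2ereal (moment P N A s) - 1"

definition Dset :: "'a measure \<Rightarrow> ('a \<Rightarrow> nat) \<Rightarrow> ('a \<Rightarrow> nat \<Rightarrow> real) \<Rightarrow> real set" where
  "Dset P N A = {s. 0 < s \<and> moment P N A s < \<infinity>}"

text \<open>Only meaningful on \<^const>\<open>Dset\<close>, where \<^const>\<open>Phi\<close> is finite.\<close>

definition mu :: "'a measure \<Rightarrow> ('a \<Rightarrow> nat) \<Rightarrow> ('a \<Rightarrow> nat \<Rightarrow> real) \<Rightarrow> real \<Rightarrow> real" where
  "mu P N A s = real_of_ereal (Phi P N A s) / s"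

text \<open>The derivative is that of a function with domain \<^const>\<open>Dset\<close>, an interval; at an endpoint
  belonging to it, it is the one-sided derivative.\<close>

definition mu_deriv_neg :: "'a measure \<Rightarrow> ('a \<Rightarrow> nat) \<Rightarrow> ('a \<Rightarrow> nat \<Rightarrow> real) \<Rightarrow> real \<Rightarrow> bool" where
  "mu_deriv_neg P N A s \<longleftrightarrow> s \<in> Dset P N A \<and>
     (\<exists>d<0. (mu P N A has_real_derivative d) (at s within Dset P N A))"

section \<open>The marked branching random walk\<close>

text \<open>Vertices are Ulam-Harris labels stored as lists with the most recent entry first and
  counted from 0: the children of \<open>x\<close> are \<open>i # x\<close> with \<open>i < N x \<omega>\<close>, the root is \<open>[]\<close>.\<close>

inductive_set gw_tree :: "(nat list \<Rightarrow> 'b \<Rightarrow> nat) \<Rightarrow> 'b \<Rightarrow> nat list set"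
  for N :: "nat list \<Rightarrow> 'b \<Rightarrow> nat" and \<omega> :: 'b where
  root: "[] \<in> gw_tree N \<omega>"
| child: "x \<in> gw_tree N \<omega> \<Longrightarrow> i < N x \<omega> \<Longrightarrow> i # x \<in> gw_tree N \<omega>"

primrec birth :: "(nat list \<Rightarrow> 'b \<Rightarrow> real) \<Rightarrow> nat list \<Rightarrow> 'b \<Rightarrow> real" where
  "birth E [] = (\<lambda>\<omega>. 0)"
| "birth E (i # x) = (\<lambda>\<omega>. birth E x \<omega> + E x \<omega>)"

definition death :: "(nat list \<Rightarrow> 'b \<Rightarrow> real) \<Rightarrow> nat list \<Rightarrow> 'b \<Rightarrow> real" where
  "death E x \<omega> = birth E x \<omega> + E x \<omega>"

primrec pos :: "(nat list \<Rightarrow> 'b \<Rightarrow> nat \<Rightarrow> real) \<Rightarrow> nat list \<Rightarrow> 'b \<Rightarrow> real" where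
  "pos A [] = (\<lambda>\<omega>. 0)"
| "pos A (i # x) = (\<lambda>\<omega>. pos A x \<omega> + ln (A x \<omega> i))"

definition alive ::
    "(nat list \<Rightarrow> 'b \<Rightarrow> real) \<Rightarrow> (nat list \<Rightarrow> 'b \<Rightarrow> nat) \<Rightarrow> real \<Rightarrow> 'b \<Rightarrow> nat list set" where
  "alive E N t \<omega> = {x \<in> gw_tree N \<omega>. birth E x \<omega> \<le> t \<and> t < death E x \<omega>}"

definition dead ::
    "(nat list \<Rightarrow> 'b \<Rightarrow> real) \<Rightarrow> (nat list \<Rightarrow> 'b \<Rightarrow> nat) \<Rightarrow> real \<Rightarrow> 'b \<Rightarrow> nat list set" where
  "dead E N t \<omega> = {x \<in> gw_tree N \<omega>. death E x \<omega> \<le> t}"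

text \<open>In the non-explosive case \<^const>\<open>alive\<close> and \<^const>\<open>dead\<close> are almost surely finite for all \<open>t\<close>;
  on the exceptional null event the finite-set sums below may be 0.\<close>

definition Ctot ::
    "(nat list \<Rightarrow> 'b \<Rightarrow> real) \<Rightarrow> (nat list \<Rightarrow> 'b \<Rightarrow> nat) \<Rightarrow> (nat list \<Rightarrow> 'b \<Rightarrow> real) \<Rightarrow>
     (nat list \<Rightarrow> 'b \<Rightarrow> nat \<Rightarrow> real) \<Rightarrow> real \<Rightarrow> 'b \<Rightarrow> real" where
  "Ctot E N C A t \<omega> = (\<Sum>x\<in>dead E N t \<omega>. exp (pos A x \<omega>) * C x \<omega>)"

text \<open>The first argument of \<open>Mart\<close> is the value \<open>\<Phi>(\<gamma>)\<close>.\<close>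

definition Mart ::
    "real \<Rightarrow> (nat list \<Rightarrow> 'b \<Rightarrow> real) \<Rightarrow> (nat list \<Rightarrow> 'b \<Rightarrow> nat) \<Rightarrow>
     (nat list \<Rightarrow> 'b \<Rightarrow> nat \<Rightarrow> real) \<Rightarrow> real \<Rightarrow> real \<Rightarrow> 'b \<Rightarrow> real" where
  "Mart \<phi> E N A \<gamma> t \<omega> = exp (- \<phi> * t) * (\<Sum>x\<in>alive E N t \<omega>. exp (\<gamma> * pos A x \<omega>))"

text \<open>Independent copies, indexed by all labels, of a random element \<open>\<xi>\<close> of \<open>S\<close>.\<close>

definition independent_copies ::
    "'b measure \<Rightarrow> ('i \<Rightarrow> 'b \<Rightarrow> 'c) \<Rightarrow> 'a measure \<Rightarrow> ('a \<Rightarrow> 'c) \<Rightarrow> 'c measure \<Rightarrow> bool" where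
  "independent_copies M X P \<xi> S \<longleftrightarrow>
     prob_space.indep_vars M (\<lambda>_. S) X UNIV \<and> (\<forall>x. distr M S (X x) = distr P S \<xi>)"

text \<open>The law of \<open>sqrt (W * c)\<close> times a standard normal variable independent of \<open>W\<close>, realised on a
  product space.\<close>

definition normal_mixture :: "'b measure \<Rightarrow> ('b \<Rightarrow> real) \<Rightarrow> real \<Rightarrow> real measure" where
  "normal_mixture M W c =
     distr (M \<Otimes>\<^sub>M density lborel std_normal_density) borel (\<lambda>(\<omega>, z). sqrt (W \<omega> * c) * z)"

end

theory Submission
  imports Defs "HOL-Library.Nat_Bijection"
begin

text \<open>
  Marks are attached to all labels, so a realisation of the branching random walk is a
  configuration of independent identically distributed marks, and every quantity in the theorem is
  a function of this configuration. Both claims are therefore proved for the law \<open>\<Omega>\<close> of the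
  configuration and carried over in the last section. Two symmetries of \<open>\<Omega>\<close> replace conditional
  expectations: resampling the mark of a single vertex preserves it (\<open>distr_resample\<close>), and it is
  the law of a tree glued together from a root mark and independent copies of the whole tree
  (\<open>distr_glue\<close>). Write \<open>m(\<gamma>) = 1 + \<Phi>(\<gamma>)\<close>. The vertices of generation \<open>n\<close> contribute
  \<open>(m(\<gamma>) / (1 + l))^n\<close> to the expectation of the sum of \<open>exp (\<gamma> V(x) - l B(x))\<close>
  (\<open>suminf_weight_born\<close>), so this sum is integrable as soon as \<open>l > \<Phi>(\<gamma>)\<close>.

  The integral condition on the generating function \<open>f\<close> of the number of children keeps the tree
  from exploding. The probability \<open>F(t)\<close> that finitely many vertices die by time \<open>t\<close> solves
  \<open>F' = f(F) - F\<close> with \<open>F(0) = 1\<close>, and by separation of variables it could leave the value 1 only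
  if \<open>1 / (s - f(s))\<close> were integrable near 1 (\<open>finite_prob_eq_1\<close>).

  Convergence in probability: since \<open>C\<close> has mean zero, the rewards of the vertices that die in a
  time window form martingale differences if the vertices are listed by generation. The inequality
  of von Bahr and Esseen bounds the \<open>p\<close>-th moment of \<open>C\<^sub>t - C\<^sub>s\<close> by a multiple of the expected sum
  of \<open>exp (p V(x))\<close> over the vertices that die after \<open>s\<close>, which decays exponentially in \<open>s\<close>
  because \<open>m(p) < 1\<close> (\<open>moment_total_increment\<close>).

  Convergence in distribution: fix a window length \<open>u\<close> and split the reward at time \<open>s = t - u\<close>.
  After normalisation the part collected before \<open>s\<close> has a second moment of order \<open>exp (- \<Phi>(2) u)\<close>,
  which is small for large \<open>u\<close>. The reward of the window is a sum of independent copies of \<open>C\<^sub>u\<close>,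
  scaled by \<open>exp (V(x))\<close>, over the vertices alive at time \<open>s\<close>, and should be close to a normal
  variable with conditional variance \<open>Var(C\<^sub>u) Y\<^sub>s\<close>, where \<open>Y\<^sub>s\<close> is the sum of \<open>exp (2 V(x))\<close> over
  these vertices. To compare the characteristic functions of the two, observe that both satisfy
  the same renewal equation, obtained from branching at the root and the lack of memory of its
  lifetime, and differ initially by at most \<open>\<epsilon> \<theta>^2 + K \<bar>\<theta>\<bar>^p\<close> with \<open>p > 2\<close>
  (\<open>characteristic_function_near_gaussian\<close>). The renewal equation propagates \<open>\<theta>^2\<close> with growth
  rate \<open>\<Phi>(2)\<close> and \<open>\<bar>\<theta>\<bar>^p\<close> with any rate above \<open>-1\<close> that is at least \<open>\<Phi>(p)\<close> (\<open>gap_bound\<close>). For \<open>\<theta>\<close>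
  of size \<open>exp (- \<Phi>(2) t / 2)\<close> the first term stays of order \<open>\<epsilon>\<close>, and the second one vanishes
  because \<open>\<mu>'(2) < 0\<close> provides \<open>p > 2\<close> with \<open>\<Phi>(p) < p \<Phi>(2) / 2\<close>. What remains is the Gaussian
  functional of \<open>exp (- \<Phi>(2) s) Y\<^sub>s\<close>, that is, of the additive martingale with parameter 2, which
  converges almost surely by Doob's upcrossing argument (\<open>AE_additive_converges\<close>). Levy's
  continuity theorem concludes.
\<close>

section \<open>Configurations of marks\<close>

text \<open>The entries of a mark are the lifetime, the number of children, the reward and the factors
  of the children. Labels outside the tree carry marks as well, so that the marks form an
  independent family with a fixed index set.\<close>

type_synonym mark = "real \<times> nat \<times> real \<times> (nat \<Rightarrow> real)"
type_synonym config = "nat list \<Rightarrow> mark"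

definition lifetime :: "nat list \<Rightarrow> config \<Rightarrow> real" where
  "lifetime x w = fst (w x)"
definition offspring :: "nat list \<Rightarrow> config \<Rightarrow> nat" where
  "offspring x w = fst (snd (w x))"
definition reward :: "nat list \<Rightarrow> config \<Rightarrow> real" where
  "reward x w = fst (snd (snd (w x)))"
definition factor :: "nat list \<Rightarrow> config \<Rightarrow> nat \<Rightarrow> real" where
  "factor x w = snd (snd (snd (w x)))"

definition power_sum :: "real \<Rightarrow> nat \<times> real \<times> (nat \<Rightarrow> real) \<Rightarrow> real" where
  "power_sum \<gamma> r = (\<Sum>k<fst r. snd (snd r) k powr \<gamma>)"

text \<open>This is \<open>exp (\<gamma> V(x))\<close> on the tree. The value 0 off the tree turns sums over the random
  tree into series over all labels.\<close>

definition weight :: "real \<Rightarrow> nat list \<Rightarrow> config \<Rightarrow> real" where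
  "weight \<gamma> x w = (if x \<in> gw_tree offspring w then exp (\<gamma> * pos factor x w) else 0)"

abbreviation born :: "nat list \<Rightarrow> config \<Rightarrow> real" where "born \<equiv> birth lifetime"
abbreviation dies :: "nat list \<Rightarrow> config \<Rightarrow> real" where "dies \<equiv> death lifetime"
abbreviation tree :: "config \<Rightarrow> nat list set" where "tree \<equiv> gw_tree offspring"
abbreviation live :: "real \<Rightarrow> config \<Rightarrow> nat list set" where "live \<equiv> alive lifetime offspring"
abbreviation past :: "real \<Rightarrow> config \<Rightarrow> nat list set" where "past \<equiv> dead lifetime offspring"
abbreviation total_reward :: "real \<Rightarrow> config \<Rightarrow> real" where
  "total_reward \<equiv> Ctot lifetime offspring reward factor"

lemma tree_Nil [simp]: "[] \<in> gw_tree N w"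
  by (rule gw_tree.root)

lemma tree_Cons [simp]: "i # x \<in> gw_tree N w \<longleftrightarrow> x \<in> gw_tree N w \<and> i < N x w"
  by (auto intro: gw_tree.child elim: gw_tree.cases)

lemma weight_Nil [simp]: "weight \<gamma> [] w = 1"
  by (simp add: weight_def)

lemma weight_nonneg [simp]: "0 \<le> weight \<gamma> x w"
  by (simp add: weight_def)

lemma fun_upd_coords [simp]:
  "lifetime x (w(y := q)) = (if x = y then fst q else lifetime x w)"
  "offspring x (w(y := q)) = (if x = y then fst (snd q) else offspring x w)"
  "reward x (w(y := q)) = (if x = y then fst (snd (snd q)) else reward x w)"
  "factor x (w(y := q)) = (if x = y then snd (snd (snd q)) else factor x w)"
  by (simp_all add: lifetime_def offspring_def reward_def factor_def)

text \<open>Birth time, position and membership in the tree are determined by the marks of the proper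
  ancestors, which are shorter labels. Changing the mark of a label that is at least as long has
  no effect on them.\<close>

lemma born_upd [simp]: "length x \<le> length y \<Longrightarrow> born x (w(y := q)) = born x w"
  by (induction x) auto

lemma tree_upd [simp]: "length x \<le> length y \<Longrightarrow> x \<in> tree (w(y := q)) \<longleftrightarrow> x \<in> tree w"
  by (induction x) auto

lemma pos_upd [simp]: "length x \<le> length y \<Longrightarrow> pos factor x (w(y := q)) = pos factor x w"
  by (induction x) auto

lemma weight_upd [simp]: "length x \<le> length y \<Longrightarrow> weight \<gamma> x (w(y := q)) = weight \<gamma> x w"
  by (simp add: weight_def)

lemma dies_upd: "length x \<le> length y \<Longrightarrow> dies x (w(y := q)) = (if x = y then born x w + fst q else dies x w)"
  by (simp add: death_def)

lemma dies_upd_same [simp]: "dies x (w(x := q)) = born x w + fst q"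
  by (simp add: dies_upd)

text \<open>A sum over a random finite set of vertices becomes a limit of sums with fixed index sets
  once the labels are enumerated. Measurability of such sums and their interchange with
  expectations rest on this.\<close>

lemma sum_eq_enumerated_limit:
  fixes f :: "nat list \<Rightarrow> real"
  assumes "finite D"
  shows "(\<lambda>n. \<Sum>i<n. if list_decode i \<in> D then f (list_decode i) else 0) \<longlonglongrightarrow> sum f D"
proof -
  let ?I = "list_encode ` D"
  have "(\<lambda>i. if i \<in> ?I then f (list_decode i) else 0) sums (\<Sum>i\<in>?I. f (list_decode i))"
    using assms by (intro sums_If_finite_set) auto
  moreover have "i \<in> ?I \<longleftrightarrow> list_decode i \<in> D" for i
    by (metis image_iff list_decode_inverse list_encode_inverse)
  moreover have "(\<Sum>i\<in>?I. f (list_decode i)) = sum f D"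
    by (subst sum.reindex) (auto simp: inj_on_def list_encode_eq)
  ultimately show ?thesis by (simp add: sums_def)
qed

text \<open>The criterion only involves membership of single labels, so that finiteness of a random
  set of labels is an event.\<close>

lemma finite_labels_iff: "finite (D :: nat list set) \<longleftrightarrow> (\<exists>n. \<forall>i\<ge>n. list_decode i \<notin> D)"
proof
  assume "finite D"
  then have "finite (list_encode ` D)" by simp
  then obtain n where "\<forall>i\<in>list_encode ` D. i < n" using finite_nat_set_iff_bounded by blast
  then show "\<exists>n. \<forall>i\<ge>n. list_decode i \<notin> D"
    by (metis image_eqI list_decode_inverse not_less)
next
  assume "\<exists>n. \<forall>i\<ge>n. list_decode i \<notin> D"
  then obtain n where n: "\<forall>i\<ge>n. list_decode i \<notin> D" by blast
  have "D \<subseteq> list_decode ` {..<n}"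
  proof
    fix x assume "x \<in> D"
    then have "list_encode x < n" using n by (metis list_encode_inverse not_less)
    then show "x \<in> list_decode ` {..<n}" by (metis image_eqI lessThan_iff list_encode_inverse)
  qed
  then show "finite D" using finite_subset by blast
qed

lemma measurable_finite_labels [measurable (raw)]:
  assumes [measurable]: "\<And>x. Measurable.pred M (\<lambda>w. x \<in> D w)"
  shows "Measurable.pred M (\<lambda>w. finite (D w :: nat list set))"
  unfolding finite_labels_iff by measurable

lemma borel_measurable_sum_labels:
  fixes f :: "nat list \<Rightarrow> 'b \<Rightarrow> real"
  assumes D [measurable]: "\<And>x. Measurable.pred M (\<lambda>w. x \<in> D w)"
    and f [measurable]: "\<And>x. f x \<in> borel_measurable M"
  shows "(\<lambda>w. \<Sum>x\<in>D w. f x w) \<in> borel_measurable M"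
proof -
  have "(\<lambda>w. \<Sum>x\<in>D w. f x w) = (\<lambda>w. if finite (D w)
      then lim (\<lambda>n. \<Sum>i<n. if list_decode i \<in> D w then f (list_decode i) w else 0) else 0)"
    by (rule ext) (auto intro!: limI[symmetric] sum_eq_enumerated_limit)
  also have "\<dots> \<in> borel_measurable M" by measurable
  finally show ?thesis .
qed

section \<open>The canonical probability space\<close>

lemma measurable_mark_space_N [measurable]: "fst \<in> mark_space \<rightarrow>\<^sub>M count_space UNIV"
  unfolding mark_space_def by measurable

lemma measurable_mark_space_C [measurable]: "(\<lambda>r. fst (snd r)) \<in> borel_measurable mark_space"
  unfolding mark_space_def by measurable

lemma measurable_mark_space_A [measurable]: "(\<lambda>r. snd (snd r) k) \<in> borel_measurable mark_space"
proof -
  have "(\<lambda>r. snd (snd r) k) \<in> mark_space \<rightarrow>\<^sub>M restrict_space borel {0::real<..}"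
    unfolding mark_space_def by measurable
  then show ?thesis by (simp add: measurable_restrict_space2_iff)
qed

lemma mark_space_A_pos: "r \<in> space mark_space \<Longrightarrow> 0 < snd (snd r) k"
  by (auto simp: mark_space_def space_pair_measure space_PiM space_restrict_space PiE_iff)

lemma measurable_power_sum [measurable]: "power_sum \<gamma> \<in> borel_measurable mark_space"
  unfolding power_sum_def[abs_def]
  by (rule measurable_compose_countable[where g=fst]) measurable

lemma power_sum_nonneg [simp]: "0 \<le> power_sum \<gamma> r"
  by (auto simp: power_sum_def intro!: sum_nonneg)

definition unit_exponential :: "real measure" where
  "unit_exponential = density lborel (exponential_density 1)"

lemma sets_unit_exponential [simp, measurable_cong]: "sets unit_exponential = sets borel"
  by (simp add: unit_exponential_def)

lemma space_unit_exponential [simp]: "space unit_exponential = UNIV"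
  by (simp add: unit_exponential_def)

lemma prob_space_unit_exponential: "prob_space unit_exponential"
  unfolding unit_exponential_def by (rule prob_space_exponential_density) simp

lemma AE_unit_exponential_pos: "AE e in unit_exponential. 0 < e"
proof -
  have "AE e in lborel. e \<noteq> (0::real)" by (rule AE_lborel_singleton)
  then show ?thesis
    unfolding unit_exponential_def
    by (subst AE_density) (auto simp: exponential_density_def elim!: eventually_mono)
qed

locale marked_branching =
  fixes R :: "(nat \<times> real \<times> (nat \<Rightarrow> real)) measure"
  assumes prob_space_R: "prob_space R"
    and sets_R [simp, measurable_cong]: "sets R = sets mark_space"
begin

sublocale R: prob_space R by (rule prob_space_R)

definition Q :: "mark measure" where "Q = unit_exponential \<Otimes>\<^sub>M R"
definition \<Omega> :: "config measure" where "\<Omega> = (\<Pi>\<^sub>M x\<in>UNIV. Q)"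

sublocale ex: prob_space unit_exponential by (rule prob_space_unit_exponential)
sublocale exR: pair_prob_space unit_exponential R ..
sublocale Q: prob_space Q unfolding Q_def by (rule exR.prob_space_axioms)
sublocale \<Omega>: prob_space \<Omega> unfolding \<Omega>_def by (intro prob_space_PiM Q.prob_space_axioms)

lemma space_R: "space R = space mark_space"
  using sets_R by (rule sets_eq_imp_space_eq)

lemma sets_Q [simp, measurable_cong]: "sets Q = sets (borel \<Otimes>\<^sub>M mark_space)"
  unfolding Q_def by (intro sets_pair_measure_cong) auto

lemma space_Q: "space Q = UNIV \<times> space mark_space"
  by (simp add: Q_def space_pair_measure space_R)

lemma sets_\<Omega> [measurable_cong]: "sets \<Omega> = sets (\<Pi>\<^sub>M x\<in>UNIV. borel \<Otimes>\<^sub>M mark_space)"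
  unfolding \<Omega>_def by (intro sets_PiM_cong) auto

lemma space_\<Omega>: "space \<Omega> = UNIV \<rightarrow> space Q"
  by (auto simp: \<Omega>_def space_PiM PiE_iff)

lemma measurable_coord: "(\<lambda>w. w x) \<in> \<Omega> \<rightarrow>\<^sub>M borel \<Otimes>\<^sub>M mark_space"
  by measurable

lemma measurable_coords [measurable]:
  "lifetime x \<in> borel_measurable \<Omega>"
  "offspring x \<in> \<Omega> \<rightarrow>\<^sub>M count_space UNIV"
  "reward x \<in> borel_measurable \<Omega>"
  "(\<lambda>w. factor x w k) \<in> borel_measurable \<Omega>"
  unfolding lifetime_def[abs_def] offspring_def[abs_def] reward_def[abs_def] factor_def
  using measurable_coord[measurable] by measurable

lemma measurable_power_sum_coord [measurable]: "(\<lambda>w. power_sum \<gamma> (snd (w x))) \<in> borel_measurable \<Omega>"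
  by (rule measurable_compose[OF measurable_compose[OF measurable_coord measurable_snd] measurable_power_sum])

lemma factor_pos: "w \<in> space \<Omega> \<Longrightarrow> 0 < factor x w k"
  using mark_space_A_pos[of "snd (w x)" k]
  by (simp add: space_\<Omega> factor_def space_Q Pi_iff mem_Times_iff)

lemma measurable_born [measurable]: "born x \<in> borel_measurable \<Omega>"
  by (induction x) auto

lemma measurable_dies [measurable]: "dies x \<in> borel_measurable \<Omega>"
  unfolding death_def[abs_def] by measurable

lemma measurable_tree [measurable]: "Measurable.pred \<Omega> (\<lambda>w. x \<in> tree w)"
  by (induction x) auto

lemma measurable_pos [measurable]: "pos factor x \<in> borel_measurable \<Omega>"
  by (induction x) auto

lemma measurable_weight [measurable]: "weight \<gamma> x \<in> borel_measurable \<Omega>"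
  unfolding weight_def[abs_def] by measurable

lemma measurable_live [measurable]: "Measurable.pred \<Omega> (\<lambda>w. x \<in> live t w)"
  unfolding alive_def mem_Collect_eq by measurable

lemma measurable_past [measurable]: "Measurable.pred \<Omega> (\<lambda>w. x \<in> past t w)"
  unfolding dead_def mem_Collect_eq by measurable

lemma measurable_total [measurable]: "total_reward t \<in> borel_measurable \<Omega>"
  unfolding Ctot_def[abs_def] by (rule borel_measurable_sum_labels) measurable

lemma measurable_Mart [measurable]: "Mart \<phi> lifetime offspring factor \<gamma> t \<in> borel_measurable \<Omega>"
  unfolding Mart_def[abs_def]
  by (intro borel_measurable_times borel_measurable_const borel_measurable_sum_labels) measurable

lemma weight_Cons:
  "w \<in> space \<Omega> \<Longrightarrow> weight \<gamma> (i # x) w =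
     weight \<gamma> x w * (if i < offspring x w then factor x w i powr \<gamma> else 0)"
  using factor_pos[of w x i] by (simp add: weight_def powr_def exp_add[symmetric] algebra_simps)

subsection \<open>Resampling the mark of one vertex\<close>

lemma measurable_upd [measurable]:
  "(\<lambda>(q, w). w(x := q)) \<in> (Q \<Otimes>\<^sub>M \<Omega>) \<rightarrow>\<^sub>M \<Omega>"
  unfolding \<Omega>_def split_beta' by (rule measurable_fun_upd[where J=UNIV]) auto

text \<open>Replacing one mark by an independent copy preserves the law of the configuration.
  Integrating over the copy alone amounts to conditioning on the marks of all other labels.\<close>

lemma distr_resample: "distr (Q \<Otimes>\<^sub>M \<Omega>) \<Omega> (\<lambda>(q, w). w(x := q)) = \<Omega>"
  using distr_pair_PiM_eq_PiM[of UNIV "\<lambda>_. Q" x] Q.prob_space_axioms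
  by (simp add: \<Omega>_def insert_UNIV)

lemma upd_in_space: "w \<in> space \<Omega> \<Longrightarrow> q \<in> space Q \<Longrightarrow> w(x := q) \<in> space \<Omega>"
  by (auto simp: space_\<Omega>)

sublocale Q\<Omega>: pair_prob_space Q \<Omega> ..

lemma nn_integral_resample:
  assumes [measurable]: "F \<in> borel_measurable \<Omega>"
  shows "(\<integral>\<^sup>+ w. F w \<partial>\<Omega>) = (\<integral>\<^sup>+ w. \<integral>\<^sup>+ q. F (w(x := q)) \<partial>Q \<partial>\<Omega>)"
proof -
  have "(\<integral>\<^sup>+ w. F w \<partial>\<Omega>) = (\<integral>\<^sup>+ w. F w \<partial>distr (Q \<Otimes>\<^sub>M \<Omega>) \<Omega> (\<lambda>(q, w). w(x := q)))"
    by (simp only: distr_resample)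
  also have "\<dots> = (\<integral>\<^sup>+ p. F ((\<lambda>(q, w). w(x := q)) p) \<partial>(Q \<Otimes>\<^sub>M \<Omega>))"
    by (intro nn_integral_distr) measurable
  also have "\<dots> = (\<integral>\<^sup>+ w. \<integral>\<^sup>+ q. F (w(x := q)) \<partial>Q \<partial>\<Omega>)"
    by (subst Q\<Omega>.nn_integral_snd[symmetric]) (auto simp: split_beta')
  finally show ?thesis .
qed

lemma integral_resample:
  fixes F :: "config \<Rightarrow> 'c::{banach, second_countable_topology}"
  assumes F: "integrable \<Omega> F"
  shows "(\<integral> w. F w \<partial>\<Omega>) = (\<integral> w. \<integral> q. F (w(x := q)) \<partial>Q \<partial>\<Omega>)"
proof -
  have [measurable]: "F \<in> borel_measurable \<Omega>" using F by auto
  have int: "integrable (Q \<Otimes>\<^sub>M \<Omega>) (\<lambda>(q, w). F (w(x := q)))"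
    using F distr_resample[of x] integrable_distr_eq[of "\<lambda>(q, w). w(x := q)" "Q \<Otimes>\<^sub>M \<Omega>" \<Omega> F]
    by (simp add: split_beta')
  have "(\<integral> w. F w \<partial>\<Omega>) = (\<integral> w. F w \<partial>distr (Q \<Otimes>\<^sub>M \<Omega>) \<Omega> (\<lambda>(q, w). w(x := q)))"
    by (simp only: distr_resample)
  also have "\<dots> = (\<integral> p. F ((\<lambda>(q, w). w(x := q)) p) \<partial>(Q \<Otimes>\<^sub>M \<Omega>))"
    by (intro integral_distr) measurable
  also have "\<dots> = (\<integral> w. \<integral> q. F (w(x := q)) \<partial>Q \<partial>\<Omega>)"
    using Q\<Omega>.integral_snd[OF int] by (simp add: split_beta')
  finally show ?thesis .
qed

lemma AE_mark_lifetime_pos: "AE q in Q. 0 < fst q"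
proof -
  have "{q \<in> space (unit_exponential \<Otimes>\<^sub>M R). 0 < fst q} \<in> sets (unit_exponential \<Otimes>\<^sub>M R)"
    by measurable
  then show ?thesis
    unfolding Q_def
    by (rule exR.AE_pair_measure) (use AE_unit_exponential_pos in simp)
qed

lemma AE_lifetime_pos: "AE w in \<Omega>. \<forall>x. 0 < lifetime x w"
proof -
  have "AE w in \<Omega>. 0 < fst (w x)" for x
    using AE_mark_lifetime_pos unfolding \<Omega>_def by (intro AE_PiM_component Q.prob_space_axioms) auto
  then show ?thesis by (simp add: AE_all_countable lifetime_def)
qed

end

section \<open>Discounted moments summed over the tree\<close>

lemma nn_integral_exp_unit_exponential:
  assumes "-1 < l"
  shows "(\<integral>\<^sup>+ e. ennreal (exp (- l * e)) \<partial>unit_exponential) = ennreal (1 / (1 + l))"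
proof -
  have "(\<integral>\<^sup>+ e. ennreal (exp (- l * e)) \<partial>unit_exponential)
      = (\<integral>\<^sup>+ e. ennreal (exponential_density 1 e) * ennreal (exp (- l * e)) \<partial>lborel)"
    unfolding unit_exponential_def by (subst nn_integral_density) auto
  also have "\<dots> = (\<integral>\<^sup>+ e. ennreal (1 / (1 + l)) * ennreal (exponential_density (1 + l) e) \<partial>lborel)"
  proof (rule nn_integral_cong)
    fix e :: real
    have "exponential_density 1 e * exp (- l * e) = 1 / (1 + l) * exponential_density (1 + l) e"
    proof (cases "e < 0")
      case False
      have "exp (- e) * exp (- l * e) = exp (- e * (1 + l))"
        by (simp add: exp_add[symmetric] algebra_simps)
      then show ?thesis using False assms by (simp add: exponential_density_def)
    qed (simp add: exponential_density_def)
    then show "ennreal (exponential_density 1 e) * ennreal (exp (- l * e))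
        = ennreal (1 / (1 + l)) * ennreal (exponential_density (1 + l) e)"
      using assms by (simp add: ennreal_mult[symmetric] exponential_density_nonneg)
  qed
  also have "\<dots> = ennreal (1 / (1 + l)) * (\<integral>\<^sup>+ e. ennreal (exponential_density (1 + l) e) \<partial>lborel)"
    by (rule nn_integral_cmult) auto
  also have "(\<integral>\<^sup>+ e. ennreal (exponential_density (1 + l) e) \<partial>lborel) = 1"
    using prob_space.emeasure_space_1[OF prob_space_exponential_density, of "1 + l"] assms
    by (simp add: emeasure_density)
  finally show ?thesis by simp
qed

lemma nn_integral_lists_by_length:
  fixes d :: "'a::countable \<Rightarrow> ennreal"
  shows "(\<integral>\<^sup>+ x. (if length x = n then prod_list (map d x) else 0) \<partial>count_space UNIV)
    = (\<integral>\<^sup>+ i. d i \<partial>count_space UNIV) ^ n"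
proof (induction n)
  case 0
  have "(\<integral>\<^sup>+ x. (if length x = 0 then prod_list (map d x) else 0) \<partial>count_space UNIV)
      = (\<integral>\<^sup>+ x. (if length x = 0 then prod_list (map d x) else 0) \<partial>count_space {[]})"
    by (rule nn_integral_count_space_eq) auto
  then show ?case by (simp add: nn_integral_count_space_finite)
next
  case (Suc n)
  let ?g = "\<lambda>n x. if length x = n then prod_list (map d x) else 0"
  have bij: "bij_betw (\<lambda>(i, x). i # x) UNIV (UNIV - {[]} :: 'a list set)"
    by (rule bij_betwI[where g="\<lambda>x. (hd x, tl x)"]) auto
  have "(\<integral>\<^sup>+ x. ?g (Suc n) x \<partial>count_space UNIV) = (\<integral>\<^sup>+ x. ?g (Suc n) x \<partial>count_space (UNIV - {[]}))"
    by (rule nn_integral_count_space_eq) auto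
  also have "\<dots> = (\<integral>\<^sup>+ p. ?g (Suc n) ((\<lambda>(i, x). i # x) p) \<partial>count_space UNIV)"
    by (rule nn_integral_bij_count_space[OF bij, symmetric])
  also have "\<dots> = (\<integral>\<^sup>+ p. d (fst p) * ?g n (snd p) \<partial>count_space UNIV)"
    by (intro nn_integral_cong) auto
  also have "\<dots> = (\<integral>\<^sup>+ i. \<integral>\<^sup>+ x. d i * ?g n x \<partial>count_space UNIV \<partial>count_space UNIV)"
    by (subst nn_integral_fst_count_space[symmetric]) (simp only: fst_conv snd_conv)
  also have "\<dots> = (\<integral>\<^sup>+ i. d i \<partial>count_space UNIV) * (\<integral>\<^sup>+ i. d i \<partial>count_space UNIV) ^ n"
    by (simp add: nn_integral_cmult nn_integral_multc Suc)
  finally show ?case by simp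
qed

lemma suminf_prod_list:
  fixes d :: "nat \<Rightarrow> ennreal"
  shows "(\<Sum>k. prod_list (map d (list_decode k))) = (\<Sum>n. (\<Sum>i. d i) ^ n)"
proof -
  have "(\<Sum>k. prod_list (map d (list_decode k)))
      = (\<integral>\<^sup>+ x. prod_list (map d x) \<partial>count_space UNIV)"
    by (subst nn_integral_bij_count_space[OF bij_list_decode, symmetric])
       (simp add: nn_integral_count_space_nat)
  also have "\<dots> = (\<integral>\<^sup>+ x. (\<Sum>n. if length x = n then prod_list (map d x) else 0) \<partial>count_space UNIV)"
  proof (rule nn_integral_cong)
    fix x :: "nat list"
    have "(\<Sum>n. if length x = n then prod_list (map d x) else 0)
        = (\<Sum>n\<in>{length x}. if length x = n then prod_list (map d x) else 0)"
      by (rule suminf_finite) auto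
    then show "prod_list (map d x) = (\<Sum>n. if length x = n then prod_list (map d x) else 0)" by simp
  qed
  also have "\<dots> = (\<Sum>n. \<integral>\<^sup>+ x. (if length x = n then prod_list (map d x) else 0) \<partial>count_space UNIV)"
    by (rule nn_integral_suminf) auto
  also have "\<dots> = (\<Sum>n. (\<Sum>i. d i) ^ n)"
    by (simp only: nn_integral_lists_by_length nn_integral_count_space_nat)
  finally show ?thesis .
qed

context marked_branching
begin

text \<open>This is \<open>1 + \<Phi>(\<gamma>)\<close>.\<close>

definition mom :: "real \<Rightarrow> ennreal" where
  "mom \<gamma> = (\<integral>\<^sup>+ r. ennreal (power_sum \<gamma> r) \<partial>R)"

definition child_moment :: "real \<Rightarrow> nat \<Rightarrow> ennreal" where
  "child_moment \<gamma> i = (\<integral>\<^sup>+ r. ennreal (if i < fst r then snd (snd r) i powr \<gamma> else 0) \<partial>R)"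

lemma suminf_child_moment: "(\<Sum>i. child_moment \<gamma> i) = mom \<gamma>"
proof -
  have "(\<Sum>i. child_moment \<gamma> i)
      = (\<integral>\<^sup>+ r. (\<Sum>i. ennreal (if i < fst r then snd (snd r) i powr \<gamma> else 0)) \<partial>R)"
    unfolding child_moment_def by (rule nn_integral_suminf[symmetric]) measurable
  also have "\<dots> = mom \<gamma>"
    unfolding mom_def power_sum_def
    by (intro nn_integral_cong, subst suminf_finite[OF finite_lessThan])
       (auto simp: sum_ennreal intro!: sum.cong)
  finally show ?thesis .
qed

lemma nn_integral_Q:
  assumes "F \<in> borel_measurable (borel \<Otimes>\<^sub>M mark_space)"
  shows "(\<integral>\<^sup>+ q. F q \<partial>Q) = (\<integral>\<^sup>+ e. \<integral>\<^sup>+ r. F (e, r) \<partial>R \<partial>unit_exponential)"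
proof -
  have "sets (unit_exponential \<Otimes>\<^sub>M R) = sets (borel \<Otimes>\<^sub>M mark_space)"
    using sets_Q by (simp add: Q_def)
  then have "F \<in> borel_measurable (unit_exponential \<Otimes>\<^sub>M R)"
    using assms measurable_cong_sets by blast
  then show ?thesis unfolding Q_def by (rule R.nn_integral_fst[symmetric])
qed

lemma nn_integral_Q_times:
  assumes [measurable]: "f \<in> borel_measurable borel" "g \<in> borel_measurable mark_space"
  shows "(\<integral>\<^sup>+ q. f (fst q) * g (snd q) \<partial>Q) = (\<integral>\<^sup>+ e. f e \<partial>unit_exponential) * (\<integral>\<^sup>+ r. g r \<partial>R)"
  by (subst nn_integral_Q) (simp_all add: nn_integral_cmult nn_integral_multc)

text \<open>If the mark of \<open>x\<close> enters through separate factors for its lifetime and for the rest, both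
  factors split off, because the mark is independent of all others and its two parts are
  independent of each other.\<close>

lemma nn_integral_resample_times:
  assumes [measurable]: "H \<in> borel_measurable \<Omega>" "f \<in> borel_measurable \<Omega>"
      "g \<in> borel_measurable borel" "h \<in> borel_measurable mark_space"
    and H: "\<And>w q. w \<in> space \<Omega> \<Longrightarrow> q \<in> space Q \<Longrightarrow> H (w(x := q)) = f w * (g (fst q) * h (snd q))"
  shows "(\<integral>\<^sup>+ w. H w \<partial>\<Omega>)
    = (\<integral>\<^sup>+ w. f w \<partial>\<Omega>) * ((\<integral>\<^sup>+ e. g e \<partial>unit_exponential) * (\<integral>\<^sup>+ r. h r \<partial>R))"
proof -
  have "(\<integral>\<^sup>+ w. H w \<partial>\<Omega>) = (\<integral>\<^sup>+ w. \<integral>\<^sup>+ q. H (w(x := q)) \<partial>Q \<partial>\<Omega>)"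
    by (rule nn_integral_resample) fact
  also have "\<dots> = (\<integral>\<^sup>+ w. \<integral>\<^sup>+ q. f w * (g (fst q) * h (snd q)) \<partial>Q \<partial>\<Omega>)"
    by (intro nn_integral_cong H)
  also have "\<dots> = (\<integral>\<^sup>+ w. f w * (\<integral>\<^sup>+ q. g (fst q) * h (snd q) \<partial>Q) \<partial>\<Omega>)"
    by (intro nn_integral_cong nn_integral_cmult) measurable
  also have "\<dots> = (\<integral>\<^sup>+ w. f w \<partial>\<Omega>) * (\<integral>\<^sup>+ q. g (fst q) * h (snd q) \<partial>Q)"
    by (rule nn_integral_multc) measurable
  finally show ?thesis by (simp add: nn_integral_Q_times)
qed

text \<open>Each edge of the ancestral line of \<open>x\<close> contributes to \<open>V(x)\<close> and \<open>B(x)\<close> through the mark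
  of the parent only. These marks are independent, and a discounted exponential lifetime has
  mean \<open>1 / (1 + l)\<close>.\<close>

lemma nn_integral_weight_born:
  assumes l: "-1 < l"
  shows "(\<integral>\<^sup>+ w. ennreal (weight \<gamma> x w * exp (- l * born x w)) \<partial>\<Omega>)
    = prod_list (map (\<lambda>i. child_moment \<gamma> i * ennreal (1 / (1 + l))) x)"
proof (induction x)
  case Nil
  then show ?case using \<Omega>.emeasure_space_1 by simp
next
  case (Cons i x)
  have "(\<integral>\<^sup>+ w. ennreal (weight \<gamma> (i # x) w * exp (- l * born (i # x) w)) \<partial>\<Omega>)
      = (\<integral>\<^sup>+ w. ennreal (weight \<gamma> x w * exp (- l * born x w)) \<partial>\<Omega>) *
        ((\<integral>\<^sup>+ e. ennreal (exp (- l * e)) \<partial>unit_exponential) *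
         (\<integral>\<^sup>+ r. ennreal (if i < fst r then snd (snd r) i powr \<gamma> else 0) \<partial>R))"
  proof (rule nn_integral_resample_times[where x=x])
    fix w q assume "w \<in> space \<Omega>" "q \<in> space Q"
    then show "ennreal (weight \<gamma> (i # x) (w(x := q)) * exp (- l * born (i # x) (w(x := q))))
      = ennreal (weight \<gamma> x w * exp (- l * born x w)) * (ennreal (exp (- l * fst q)) *
          ennreal (if i < fst (snd q) then snd (snd (snd q)) i powr \<gamma> else 0))"
      by (subst weight_Cons[OF upd_in_space])
         (auto simp: ennreal_mult[symmetric] exp_add[symmetric] algebra_simps)
  qed measurable
  then show ?case
    unfolding Cons nn_integral_exp_unit_exponential[OF l] child_moment_def[symmetric]
    by (simp add: mult_ac)
qed

lemma nn_integral_weight_dies: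
  assumes l: "-1 < l"
  shows "(\<integral>\<^sup>+ w. ennreal (weight \<gamma> x w * exp (- l * dies x w)) \<partial>\<Omega>)
    = (\<integral>\<^sup>+ w. ennreal (weight \<gamma> x w * exp (- l * born x w)) \<partial>\<Omega>) * ennreal (1 / (1 + l))"
proof -
  have "(\<integral>\<^sup>+ w. ennreal (weight \<gamma> x w * exp (- l * dies x w)) \<partial>\<Omega>)
      = (\<integral>\<^sup>+ w. ennreal (weight \<gamma> x w * exp (- l * born x w)) \<partial>\<Omega>) *
        ((\<integral>\<^sup>+ e. ennreal (exp (- l * e)) \<partial>unit_exponential) * (\<integral>\<^sup>+ r. 1 \<partial>R))"
  proof (rule nn_integral_resample_times[where x=x])
    fix w q assume "w \<in> space \<Omega>" "q \<in> space Q"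
    show "ennreal (weight \<gamma> x (w(x := q)) * exp (- l * dies x (w(x := q))))
      = ennreal (weight \<gamma> x w * exp (- l * born x w)) * (ennreal (exp (- l * fst q)) * 1)"
      by (auto simp: ennreal_mult[symmetric] exp_add[symmetric] algebra_simps)
  qed measurable
  then show ?thesis
    unfolding nn_integral_exp_unit_exponential[OF l] by (simp add: R.emeasure_space_1)
qed

lemma suminf_weight_born:
  assumes l: "-1 < l"
  shows "(\<Sum>k. \<integral>\<^sup>+ w. ennreal (weight \<gamma> (list_decode k) w * exp (- l * born (list_decode k) w)) \<partial>\<Omega>)
    = (\<Sum>n. (mom \<gamma> * ennreal (1 / (1 + l))) ^ n)"
  unfolding nn_integral_weight_born[OF l] suminf_prod_list ennreal_suminf_multc suminf_child_moment
  ..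

text \<open>The generations form a geometric series whose ratio \<open>m(\<gamma>) / (1 + l)\<close> is below 1. If
  \<open>m(\<gamma>) < 1\<close>, the rate \<open>l\<close> may be negative, and late births are then even given a large weight.\<close>

lemma suminf_weight_born_finite:
  assumes l: "-1 < l" and m: "mom \<gamma> < ennreal (1 + l)"
  shows "(\<Sum>k. \<integral>\<^sup>+ w. ennreal (weight \<gamma> (list_decode k) w * exp (- l * born (list_decode k) w)) \<partial>\<Omega>) < \<infinity>"
proof -
  obtain a where a: "mom \<gamma> = ennreal a" "0 \<le> a"
    using m by (cases "mom \<gamma>") auto
  have less: "a < 1 + l" using m a by (simp add: ennreal_less_iff)
  let ?r = "a * (1 / (1 + l))"
  have r: "0 \<le> ?r" "?r < 1" using a less l by (auto simp: field_simps)
  have "(\<Sum>n. (mom \<gamma> * ennreal (1 / (1 + l))) ^ n) = (\<Sum>n. ennreal (?r ^ n))"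
  proof -
    have "mom \<gamma> * ennreal (1 / (1 + l)) = ennreal ?r"
      using a l by (subst ennreal_mult) auto
    then show ?thesis using r(1) by (simp only: ennreal_power)
  qed
  also have "\<dots> = ennreal (\<Sum>n. ?r ^ n)"
    using r by (intro suminf_ennreal2 summable_geometric) (simp_all only: real_norm_def abs_of_nonneg zero_le_power)
  finally show ?thesis using suminf_weight_born[OF l, of \<gamma>] by simp
qed

end

section \<open>The branching property at the root\<close>

text \<open>Labels have their most recent entry first, so the last entry of a label tells which
  subtree of the root it belongs to. Configurations are glued at all \<open>k\<close>, whether or not the
  root has a child with this index.\<close>

definition glue :: "mark \<times> (nat \<Rightarrow> config) \<Rightarrow> config" where
  "glue = (\<lambda>(q, \<eta>) x. if x = [] then q else \<eta> (last x) (butlast x))"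

lemma glue_simps [simp]: "glue (q, \<eta>) [] = q" "glue (q, \<eta>) (y @ [k]) = \<eta> k y"
  by (simp_all add: glue_def)

lemma coords_glue [simp]:
  "lifetime [] (glue (q, \<eta>)) = fst q" "lifetime (y @ [k]) (glue (q, \<eta>)) = lifetime y (\<eta> k)"
  "offspring [] (glue (q, \<eta>)) = fst (snd q)" "offspring (y @ [k]) (glue (q, \<eta>)) = offspring y (\<eta> k)"
  "reward [] (glue (q, \<eta>)) = fst (snd (snd q))" "reward (y @ [k]) (glue (q, \<eta>)) = reward y (\<eta> k)"
  "factor [] (glue (q, \<eta>)) = snd (snd (snd q))" "factor (y @ [k]) (glue (q, \<eta>)) = factor y (\<eta> k)"
  by (simp_all add: lifetime_def offspring_def reward_def factor_def)

lemma tree_glue [simp]: "y @ [k] \<in> tree (glue (q, \<eta>)) \<longleftrightarrow> k < fst (snd q) \<and> y \<in> tree (\<eta> k)"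
  by (induction y) auto

lemma born_glue [simp]: "born (y @ [k]) (glue (q, \<eta>)) = fst q + born y (\<eta> k)"
  by (induction y) auto

lemma dies_glue [simp]: "dies (y @ [k]) (glue (q, \<eta>)) = fst q + dies y (\<eta> k)"
  by (simp add: death_def)

lemma pos_glue [simp]: "pos factor (y @ [k]) (glue (q, \<eta>)) = ln (snd (snd (snd q)) k) + pos factor y (\<eta> k)"
  by (induction y) auto

definition positive_lifetimes :: "config \<Rightarrow> bool" where
  "positive_lifetimes w \<longleftrightarrow> (\<forall>x. 0 < lifetime x w)"

lemma born_nonneg: "positive_lifetimes w \<Longrightarrow> 0 \<le> born x w"
  by (induction x) (auto simp: positive_lifetimes_def less_imp_le add_nonneg_nonneg)

lemma dies_pos: "positive_lifetimes w \<Longrightarrow> 0 < dies x w"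
  using born_nonneg[of w x] by (simp add: death_def positive_lifetimes_def add_nonneg_pos)

lemma born_le_dies: "positive_lifetimes w \<Longrightarrow> born x w \<le> dies x w"
  by (simp add: death_def positive_lifetimes_def less_imp_le)

lemma past_mono: "s \<le> t \<Longrightarrow> past s w \<subseteq> past t w"
  by (auto simp: dead_def)

lemma past_neg: "positive_lifetimes w \<Longrightarrow> t \<le> 0 \<Longrightarrow> past t w = {}"
  using dies_pos[of w] by (auto simp: dead_def not_le dest: order_trans)
    (metis less_le_trans not_less order_trans)

lemma Collect_label_cases:
  "{x. P x} = (if P [] then {[]} else {}) \<union> (\<Union>k. (\<lambda>y. y @ [k]) ` {y. P (y @ [k])})"
proof -
  have "P x \<longleftrightarrow> x \<in> (if P [] then {[]} else {}) \<union> (\<Union>k. (\<lambda>y. y @ [k]) ` {y. P (y @ [k])})" for x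
    by (cases x rule: rev_cases) auto
  then show ?thesis by blast
qed

lemma past_glue:
  assumes "\<And>k. positive_lifetimes (\<eta> k)"
  shows "past t (glue (q, \<eta>)) = (if t < fst q then {} else
    insert [] (\<Union>k<fst (snd q). (\<lambda>y. y @ [k]) ` past (t - fst q) (\<eta> k)))"
proof -
  have "\<not> (dies y (\<eta> k) \<le> t - fst q)" if "t < fst q" for y k
    using dies_pos[OF assms, of y k] that by linarith
  then show ?thesis
    unfolding dead_def
    by (subst Collect_label_cases) (auto simp: death_def algebra_simps)
qed

lemma live_glue:
  assumes "\<And>k. positive_lifetimes (\<eta> k)" "0 \<le> t"
  shows "live t (glue (q, \<eta>)) = (if t < fst q then {[]} else
    (\<Union>k<fst (snd q). (\<lambda>y. y @ [k]) ` live (t - fst q) (\<eta> k)))"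
proof -
  have "\<not> (born y (\<eta> k) \<le> t - fst q)" if "t < fst q" for y k
    using born_nonneg[OF assms(1), of y k] that by linarith
  then show ?thesis
    using assms(2) unfolding alive_def
    by (subst Collect_label_cases) (auto simp: death_def algebra_simps)
qed

lemma inj_on_snoc [simp]: "inj_on (\<lambda>y. y @ [k]) S"
  by (auto simp: inj_on_def)

lemma finite_past_glue:
  assumes "\<And>k. positive_lifetimes (\<eta> k)"
  shows "finite (past t (glue (q, \<eta>))) \<longleftrightarrow>
    t < fst q \<or> (\<forall>k<fst (snd q). finite (past (t - fst q) (\<eta> k)))"
  by (auto simp: past_glue[OF assms] finite_image_iff)

lemma sum_glue:
  fixes g :: "nat list \<Rightarrow> real"
  assumes "\<And>k. k < n \<Longrightarrow> finite (D k)"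
  shows "sum g (\<Union>k<n. (\<lambda>y. y @ [k]) ` D k) = (\<Sum>k<n. \<Sum>y\<in>D k. g (y @ [k]))"
  using assms by (subst sum.UNION_disjoint) (auto simp: sum.reindex)

definition live_sum :: "real \<Rightarrow> real \<Rightarrow> config \<Rightarrow> real" where
  "live_sum \<gamma> t w = (\<Sum>x\<in>live t w. exp (\<gamma> * pos factor x w))"

lemma live_sum_nonneg [simp]: "0 \<le> live_sum \<gamma> t w"
  by (auto simp: live_sum_def intro!: sum_nonneg)

lemma live_sum_glue:
  assumes "\<And>k. positive_lifetimes (\<eta> k)" "0 \<le> t" "\<And>k. 0 < snd (snd (snd q)) k"
    and "\<And>k. k < fst (snd q) \<Longrightarrow> finite (live (t - fst q) (\<eta> k))"
  shows "live_sum \<gamma> t (glue (q, \<eta>)) = (if t < fst q then 1 else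
    (\<Sum>k<fst (snd q). snd (snd (snd q)) k powr \<gamma> * live_sum \<gamma> (t - fst q) (\<eta> k)))"
  using assms
  by (auto simp: live_sum_def live_glue sum_glue powr_def exp_add[symmetric] sum_distrib_left
      algebra_simps less_imp_neq[symmetric] intro!: sum.cong)

lemma total_glue:
  assumes "\<And>k. positive_lifetimes (\<eta> k)" "\<And>k. 0 < snd (snd (snd q)) k"
    and fin: "\<And>k. k < fst (snd q) \<Longrightarrow> finite (past (t - fst q) (\<eta> k))"
  shows "total_reward t (glue (q, \<eta>)) = (if t < fst q then 0 else
    fst (snd (snd q)) + (\<Sum>k<fst (snd q). snd (snd (snd q)) k * total_reward (t - fst q) (\<eta> k)))"
proof -
  have "sum g (insert [] (\<Union>k<fst (snd q). (\<lambda>y. y @ [k]) ` past (t - fst q) (\<eta> k)))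
     = g [] + (\<Sum>k<fst (snd q). \<Sum>y\<in>past (t - fst q) (\<eta> k). g (y @ [k]))" for g :: "nat list \<Rightarrow> real"
    using fin by (subst sum.insert) (auto simp: sum_glue)
  then show ?thesis
    using assms
    by (auto simp: Ctot_def past_glue exp_add sum_distrib_left mult.assoc intro!: sum.cong)
qed

context marked_branching
begin

definition \<Omega>s :: "(nat \<Rightarrow> config) measure" where "\<Omega>s = (\<Pi>\<^sub>M k\<in>UNIV. \<Omega>)"

sublocale \<Omega>s: prob_space \<Omega>s unfolding \<Omega>s_def by (intro prob_space_PiM \<Omega>.prob_space_axioms)
sublocale Q\<Omega>s: pair_prob_space Q \<Omega>s ..
sublocale prodQ: product_prob_space "\<lambda>_::nat list. Q" UNIV
  by unfold_locales
sublocale prod\<Omega>: product_prob_space "\<lambda>_::nat. \<Omega>" UNIV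
  by unfold_locales

lemma measurable_subtree: "(\<lambda>\<eta>. \<eta> k) \<in> \<Omega>s \<rightarrow>\<^sub>M \<Omega>"
  unfolding \<Omega>s_def by measurable

lemma measurable_glue [measurable]: "glue \<in> (Q \<Otimes>\<^sub>M \<Omega>s) \<rightarrow>\<^sub>M \<Omega>"
proof -
  have "(\<lambda>p. glue p x) \<in> (Q \<Otimes>\<^sub>M \<Omega>s) \<rightarrow>\<^sub>M Q" for x
  proof (cases x rule: rev_cases)
    case (snoc y k)
    have "(\<lambda>w. w y) \<in> \<Omega> \<rightarrow>\<^sub>M Q" unfolding \<Omega>_def by measurable
    then have "(\<lambda>p. snd p k y) \<in> (Q \<Otimes>\<^sub>M \<Omega>s) \<rightarrow>\<^sub>M Q"
      by (rule measurable_compose[OF measurable_compose[OF measurable_snd measurable_subtree]])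
    then show ?thesis by (simp add: glue_def split_beta' snoc)
  qed (simp add: glue_def split_beta')
  then have "(\<lambda>p x. glue p x) \<in> (Q \<Otimes>\<^sub>M \<Omega>s) \<rightarrow>\<^sub>M \<Omega>"
    unfolding \<Omega>_def by (intro measurable_PiM_single') (auto simp: PiE_iff dest: measurable_space)
  then show ?thesis by simp
qed

text \<open>Branching property: the marks are independent and identically distributed, so cutting a
  configuration at the root gives an independent family of copies of it. It suffices to compare
  the two measures on cylinder sets.\<close>

lemma distr_glue: "distr (Q \<Otimes>\<^sub>M \<Omega>s) \<Omega> glue = \<Omega>"
proof -
  have "distr (Q \<Otimes>\<^sub>M \<Omega>s) \<Omega> glue = PiM UNIV (\<lambda>_. Q)"
  proof (rule prodQ.PiM_eq)
    show "sets (distr (Q \<Otimes>\<^sub>M \<Omega>s) \<Omega> glue) = sets (PiM UNIV (\<lambda>_. Q))" by (simp add: \<Omega>_def)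
    fix J :: "nat list set" and F :: "nat list \<Rightarrow> mark set"
    assume J: "finite J" "J \<subseteq> UNIV" and F: "\<And>j. j \<in> J \<Longrightarrow> F j \<in> sets Q"
    let ?e = "\<lambda>x. emeasure Q (F x)"
    define K where "K = last ` (J - {[]})"
    define I where "I k = {y. y @ [k] \<in> J}" for k
    define F0 where "F0 = (if [] \<in> J then F [] else space Q)"
    define G where "G k = {w \<in> space \<Omega>. \<forall>y\<in>I k. w y \<in> F (y @ [k])}" for k
    have finI: "finite (I k)" for k
      unfolding I_def using finite_vimageI[OF J(1), of "\<lambda>y. y @ [k]"]
      by (simp add: vimage_def)
    have finK: "finite K" using J by (simp add: K_def)
    have emG: "emeasure \<Omega> (G k) = (\<Prod>y\<in>I k. ?e (y @ [k]))" for k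
      unfolding G_def \<Omega>_def
      by (rule prodQ.emeasure_PiM_Collect) (use finI F in \<open>auto simp: I_def\<close>)
    have setsG: "G k \<in> sets \<Omega>" for k
    proof -
      have "(\<lambda>w. w y) \<in> \<Omega> \<rightarrow>\<^sub>M Q" for y unfolding \<Omega>_def by measurable
      then have "{w \<in> space \<Omega>. w y \<in> F (y @ [k])} \<in> sets \<Omega>" if "y \<in> I k" for y
        using that F by (auto simp: I_def intro!: measurable_sets_Collect)
      then show ?thesis unfolding G_def
        by (intro sets.sets_Collect_finite_All finI) auto
    qed
    have bij: "bij_betw (\<lambda>(k, y). y @ [k]) (Sigma K I) (J - {[]})"
    proof (rule bij_betwI[where g="\<lambda>x. (last x, butlast x)"])
      show "(\<lambda>(k, y). y @ [k]) \<in> Sigma K I \<rightarrow> J - {[]}" by (auto simp: I_def)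
      show "(\<lambda>x. (last x, butlast x)) \<in> J - {[]} \<rightarrow> Sigma K I" by (auto simp: I_def K_def)
    qed auto
    have setsF0: "F0 \<in> sets Q" using F sets.top[of Q] by (auto simp: F0_def)
    have "prod_emb UNIV (\<lambda>_. Q) J (\<Pi>\<^sub>E j\<in>J. F j) = {w \<in> space \<Omega>. \<forall>x\<in>J. w x \<in> F x}"
      by (auto simp: prod_emb_def space_\<Omega> Pi_iff)
    \<comment> \<open>a cylinder of glued configurations is a product of cylinders for the root and for the
      subtrees\<close>
    then have vim: "glue -` prod_emb UNIV (\<lambda>_. Q) J (\<Pi>\<^sub>E j\<in>J. F j) \<inter> space (Q \<Otimes>\<^sub>M \<Omega>s)
      = F0 \<times> {\<eta> \<in> space \<Omega>s. \<forall>k\<in>K. \<eta> k \<in> G k}"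
    proof -
      have 1: "(\<forall>x\<in>J. glue (q, \<eta>) x \<in> F x) \<longleftrightarrow>
          ([] \<in> J \<longrightarrow> q \<in> F []) \<and> (\<forall>k\<in>K. \<forall>y\<in>I k. \<eta> k y \<in> F (y @ [k]))" (is "?L \<longleftrightarrow> ?R") for q \<eta>
      proof
        show "?L \<Longrightarrow> ?R" unfolding I_def by (auto dest: bspec)
        assume R: ?R
        show ?L
        proof
          fix x assume x: "x \<in> J"
          show "glue (q, \<eta>) x \<in> F x"
          proof (cases x rule: rev_cases)
            case (snoc y k)
            then have "k \<in> K" "y \<in> I k" using x by (force simp: K_def I_def)+
            then show ?thesis using R snoc by simp
          qed (use R x in simp)
        qed
      qed
      have 2: "glue (q, \<eta>) \<in> space \<Omega>" if "q \<in> space Q" "\<eta> \<in> space \<Omega>s" for q \<eta>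
        using measurable_space[OF measurable_glue, of "(q, \<eta>)"] that by (simp add: space_pair_measure)
      have 3: "\<eta> k \<in> space \<Omega>" if "\<eta> \<in> space \<Omega>s" for \<eta> k
        using measurable_space[OF measurable_subtree that] .
      have 4: "q \<in> F [] \<Longrightarrow> [] \<in> J \<Longrightarrow> q \<in> space Q" for q using F sets.sets_into_space by blast
      have "(q, \<eta>) \<in> glue -` prod_emb UNIV (\<lambda>_. Q) J (\<Pi>\<^sub>E j\<in>J. F j) \<inter> space (Q \<Otimes>\<^sub>M \<Omega>s)
          \<longleftrightarrow> (q, \<eta>) \<in> F0 \<times> {\<eta> \<in> space \<Omega>s. \<forall>k\<in>K. \<eta> k \<in> G k}" for q \<eta>
      proof -
        have "(q, \<eta>) \<in> glue -` prod_emb UNIV (\<lambda>_. Q) J (\<Pi>\<^sub>E j\<in>J. F j) \<inter> space (Q \<Otimes>\<^sub>M \<Omega>s)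
            \<longleftrightarrow> glue (q, \<eta>) \<in> space \<Omega> \<and> (\<forall>x\<in>J. glue (q, \<eta>) x \<in> F x) \<and> q \<in> space Q \<and> \<eta> \<in> space \<Omega>s"
          unfolding \<open>prod_emb UNIV (\<lambda>_. Q) J (\<Pi>\<^sub>E j\<in>J. F j) = _\<close> by (simp add: space_pair_measure)
        also have "\<dots> \<longleftrightarrow> (q, \<eta>) \<in> F0 \<times> {\<eta> \<in> space \<Omega>s. \<forall>k\<in>K. \<eta> k \<in> G k}"
          unfolding 1 G_def F0_def using 2[of q \<eta>] 3[of \<eta>] 4[of q]
          by (cases "[] \<in> J") (simp_all only: mem_Sigma_iff mem_Collect_eq if_True if_False simp_thms, blast+)
        finally show ?thesis .
      qed
      then have "p \<in> glue -` prod_emb UNIV (\<lambda>_. Q) J (\<Pi>\<^sub>E j\<in>J. F j) \<inter> space (Q \<Otimes>\<^sub>M \<Omega>s)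
          \<longleftrightarrow> p \<in> F0 \<times> {\<eta> \<in> space \<Omega>s. \<forall>k\<in>K. \<eta> k \<in> G k}" for p
        by (cases p) (simp only:)
      then show ?thesis by blast
    qed
    have "emeasure (distr (Q \<Otimes>\<^sub>M \<Omega>s) \<Omega> glue) (prod_emb UNIV (\<lambda>_. Q) J (\<Pi>\<^sub>E j\<in>J. F j))
        = emeasure (Q \<Otimes>\<^sub>M \<Omega>s) (F0 \<times> {\<eta> \<in> space \<Omega>s. \<forall>k\<in>K. \<eta> k \<in> G k})"
    proof (subst emeasure_distr)
      show "prod_emb UNIV (\<lambda>_. Q) J (\<Pi>\<^sub>E j\<in>J. F j) \<in> sets \<Omega>"
        unfolding \<Omega>_def using J F by (intro sets_PiM_I) auto
    qed (simp_all add: vim)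
    also have "\<dots> = emeasure Q F0 * emeasure \<Omega>s {\<eta> \<in> space \<Omega>s. \<forall>k\<in>K. \<eta> k \<in> G k}"
    proof (rule \<Omega>s.emeasure_pair_measure_Times[OF setsF0])
      show "{\<eta> \<in> space \<Omega>s. \<forall>k\<in>K. \<eta> k \<in> G k} \<in> sets \<Omega>s"
        using setsG by (intro sets.sets_Collect_finite_All finK measurable_sets_Collect[OF measurable_subtree]) auto
    qed
    also have "emeasure \<Omega>s {\<eta> \<in> space \<Omega>s. \<forall>k\<in>K. \<eta> k \<in> G k} = (\<Prod>k\<in>K. emeasure \<Omega> (G k))"
      unfolding \<Omega>s_def by (rule prod\<Omega>.emeasure_PiM_Collect) (use finK setsG in auto)
    also have "(\<Prod>k\<in>K. emeasure \<Omega> (G k)) = (\<Prod>k\<in>K. \<Prod>y\<in>I k. ?e (y @ [k]))"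
      by (simp add: emG)
    also have "\<dots> = (\<Prod>p\<in>Sigma K I. ?e ((\<lambda>(k, y). y @ [k]) p))"
      using finK finI by (subst prod.Sigma) (auto simp: split_beta')
    also have "\<dots> = (\<Prod>x\<in>J - {[]}. ?e x)"
      using bij by (rule prod.reindex_bij_betw)
    also have "emeasure Q F0 * (\<Prod>x\<in>J - {[]}. ?e x) = (\<Prod>x\<in>J. ?e x)"
      using J by (auto simp: F0_def prod.remove Q.emeasure_space_1)
    finally show "emeasure (distr (Q \<Otimes>\<^sub>M \<Omega>s) \<Omega> glue) (prod_emb UNIV (\<lambda>_. Q) J (\<Pi>\<^sub>E j\<in>J. F j))
      = (\<Prod>j\<in>J. emeasure Q (F j))" .
  qed
  then show ?thesis by (simp add: \<Omega>_def)
qed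

lemma nn_integral_glue:
  assumes [measurable]: "F \<in> borel_measurable \<Omega>"
  shows "(\<integral>\<^sup>+ w. F w \<partial>\<Omega>) = (\<integral>\<^sup>+ q. \<integral>\<^sup>+ \<eta>. F (glue (q, \<eta>)) \<partial>\<Omega>s \<partial>Q)"
proof -
  have "(\<integral>\<^sup>+ w. F w \<partial>\<Omega>) = (\<integral>\<^sup>+ w. F w \<partial>distr (Q \<Otimes>\<^sub>M \<Omega>s) \<Omega> glue)"
    by (simp only: distr_glue)
  also have "\<dots> = (\<integral>\<^sup>+ p. F (glue p) \<partial>(Q \<Otimes>\<^sub>M \<Omega>s))"
    by (intro nn_integral_distr) measurable
  also have "\<dots> = (\<integral>\<^sup>+ q. \<integral>\<^sup>+ \<eta>. F (glue (q, \<eta>)) \<partial>\<Omega>s \<partial>Q)"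
    by (subst \<Omega>s.nn_integral_fst[symmetric]) auto
  finally show ?thesis .
qed

lemma integrable_glue:
  fixes F :: "config \<Rightarrow> 'c::{banach, second_countable_topology}"
  assumes "integrable \<Omega> F"
  shows "integrable (Q \<Otimes>\<^sub>M \<Omega>s) (\<lambda>p. F (glue p))"
  using assms distr_glue integrable_distr_eq[OF measurable_glue, of F] by auto

lemma integral_glue:
  fixes F :: "config \<Rightarrow> 'c::{banach, second_countable_topology}"
  assumes F: "integrable \<Omega> F"
  shows "(\<integral> w. F w \<partial>\<Omega>) = (\<integral> q. \<integral> \<eta>. F (glue (q, \<eta>)) \<partial>\<Omega>s \<partial>Q)"
proof -
  have [measurable]: "F \<in> borel_measurable \<Omega>" using F by auto
  have "(\<integral> w. F w \<partial>\<Omega>) = (\<integral> w. F w \<partial>distr (Q \<Otimes>\<^sub>M \<Omega>s) \<Omega> glue)"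
    by (simp only: distr_glue)
  also have "\<dots> = (\<integral> p. F (glue p) \<partial>(Q \<Otimes>\<^sub>M \<Omega>s))"
    by (intro integral_distr) measurable
  also have "\<dots> = (\<integral> q. \<integral> \<eta>. F (glue (q, \<eta>)) \<partial>\<Omega>s \<partial>Q)"
    using Q\<Omega>s.integral_fst'[OF integrable_glue[OF F]] by simp
  finally show ?thesis .
qed

lemma AE_positive_lifetimes: "AE w in \<Omega>. positive_lifetimes w"
  using AE_lifetime_pos by (simp add: positive_lifetimes_def)

lemma AE_subtrees:
  assumes "AE w in \<Omega>. P w"
  shows "AE \<eta> in \<Omega>s. \<forall>k. P (\<eta> k)"
  unfolding AE_all_countable \<Omega>s_def
  using assms by (intro allI AE_PiM_component \<Omega>.prob_space_axioms) auto

text \<open>Subtrees rooted at different children of the root are independent.\<close>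

lemma integral_subtrees:
  fixes f :: "nat \<Rightarrow> config \<Rightarrow> complex"
  assumes f: "\<And>k. k < n \<Longrightarrow> integrable \<Omega> (f k)"
  shows "(\<integral> \<eta>. (\<Prod>k<n. f k (\<eta> k)) \<partial>\<Omega>s) = (\<Prod>k<n. \<integral> w. f k w \<partial>\<Omega>)"
proof -
  have [measurable]: "f k \<in> borel_measurable \<Omega>" if "k \<in> {..<n}" for k
    using f that by auto
  have restr: "(\<lambda>\<eta>. restrict \<eta> {..<n}) \<in> \<Omega>s \<rightarrow>\<^sub>M PiM {..<n} (\<lambda>_. \<Omega>)"
    unfolding \<Omega>s_def by (rule measurable_restrict_subset) simp
  have comp: "(\<lambda>\<eta>. f k (\<eta> k)) \<in> borel_measurable (PiM {..<n} (\<lambda>_. \<Omega>))" if "k \<in> {..<n}" for k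
    using that by (intro measurable_compose[OF measurable_component_singleton]) auto
  have "(\<integral> \<eta>. (\<Prod>k<n. f k (\<eta> k)) \<partial>\<Omega>s)
      = (\<integral> \<eta>. (\<Prod>k<n. f k (restrict \<eta> {..<n} k)) \<partial>\<Omega>s)"
    by (intro Bochner_Integration.integral_cong prod.cong) auto
  also have "\<dots> = (\<integral> \<eta>. (\<Prod>k<n. f k (\<eta> k)) \<partial>distr \<Omega>s (PiM {..<n} (\<lambda>_. \<Omega>)) (\<lambda>\<eta>. restrict \<eta> {..<n}))"
    using comp by (intro integral_distr[symmetric] restr borel_measurable_prod)
  also have "\<dots> = (\<integral> \<eta>. (\<Prod>k<n. f k (\<eta> k)) \<partial>PiM {..<n} (\<lambda>_. \<Omega>))"
    unfolding \<Omega>s_def by (subst prod\<Omega>.distr_PiM_restrict_finite) auto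
  also have "\<dots> = (\<Prod>k<n. \<integral> w. f k w \<partial>\<Omega>)"
    using f by (intro prod\<Omega>.product_integral_prod) auto
  finally show ?thesis .
qed

end

section \<open>Non-explosion\<close>

lemma borel_measurable_antimono:
  fixes f :: "real \<Rightarrow> real"
  assumes "antimono f"
  shows "f \<in> borel_measurable borel"
proof -
  have "mono (\<lambda>x. - f x)" using assms by (auto simp: mono_def antimono_def)
  then have "(\<lambda>x. - (- f x)) \<in> borel_measurable borel"
    by (intro borel_measurable_uminus borel_measurable_mono)
  then show ?thesis by simp
qed

context marked_branching
begin

definition finite_prob :: "real \<Rightarrow> real" where
  "finite_prob t = measure \<Omega> {w \<in> space \<Omega>. finite (past t w)}"

definition gen_fun :: "real \<Rightarrow> real" where
  "gen_fun s = (\<integral> r. s ^ fst r \<partial>R)"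

lemma finite_past_sets [measurable]: "Measurable.pred \<Omega> (\<lambda>w. finite (past t w))"
  by measurable

lemma finite_prob_bounds: "0 \<le> finite_prob t" "finite_prob t \<le> 1"
  by (simp_all add: finite_prob_def)

lemma antimono_finite_prob: "antimono finite_prob"
proof (rule antimonoI)
  fix s t :: real assume "s \<le> t"
  then show "finite_prob t \<le> finite_prob s"
    unfolding finite_prob_def
    by (intro \<Omega>.finite_measure_mono) (auto intro: finite_subset[OF past_mono])
qed

lemma measurable_finite_prob [measurable]: "finite_prob \<in> borel_measurable borel"
  by (rule borel_measurable_antimono[OF antimono_finite_prob])

lemma finite_prob_neg: "t \<le> 0 \<Longrightarrow> finite_prob t = 1"
  unfolding finite_prob_def using AE_positive_lifetimes
  by (subst \<Omega>.prob_Collect_eq_1) (auto simp: past_neg elim!: eventually_mono)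

lemma gen_fun_integrable: "0 \<le> (s::real) \<Longrightarrow> s \<le> 1 \<Longrightarrow> integrable R (\<lambda>r. s ^ fst r)"
  by (rule R.integrable_const_bound[where B=1]) (auto simp: power_le_one)

lemma gen_fun_bounds:
  assumes "0 \<le> s" "s \<le> 1"
  shows "0 \<le> gen_fun s" "gen_fun s \<le> 1"
proof -
  show "0 \<le> gen_fun s" using assms by (simp add: gen_fun_def)
  have "gen_fun s \<le> (\<integral> r. 1 \<partial>R)"
    unfolding gen_fun_def using assms gen_fun_integrable[OF assms]
    by (intro integral_mono) (auto simp: power_le_one)
  then show "gen_fun s \<le> 1" by (simp add: R.prob_space)
qed

lemma gen_fun_mono: "0 \<le> s \<Longrightarrow> s \<le> s' \<Longrightarrow> s' \<le> 1 \<Longrightarrow> gen_fun s \<le> gen_fun s'"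
  unfolding gen_fun_def
  by (intro integral_mono gen_fun_integrable) (auto intro: power_mono)

lemma continuous_gen_fun: "continuous_on {0..1} gen_fun"
  unfolding continuous_on_sequentially
proof (intro allI ballI impI)
  fix X a assume a: "a \<in> {0..1::real}" and X: "(\<forall>n. X n \<in> {0..1}) \<and> X \<longlonglongrightarrow> a"
  show "(gen_fun \<circ> X) \<longlonglongrightarrow> gen_fun a"
    unfolding gen_fun_def comp_def
  proof (rule integral_dominated_convergence[where w="\<lambda>_. 1"])
    show "AE r in R. (\<lambda>i. X i ^ fst r) \<longlonglongrightarrow> a ^ fst r"
      using X by (auto intro!: tendsto_power)
    show "AE r in R. norm (X i ^ fst r) \<le> 1" for i
      using X by (auto simp: power_le_one abs_le_iff)
  qed auto
qed

lemma gen_finite_antimono: "antimono (\<lambda>t. gen_fun (finite_prob t))"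
  using antimono_finite_prob finite_prob_bounds
  by (auto simp: antimono_def intro!: gen_fun_mono)

lemma measurable_gen_finite [measurable]: "(\<lambda>t. gen_fun (finite_prob t)) \<in> borel_measurable borel"
  by (rule borel_measurable_antimono[OF gen_finite_antimono])

text \<open>Finitely many vertices have died by time \<open>t\<close> iff the root is still alive or this holds, at
  the remaining time, for the subtrees of its children, which are independent. If the root is
  still alive, the remaining time is negative and \<open>finite_prob\<close> equals 1 there, so that the
  formula has no separate initial term.\<close>

lemma finite_prob_renewal:
  "ennreal (finite_prob t) = (\<integral>\<^sup>+ e. ennreal (gen_fun (finite_prob (t - e))) \<partial>unit_exponential)"
proof -
  have inner: "(\<integral>\<^sup>+ \<eta>. indicator {w \<in> space \<Omega>. finite (past t w)} (glue (q, \<eta>)) \<partial>\<Omega>s)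
      = ennreal (finite_prob (t - fst q) ^ fst (snd q))" if q: "q \<in> space Q" for q
  proof -
    let ?S = "{w \<in> space \<Omega>. finite (past (t - fst q) w)}"
    have "(\<integral>\<^sup>+ \<eta>. indicator {w \<in> space \<Omega>. finite (past t w)} (glue (q, \<eta>)) \<partial>\<Omega>s)
        = (\<integral>\<^sup>+ \<eta>. indicator {\<eta> \<in> space \<Omega>s. \<forall>k\<in>{..<fst (snd q)}. \<eta> k \<in> ?S} \<eta> \<partial>\<Omega>s)"
    proof (rule nn_integral_cong_AE, use AE_subtrees[OF AE_positive_lifetimes] AE_space in eventually_elim)
      case (elim \<eta>)
      have "glue (q, \<eta>) \<in> space \<Omega>"
        using measurable_space[OF measurable_glue, of "(q, \<eta>)"] elim q by (simp add: space_pair_measure)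
      moreover have "\<eta> k \<in> space \<Omega>" for k
        using measurable_space[OF measurable_subtree] elim by blast
      moreover have "past (t - fst q) (\<eta> k) = {}" if "t < fst q" for k
        using elim(1) that by (intro past_neg) auto
      ultimately show ?case
        using elim by (auto simp: finite_past_glue indicator_def)
    qed
    also have "\<dots> = emeasure \<Omega>s {\<eta> \<in> space \<Omega>s. \<forall>k\<in>{..<fst (snd q)}. \<eta> k \<in> ?S}"
      by (intro nn_integral_indicator sets.sets_Collect_finite_All
          measurable_sets_Collect[OF measurable_subtree]) auto
    also have "\<dots> = (\<Prod>k<fst (snd q). emeasure \<Omega> ?S)"
      unfolding \<Omega>s_def by (rule prod\<Omega>.emeasure_PiM_Collect) auto
    finally show ?thesis
      by (simp add: \<Omega>.emeasure_eq_measure finite_prob_def ennreal_power)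
  qed
  have "ennreal (finite_prob t) = (\<integral>\<^sup>+ w. indicator {w \<in> space \<Omega>. finite (past t w)} w \<partial>\<Omega>)"
    by (simp add: \<Omega>.emeasure_eq_measure finite_prob_def)
  also have "\<dots> = (\<integral>\<^sup>+ q. ennreal (finite_prob (t - fst q) ^ fst (snd q)) \<partial>Q)"
    by (subst nn_integral_glue) (auto simp: inner intro!: nn_integral_cong)
  also have "\<dots> = (\<integral>\<^sup>+ e. \<integral>\<^sup>+ r. ennreal (finite_prob (t - e) ^ fst r) \<partial>R \<partial>unit_exponential)"
    by (subst nn_integral_Q) auto
  also have "\<dots> = (\<integral>\<^sup>+ e. ennreal (gen_fun (finite_prob (t - e))) \<partial>unit_exponential)"
    unfolding gen_fun_def using finite_prob_bounds
    by (intro nn_integral_cong nn_integral_eq_integral gen_fun_integrable) auto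
  finally show ?thesis .
qed

lemma finite_prob_convolution:
  "ennreal (finite_prob t) =
     (\<integral>\<^sup>+ v. ennreal (exp (v - t) * gen_fun (finite_prob v)) * indicator {..t} v \<partial>lborel)"
proof -
  let ?g = "\<lambda>v. gen_fun (finite_prob v)"
  have pos: "0 \<le> ?g v" for v using gen_fun_bounds finite_prob_bounds by blast
  have "ennreal (finite_prob t) = (\<integral>\<^sup>+ e. ennreal (exponential_density 1 e) * ennreal (?g (t - e)) \<partial>lborel)"
    unfolding finite_prob_renewal unit_exponential_def by (subst nn_integral_density) auto
  also have "\<dots> = (\<integral>\<^sup>+ e. ennreal (exp (- e) * ?g (t - e)) * indicator {0..} e \<partial>lborel)"
    using pos by (intro nn_integral_cong)
      (auto simp: exponential_density_def ennreal_mult indicator_def)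
  also have "\<dots> = (\<integral>\<^sup>+ v. ennreal (exp (v - t) * ?g v) * indicator {..t} v \<partial>lborel)"
    by (subst nn_integral_real_affine[where c="-1" and t=t])
       (auto intro!: nn_integral_cong simp: indicator_def)
  finally show ?thesis .
qed

text \<open>Starting the integral at \<open>-1\<close>, where everything is still explicit, makes time 0 an
  interior point, so that the differential equation derived from this holds at time 0, too.\<close>

lemma finite_prob_integral:
  assumes "-1 \<le> t"
  shows "(\<lambda>v. exp v * gen_fun (finite_prob v)) integrable_on {-1..t}"
    and "exp t * finite_prob t = exp (-1) + integral {-1..t} (\<lambda>v. exp v * gen_fun (finite_prob v))"
proof -
  let ?g = "\<lambda>v. gen_fun (finite_prob v)"
  have pos: "0 \<le> ?g v" and le1: "?g v \<le> 1" for v using gen_fun_bounds finite_prob_bounds by blast+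
  have si: "set_integrable lborel {-1..t} (\<lambda>v. exp v * ?g v)"
  proof (unfold set_integrable_def, rule Bochner_Integration.integrable_bound)
    show "integrable lborel (\<lambda>v. indicator {-1..t} v *\<^sub>R exp t)"
      by (intro integrable_scaleR_left integrable_real_indicator) (auto simp: emeasure_lborel_Icc_eq)
    show "AE v in lborel. norm (indicator {-1..t} v *\<^sub>R (exp v * ?g v)) \<le> norm (indicator {-1..t} v *\<^sub>R exp t)"
    proof (rule AE_I2)
      fix v
      have "exp v * ?g v \<le> exp t" if "v \<le> t"
        using that mult_mono[of "exp v" "exp t" "?g v" 1] pos le1 by simp
      then show "norm (indicator {-1..t} v *\<^sub>R (exp v * ?g v)) \<le> norm (indicator {-1..t} v *\<^sub>R exp t)"
        using pos by (auto simp: indicator_def)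
    qed
  qed measurable
  show "(\<lambda>v. exp v * ?g v) integrable_on {-1..t}"
    by (rule set_borel_integral_eq_integral(1)[OF si])
  have split: "ennreal (exp s * finite_prob s) =
    (\<integral>\<^sup>+ v. ennreal (exp v * ?g v) * indicator {..s} v \<partial>lborel)" for s
  proof -
    have "ennreal (exp s * finite_prob s) = ennreal (exp s) *
        (\<integral>\<^sup>+ v. ennreal (exp (v - s) * ?g v) * indicator {..s} v \<partial>lborel)"
      by (simp add: ennreal_mult finite_prob_bounds finite_prob_convolution[of s, symmetric])
    also have "\<dots> = (\<integral>\<^sup>+ v. ennreal (exp s) * (ennreal (exp (v - s) * ?g v) * indicator {..s} v) \<partial>lborel)"
      by (rule nn_integral_cmult[symmetric]) measurable
    also have "\<dots> = (\<integral>\<^sup>+ v. ennreal (exp v * ?g v) * indicator {..s} v \<partial>lborel)"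
      using pos by (intro nn_integral_cong)
        (auto simp: indicator_def ennreal_mult[symmetric] exp_diff)
    finally show ?thesis .
  qed
  have "ennreal (exp t * finite_prob t)
      = (\<integral>\<^sup>+ v. ennreal (exp v * ?g v) * indicator {..-1} v + ennreal (exp v * ?g v) * indicator {-1<..t} v \<partial>lborel)"
    unfolding split using assms by (intro nn_integral_cong) (auto simp: indicator_def)
  also have "\<dots> = ennreal (exp (-1) * finite_prob (-1)) + (\<integral>\<^sup>+ v. ennreal (exp v * ?g v) * indicator {-1<..t} v \<partial>lborel)"
    unfolding split by (rule nn_integral_add) measurable
  also have "(\<integral>\<^sup>+ v. ennreal (exp v * ?g v) * indicator {-1<..t} v \<partial>lborel)
      = (\<integral>\<^sup>+ v. ennreal (indicator {-1..t} v *\<^sub>R (exp v * ?g v)) \<partial>lborel)"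
    using AE_lborel_singleton[of "-1::real"]
    by (intro nn_integral_cong_AE) (auto simp: indicator_def elim!: eventually_mono)
  also have "\<dots> = ennreal (LINT v : {-1..t} | lborel. exp v * ?g v)"
    using si pos unfolding set_integrable_def set_lebesgue_integral_def
    by (intro nn_integral_eq_integral) (auto simp: indicator_def)
  also have "(LINT v : {-1..t} | lborel. exp v * ?g v) = integral {-1..t} (\<lambda>v. exp v * ?g v)"
    by (rule set_borel_integral_eq_integral(2)[OF si])
  finally have "ennreal (exp t * finite_prob t)
    = ennreal (exp (-1) + integral {-1..t} (\<lambda>v. exp v * ?g v))"
    using pos by (simp add: finite_prob_neg Henstock_Kurzweil_Integration.integral_nonneg
      \<open>(\<lambda>v. exp v * ?g v) integrable_on {-1..t}\<close>)
  then show "exp t * finite_prob t = exp (-1) + integral {-1..t} (\<lambda>v. exp v * ?g v)"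
    using finite_prob_bounds[of t] pos
    by (subst (asm) ennreal_inj)
       (auto intro!: add_nonneg_nonneg Henstock_Kurzweil_Integration.integral_nonneg
          \<open>(\<lambda>v. exp v * ?g v) integrable_on {-1..t}\<close>)
qed

lemma finite_prob_eq:
  "-1 \<le> t \<Longrightarrow> finite_prob t =
     exp (- t) * (exp (-1) + integral {-1..t} (\<lambda>v. exp v * gen_fun (finite_prob v)))"
  using finite_prob_integral(2)[of t] by (simp add: exp_minus field_simps)

lemma continuous_finite_prob: "continuous_on {-1..T} finite_prob"
proof (cases "-1 \<le> T")
  case True
  have "continuous_on {-1..T} (\<lambda>t. exp (- t) *
      (exp (-1) + integral {-1..t} (\<lambda>v. exp v * gen_fun (finite_prob v))))"
    using finite_prob_integral(1)[OF True]
    by (intro continuous_intros indefinite_integral_continuous_1)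
  then show ?thesis by (rule continuous_on_eq) (simp add: finite_prob_eq[symmetric])
qed simp

lemma continuous_gen_finite: "continuous_on {-1..T} (\<lambda>t. gen_fun (finite_prob t))"
  by (rule continuous_on_compose2[OF continuous_gen_fun continuous_finite_prob])
     (auto simp: finite_prob_bounds)

lemma DERIV_finite_prob:
  assumes "-1 < t"
  shows "(finite_prob has_real_derivative gen_fun (finite_prob t) - finite_prob t) (at t)"
proof -
  let ?g = "\<lambda>v. exp v * gen_fun (finite_prob v)"
  let ?F = "\<lambda>t. exp (- t) * (exp (-1) + integral {-1..t} ?g)"
  have cont: "continuous_on {-1..t + 1} ?g"
    by (intro continuous_intros continuous_gen_finite)
  have "((\<lambda>x. integral {-1..x} ?g) has_real_derivative ?g t) (at t within {-1..t+1})"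
    using assms by (intro integral_has_real_derivative cont) auto
  then have "(?F has_real_derivative - ?F t + gen_fun (finite_prob t)) (at t within {-1..t+1})"
    by (auto intro!: derivative_eq_intros simp: exp_minus algebra_simps)
  then have "(finite_prob has_real_derivative - finite_prob t + gen_fun (finite_prob t)) (at t within {-1..t+1})"
    unfolding finite_prob_eq[of t, OF less_imp_le[OF assms], symmetric]
    by (rule has_field_derivative_transform_within[where d=1])
       (use assms in \<open>auto simp: finite_prob_eq[symmetric]\<close>)
  moreover have "at t within {-1..t+1} = at t"
    using assms by (intro at_within_interior) simp
  ultimately show ?thesis by simp
qed

text \<open>Otherwise the derivative \<open>f(F) - F\<close> would be positive, but \<open>F\<close> decreases.\<close>

lemma gen_finite_le: "-1 < t \<Longrightarrow> gen_fun (finite_prob t) \<le> finite_prob t"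
proof (rule ccontr)
  assume t: "-1 < t" and "\<not> gen_fun (finite_prob t) \<le> finite_prob t"
  then obtain d where "d > 0" "\<forall>h>0. h < d \<longrightarrow> finite_prob t < finite_prob (t + h)"
    using DERIV_pos_inc_right[OF DERIV_finite_prob[OF t]] by auto
  then have "finite_prob t < finite_prob (t + d/2)" by simp
  then show False using antimono_finite_prob \<open>d > 0\<close> by (auto simp: antimono_def not_le[symmetric])
qed

text \<open>Harris' criterion. Suppose that \<open>F\<close> leaves the value 1 at time \<open>t0\<close>. Since
  \<open>F' = f(F) - F\<close>, the substitution \<open>s = F(t)\<close> turns the integral of \<open>1 / (s - f(s))\<close> over
  \<open>[F(t2), 1]\<close> into one over \<open>[t0, t2]\<close> with an integrand of at most 1, so it is finite for
  every \<open>t2 > t0\<close>.\<close>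

lemma finite_prob_eq_1:
  assumes harris: "\<forall>\<^sub>F \<epsilon> in at_right (0::real).
      (\<integral>\<^sup>+ s\<in>{1 - \<epsilon>..1}. ennreal (1 / (s - gen_fun s)) \<partial>lborel) = \<infinity>"
  shows "finite_prob T = 1"
proof (rule ccontr)
  assume T: "finite_prob T \<noteq> 1"
  then have "0 < T" using finite_prob_neg[of T] by (cases "T \<le> 0") auto
  obtain b where b: "b > 0" "\<And>\<epsilon>. 0 < \<epsilon> \<Longrightarrow> \<epsilon> < b \<Longrightarrow>
      (\<integral>\<^sup>+ s\<in>{1 - \<epsilon>..1}. ennreal (1 / (s - gen_fun s)) \<partial>lborel) = \<infinity>"
    using harris unfolding eventually_at_right_field by blast
  define Z where "Z = {t \<in> {0..T}. finite_prob t = 1}"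
  have "closed Z" unfolding Z_def
    by (intro continuous_closed_preimage_constant continuous_on_subset[OF continuous_finite_prob[of T]]) auto
  moreover have "0 \<in> Z" using \<open>0 < T\<close> by (simp add: Z_def finite_prob_neg)
  moreover have bdd: "bdd_above Z" by (auto simp: Z_def bdd_above_def)
  ultimately have "Sup Z \<in> Z" using closed_contains_Sup[of Z] by blast
  \<comment> \<open>t0 is the last time at which F equals 1\<close>
  define t0 where "t0 = Sup Z"
  have t0: "0 \<le> t0" "t0 \<le> T" "finite_prob t0 = 1" using \<open>Sup Z \<in> Z\<close> by (auto simp: Z_def t0_def)
  have "t0 < T" using t0 T by (cases "t0 = T") auto
  have lt1: "finite_prob t < 1" if "t0 < t" "t \<le> T" for t
  proof -
    have "t \<notin> Z" using that bdd cSup_upper[of t Z] by (auto simp: t0_def)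
    then show ?thesis using that t0 finite_prob_bounds(2)[of t] by (auto simp: Z_def)
  qed
  have "isCont finite_prob t0"
    using DERIV_finite_prob[of t0] t0 by (auto intro: DERIV_isCont)
  then have "\<forall>\<^sub>F t in at t0. dist (finite_prob t) (finite_prob t0) < b"
    using b(1) unfolding isCont_def tendsto_iff by blast
  then obtain d where d: "d > 0" "\<And>t. t \<noteq> t0 \<Longrightarrow> dist t t0 < d \<Longrightarrow> dist (finite_prob t) 1 < b"
    unfolding eventually_at using t0 by auto
  define t2 where "t2 = min T (t0 + d / 2)"
  have t2: "t0 < t2" "t2 \<le> T" using \<open>t0 < T\<close> d by (auto simp: t2_def)
  have "dist (finite_prob t2) 1 < b"
    using d t2 by (intro d) (auto simp: t2_def dist_real_def)
  then have "1 - finite_prob t2 < b" "0 < 1 - finite_prob t2"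
    using lt1[OF t2] by (auto simp: dist_real_def)
  then have inf: "(\<integral>\<^sup>+ s\<in>{finite_prob t2..1}. ennreal (1 / (s - gen_fun s)) \<partial>lborel) = \<infinity>"
    using b(2)[of "1 - finite_prob t2"] by simp
  let ?h = "\<lambda>s. 1 / (s - gen_fun s)"
  \<comment> \<open>time is reversed, as the substitution has to be increasing\<close>
  let ?G = "\<lambda>t. finite_prob (- t)"
  let ?G' = "\<lambda>t. ?G t - gen_fun (?G t)"
  have sub: "{finite_prob t2..1} \<subseteq> {0..1}" using finite_prob_bounds by auto
  have "(\<integral>\<^sup>+ s. ?h s * indicator {?G (- t2)..?G (- t0)} s \<partial>lborel)
      = (\<integral>\<^sup>+ t. ?h (?G t) * ?G' t * indicator {- t2..- t0} t \<partial>lborel)"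
  proof (rule nn_integral_substitution)
    have "continuous_on {finite_prob t2..1} gen_fun"
      using continuous_gen_fun sub by (rule continuous_on_subset)
    then have m: "set_borel_measurable borel {finite_prob t2..1} gen_fun"
      unfolding set_borel_measurable_def by (intro borel_measurable_continuous_on_indicator) auto
    have "(\<lambda>x. indicator {finite_prob t2..1} x * (1 / (x - indicator {finite_prob t2..1} x *\<^sub>R gen_fun x)))
        \<in> borel_measurable borel"
      by (intro borel_measurable_times borel_measurable_divide borel_measurable_diff
          borel_measurable_const borel_measurable_indicator m[unfolded set_borel_measurable_def]
          measurable_ident_sets refl) simp
    also have "(\<lambda>x. indicator {finite_prob t2..1} x * (1 / (x - indicator {finite_prob t2..1} x *\<^sub>R gen_fun x)))
      = (\<lambda>x. indicator {finite_prob t2..1} x *\<^sub>R ?h x)"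
      by (auto simp: indicator_def)
    finally show "set_borel_measurable borel {?G (- t2)..?G (- t0)} ?h"
      using t0 by (simp add: set_borel_measurable_def)
    show "(?G has_real_derivative ?G' t) (at t)" if "t \<in> {- t2..- t0}" for t
    proof -
      have "\<not> 0 < t" using that t0 by auto
      then have "((\<lambda>t. finite_prob (- t)) has_real_derivative
          (gen_fun (finite_prob (- t)) - finite_prob (- t)) * (- 1)) (at t)"
        by (intro DERIV_chain2[OF DERIV_finite_prob]) (auto intro!: derivative_eq_intros)
      then show ?thesis by simp
    qed
    have "continuous_on {- t2..- t0} ?G"
      using t0 by (intro continuous_on_compose2[OF continuous_finite_prob[of t2]] continuous_intros) auto
    moreover have "continuous_on {- t2..- t0} (\<lambda>t. gen_fun (?G t))"
      using t0 by (intro continuous_on_compose2[OF continuous_gen_finite[of t2]] continuous_intros) auto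
    ultimately show "continuous_on {- t2..- t0} ?G'" by (rule continuous_on_diff)
    show "0 \<le> ?G' t" if "t \<in> {- t2..- t0}" for t
      using gen_finite_le[of "- t"] that t0 by auto
    show "- t2 \<le> - t0" using t2 by simp
  qed
  also have "\<dots> \<le> (\<integral>\<^sup>+ t. indicator {- t2..- t0} t \<partial>lborel)"
  proof (rule nn_integral_mono)
    fix t :: real
    \<comment> \<open>the integrand is 1, except that division by zero may give 0\<close>
    have "1 / x * x \<le> 1" for x :: real by (cases "x = 0") auto
    then have "ennreal (?h (?G t) * ?G' t) \<le> 1" by (simp only: ennreal_le_1)
    then show "ennreal (?h (?G t) * ?G' t * indicator {- t2..- t0} t) \<le> indicator {- t2..- t0} t"
      by (cases "t \<in> {- t2..- t0}") (auto simp: indicator_def)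
  qed
  also have "\<dots> < \<infinity>" using t2 by simp
  finally have "(\<integral>\<^sup>+ s. ?h s * indicator {finite_prob t2..1} s \<partial>lborel) < \<infinity>" using t0 by simp
  moreover have "(\<integral>\<^sup>+ s. ?h s * indicator {finite_prob t2..1} s \<partial>lborel)
     = (\<integral>\<^sup>+ s\<in>{finite_prob t2..1}. ennreal (?h s) \<partial>lborel)"
  proof (rule nn_integral_cong)
    fix s :: real
    show "ennreal (?h s * indicator {finite_prob t2..1} s) = ennreal (?h s) * indicator {finite_prob t2..1} s"
      by (cases "s \<in> {finite_prob t2..1}") (auto simp: indicator_def)
  qed
  ultimately show False using inf by simp
qed

theorem AE_finite_past:
  assumes "\<forall>\<^sub>F \<epsilon> in at_right (0::real).
      (\<integral>\<^sup>+ s\<in>{1 - \<epsilon>..1}. ennreal (1 / (s - gen_fun s)) \<partial>lborel) = \<infinity>"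
  shows "AE w in \<Omega>. \<forall>t. finite (past t w)"
proof -
  have "AE w in \<Omega>. finite (past (real n) w)" for n
    using finite_prob_eq_1[OF assms, of "real n"] finite_past_sets[of "real n"]
      \<Omega>.prob_Collect_eq_1[of "\<lambda>w. finite (past (real n) w)"]
    unfolding finite_prob_def by (simp only: pred_def simp_thms)
  then have "AE w in \<Omega>. \<forall>n. finite (past (real n) w)" by (simp only: AE_all_countable simp_thms)
  moreover have "finite (past t w)" if "\<forall>n. finite (past (real n) w)" for w t
  proof -
    obtain n where "t \<le> real n" using real_arch_simple by blast
    then have "past t w \<subseteq> past (real n) w" by (rule past_mono)
    then show ?thesis using that finite_subset by blast
  qed
  ultimately show ?thesis by (auto elim!: eventually_mono)
qed

end

section \<open>Sums of martingale differences indexed by the tree\<close>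

lemma powr_le_affine:
  fixes u :: real
  assumes "0 < a" "a \<le> 1" "0 \<le> u"
  shows "u powr a \<le> 1 + a * (u - 1)"
proof (cases "u = 0")
  case False
  then show ?thesis
    using Youngs_inequality_0[of a "1 - a" u 1] assms by (simp add: algebra_simps)
qed (use assms in auto)

lemma abs_mult_le_squares: "\<bar>a * b\<bar> \<le> a\<^sup>2 + (b::real)\<^sup>2"
proof -
  have "0 \<le> (\<bar>a\<bar> - \<bar>b\<bar>)\<^sup>2" by simp
  then have "2 * (\<bar>a\<bar> * \<bar>b\<bar>) \<le> a\<^sup>2 + b\<^sup>2" by (simp add: power2_diff)
  moreover have "0 \<le> \<bar>a\<bar> * \<bar>b\<bar>" by simp
  ultimately show ?thesis unfolding abs_mult by linarith
qed

text \<open>The \<open>p\<close>-th power lies below its linear expansion at \<open>a\<close> up to a multiple of \<open>\<bar>b\<bar>^p\<close>. If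
  \<open>\<bar>b\<bar> \<le> \<bar>a\<bar>\<close>, factor out \<open>a\<close> and apply Bernoulli's inequality with exponent \<open>p - 1\<close>. Otherwise
  the left-hand side is at most \<open>4 \<bar>b\<bar>^p\<close> and the linear term at least \<open>- 2 \<bar>b\<bar>^p\<close>, whence the
  constant 6.\<close>

lemma abs_add_powr_le:
  fixes a b p :: real
  assumes p: "1 < p" "p \<le> 2"
  shows "\<bar>a + b\<bar> powr p \<le> \<bar>a\<bar> powr p + p * (sgn a * \<bar>a\<bar> powr (p - 1)) * b + 6 * \<bar>b\<bar> powr p"
proof (cases "\<bar>b\<bar> \<le> \<bar>a\<bar>")
  case True
  show ?thesis
  proof (cases "a = 0")
    case False
    define y where "y = b / a"
    have y: "\<bar>y\<bar> \<le> 1" "b = a * y" using True False by (auto simp: y_def abs_divide)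
    have u: "0 \<le> 1 + y" using y by linarith
    have "(1 + y) powr p = (1 + y) * (1 + y) powr (p - 1)"
      using u p powr_mult_base[of "1 + y" "p - 1"] by simp
    also have "\<dots> \<le> (1 + y) * (1 + (p - 1) * y)"
      using powr_le_affine[of "p - 1" "1 + y"] p u by (intro mult_left_mono) auto
    also have "\<dots> = 1 + p * y + (p - 1) * y\<^sup>2" by (simp add: power2_eq_square algebra_simps)
    also have "(p - 1) * y\<^sup>2 \<le> 6 * \<bar>y\<bar> powr p"
    proof -
      have "y\<^sup>2 \<le> \<bar>y\<bar> powr p"
      proof (cases "y = 0")
        case False
        then have "\<bar>y\<bar> powr 2 \<le> \<bar>y\<bar> powr p"
          using y p by (intro powr_mono') auto
        then show ?thesis using False by (simp add: powr_numeral)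
      qed simp
      moreover have "(p - 1) * y\<^sup>2 \<le> 1 * y\<^sup>2" using p by (intro mult_right_mono) auto
      moreover have "0 \<le> \<bar>y\<bar> powr p" by simp
      ultimately show ?thesis by linarith
    qed
    finally have "(1 + y) powr p \<le> 1 + p * y + 6 * \<bar>y\<bar> powr p" by simp
    then have "\<bar>a\<bar> powr p * (1 + y) powr p \<le> \<bar>a\<bar> powr p * (1 + p * y + 6 * \<bar>y\<bar> powr p)"
      by (intro mult_left_mono) auto
    moreover have "\<bar>a + b\<bar> powr p = \<bar>a\<bar> powr p * (1 + y) powr p"
    proof -
      have "a + b = a * (1 + y)" using y by (simp add: algebra_simps)
      then have "\<bar>a + b\<bar> = \<bar>a\<bar> * (1 + y)" using u by (simp add: abs_mult)
      then show ?thesis using u by (simp add: powr_mult)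
    qed
    moreover have "\<bar>b\<bar> powr p = \<bar>a\<bar> powr p * \<bar>y\<bar> powr p"
      using y by (simp add: abs_mult powr_mult)
    moreover have "sgn a * \<bar>a\<bar> powr (p - 1) * b = \<bar>a\<bar> powr p * y"
    proof -
      have "\<bar>a\<bar> powr p = \<bar>a\<bar> * \<bar>a\<bar> powr (p - 1)" using False powr_mult_base[of "\<bar>a\<bar>" "p - 1"] by simp
      then show ?thesis using y by (simp add: abs_sgn algebra_simps)
    qed
    then have "p * (sgn a * \<bar>a\<bar> powr (p - 1)) * b = p * (\<bar>a\<bar> powr p * y)"
      by (simp only: mult.assoc)
    ultimately show ?thesis by (simp only: distrib_left mult_1_right mult_ac)
  qed (use True in simp)
next
  case False
  then have b: "0 < \<bar>b\<bar>" "\<bar>a\<bar> \<le> \<bar>b\<bar>" by auto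
  have "\<bar>a + b\<bar> powr p \<le> (2 * \<bar>b\<bar>) powr p"
    using b p by (intro powr_mono2) auto
  also have "\<dots> = 2 powr p * \<bar>b\<bar> powr p" by (simp add: powr_mult)
  also have "\<dots> \<le> 4 * \<bar>b\<bar> powr p"
    using powr_mono[of p 2 2] p by (intro mult_right_mono) auto
  finally have 1: "\<bar>a + b\<bar> powr p \<le> 4 * \<bar>b\<bar> powr p" .
  have "\<bar>p * (sgn a * \<bar>a\<bar> powr (p - 1)) * b\<bar> \<le> 2 * (1 * \<bar>b\<bar> powr (p - 1)) * \<bar>b\<bar>"
    unfolding abs_mult using p powr_mono2[of "p - 1" "\<bar>a\<bar>" "\<bar>b\<bar>"] b
    by (intro mult_mono) (auto simp: sgn_if)
  also have "\<dots> = 2 * \<bar>b\<bar> powr p"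
    using powr_mult_base[of "\<bar>b\<bar>" "p - 1"] b by (simp add: mult.commute)
  finally have "- (2 * \<bar>b\<bar> powr p) \<le> p * (sgn a * \<bar>a\<bar> powr (p - 1)) * b" by linarith
  then show ?thesis using 1 by (smt (verit) powr_ge_zero)
qed

lemma powr_times_le:
  fixes a b p :: real
  assumes "1 < p" "0 \<le> a" "0 \<le> b"
  shows "a powr (p - 1) * b \<le> a powr p + b powr p"
proof -
  have "a powr (p - 1) * b \<le> max a b powr (p - 1) * max a b"
    using assms by (intro mult_mono powr_mono2) auto
  also have "\<dots> = max a b powr p"
    using assms powr_mult_base[of "max a b" "p - 1"] by (simp add: mult.commute)
  also have "\<dots> \<le> a powr p + b powr p" by (simp add: max_def)
  finally show ?thesis .
qed

context marked_branching
begin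

text \<open>The value at \<open>x\<close> ignores the marks of longer labels and of other labels of the same
  length, and averages to zero over the mark of \<open>x\<close>. Listed by nondecreasing length, such
  variables are martingale differences in the usual sense.\<close>

definition martingale_differences :: "(nat list \<Rightarrow> config \<Rightarrow> real) \<Rightarrow> bool" where
  "martingale_differences d \<longleftrightarrow> (\<forall>x. d x \<in> borel_measurable \<Omega>) \<and>
     (\<forall>x y w q. w \<in> space \<Omega> \<longrightarrow> q \<in> space Q \<longrightarrow> x \<noteq> y \<longrightarrow> length x \<le> length y \<longrightarrow>
        d x (w(y := q)) = d x w) \<and>
     (\<forall>x. \<forall>w\<in>space \<Omega>. (\<integral> q. d x (w(x := q)) \<partial>Q) = 0)"

text \<open>Averaging over the mark of \<open>x\<close> first gives zero, as the labels in \<open>S\<close> are not longer than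
  \<open>x\<close> and thus unaffected by this mark.\<close>

lemma expectation_past_times_difference:
  fixes \<phi> :: "real \<Rightarrow> real"
  assumes d: "martingale_differences d" and "finite S" "x \<notin> S" "\<And>y. y \<in> S \<Longrightarrow> length y \<le> length x"
    and int: "integrable \<Omega> (\<lambda>w. \<phi> (\<Sum>y\<in>S. d y w) * d x w)"
  shows "(\<integral> w. \<phi> (\<Sum>y\<in>S. d y w) * d x w \<partial>\<Omega>) = 0"
proof -
  have "(\<integral> w. \<phi> (\<Sum>y\<in>S. d y w) * d x w \<partial>\<Omega>)
      = (\<integral> w. \<integral> q. \<phi> (\<Sum>y\<in>S. d y (w(x := q))) * d x (w(x := q)) \<partial>Q \<partial>\<Omega>)"
    by (rule integral_resample[OF int])
  also have "\<dots> = (\<integral> w. \<integral> q. \<phi> (\<Sum>y\<in>S. d y w) * d x (w(x := q)) \<partial>Q \<partial>\<Omega>)"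
  proof (intro Bochner_Integration.integral_cong refl)
    fix w q assume wq: "w \<in> space \<Omega>" "q \<in> space Q"
    have "d y (w(x := q)) = d y w" if "y \<in> S" for y
    proof -
      have "y \<noteq> x" "length y \<le> length x" using that assms by auto
      then show ?thesis using d wq unfolding martingale_differences_def by blast
    qed
    then show "\<phi> (\<Sum>y\<in>S. d y (w(x := q))) * d x (w(x := q)) = \<phi> (\<Sum>y\<in>S. d y w) * d x (w(x := q))"
      by simp
  qed
  also have "\<dots> = (\<integral> w. 0 \<partial>\<Omega>)"
    using d by (intro Bochner_Integration.integral_cong) (auto simp: martingale_differences_def)
  finally show ?thesis by simp
qed

text \<open>The vertices are added one by one in the order of their generations. Each of them adds at
  most 6 times the \<open>p\<close>-th moment of its difference, because the linear term of \<open>abs_add_powr_le\<close>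
  has mean zero.\<close>

lemma von_Bahr_Esseen:
  assumes d: "martingale_differences d" and p: "1 < p" "p \<le> 2" and F: "finite F"
    and int: "\<And>x. x \<in> F \<Longrightarrow> integrable \<Omega> (\<lambda>w. \<bar>d x w\<bar> powr p)"
  shows "integrable \<Omega> (\<lambda>w. \<bar>\<Sum>x\<in>F. d x w\<bar> powr p) \<and>
    (\<integral> w. \<bar>\<Sum>x\<in>F. d x w\<bar> powr p \<partial>\<Omega>) \<le> 6 * (\<Sum>x\<in>F. \<integral> w. \<bar>d x w\<bar> powr p \<partial>\<Omega>)"
  using F int
proof (induction F rule: finite_ranking_induct[where f=length])
  case (insert x S)
  have [measurable]: "d y \<in> borel_measurable \<Omega>" for y using d by (simp add: martingale_differences_def)
  show ?case
  proof (cases "x \<in> S")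
    case True
    then show ?thesis using insert by (simp add: insert_absorb)
  next
    case False
    let ?S = "\<lambda>w. \<Sum>y\<in>S. d y w"
    let ?\<phi> = "\<lambda>a::real. sgn a * \<bar>a\<bar> powr (p - 1)"
    have intS: "integrable \<Omega> (\<lambda>w. \<bar>?S w\<bar> powr p)"
      and IH: "(\<integral> w. \<bar>?S w\<bar> powr p \<partial>\<Omega>) \<le> 6 * (\<Sum>x\<in>S. \<integral> w. \<bar>d x w\<bar> powr p \<partial>\<Omega>)"
      using insert by auto
    have intd: "integrable \<Omega> (\<lambda>w. \<bar>d x w\<bar> powr p)" using insert by auto
    have int\<phi>: "integrable \<Omega> (\<lambda>w. ?\<phi> (?S w) * d x w)"
    proof (rule Bochner_Integration.integrable_bound[OF Bochner_Integration.integrable_add[OF intS intd]])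
      show "AE w in \<Omega>. norm (?\<phi> (?S w) * d x w) \<le> norm (\<bar>?S w\<bar> powr p + \<bar>d x w\<bar> powr p)"
      proof (rule AE_I2)
        fix w
        have "norm (?\<phi> (?S w) * d x w) \<le> \<bar>?S w\<bar> powr (p - 1) * \<bar>d x w\<bar>"
          by (simp add: abs_mult sgn_if)
        also have "\<dots> \<le> \<bar>?S w\<bar> powr p + \<bar>d x w\<bar> powr p" using p by (intro powr_times_le) auto
        finally show "norm (?\<phi> (?S w) * d x w) \<le> norm (\<bar>?S w\<bar> powr p + \<bar>d x w\<bar> powr p)" by simp
      qed
    qed measurable
    have zero: "(\<integral> w. ?\<phi> (?S w) * d x w \<partial>\<Omega>) = 0"
      by (rule expectation_past_times_difference[OF d insert(1) False insert(2) int\<phi>])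
    have intB: "integrable \<Omega> (\<lambda>w. \<bar>?S w\<bar> powr p + p * (?\<phi> (?S w) * d x w) + 6 * \<bar>d x w\<bar> powr p)"
      using intS intd int\<phi> by auto
    have le: "\<bar>?S w + d x w\<bar> powr p \<le> \<bar>?S w\<bar> powr p + p * (?\<phi> (?S w) * d x w) + 6 * \<bar>d x w\<bar> powr p" for w
      using abs_add_powr_le[OF p, of "?S w" "d x w"] by (simp add: mult.assoc)
    have intSd: "integrable \<Omega> (\<lambda>w. \<bar>?S w + d x w\<bar> powr p)"
    proof (rule Bochner_Integration.integrable_bound[OF intB])
      show "AE w in \<Omega>. norm (\<bar>?S w + d x w\<bar> powr p) \<le>
          norm (\<bar>?S w\<bar> powr p + p * (?\<phi> (?S w) * d x w) + 6 * \<bar>d x w\<bar> powr p)"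
        using order_trans[OF le abs_ge_self] by (intro AE_I2) simp
    qed measurable
    have "(\<integral> w. \<bar>?S w + d x w\<bar> powr p \<partial>\<Omega>)
        \<le> (\<integral> w. \<bar>?S w\<bar> powr p + p * (?\<phi> (?S w) * d x w) + 6 * \<bar>d x w\<bar> powr p \<partial>\<Omega>)"
      by (intro integral_mono intSd intB le)
    also have "\<dots> = (\<integral> w. \<bar>?S w\<bar> powr p \<partial>\<Omega>) + 6 * (\<integral> w. \<bar>d x w\<bar> powr p \<partial>\<Omega>)"
      using intS intd int\<phi> zero by simp
    finally have "(\<integral> w. \<bar>?S w + d x w\<bar> powr p \<partial>\<Omega>)
        \<le> 6 * (\<Sum>x\<in>S. \<integral> w. \<bar>d x w\<bar> powr p \<partial>\<Omega>) + 6 * (\<integral> w. \<bar>d x w\<bar> powr p \<partial>\<Omega>)"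
      using IH by linarith
    moreover have "(\<Sum>y\<in>insert x S. d y w) = ?S w + d x w" for w
      using False insert(1) by simp
    moreover have "(\<Sum>y\<in>insert x S. \<integral> w. \<bar>d y w\<bar> powr p \<partial>\<Omega>)
        = (\<Sum>y\<in>S. \<integral> w. \<bar>d y w\<bar> powr p \<partial>\<Omega>) + (\<integral> w. \<bar>d x w\<bar> powr p \<partial>\<Omega>)"
      using False insert(1) by simp
    ultimately show ?thesis
      using intSd by (simp only: distrib_left simp_thms)
  qed
qed simp

text \<open>The differences are pairwise orthogonal.\<close>

lemma variance_sum:
  assumes d: "martingale_differences d" and F: "finite F"
    and int: "\<And>x. x \<in> F \<Longrightarrow> integrable \<Omega> (\<lambda>w. (d x w)\<^sup>2)"
  shows "integrable \<Omega> (\<lambda>w. (\<Sum>x\<in>F. d x w)\<^sup>2) \<and>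
    (\<integral> w. (\<Sum>x\<in>F. d x w)\<^sup>2 \<partial>\<Omega>) = (\<Sum>x\<in>F. \<integral> w. (d x w)\<^sup>2 \<partial>\<Omega>)"
  using F int
proof (induction F rule: finite_ranking_induct[where f=length])
  case (insert x S)
  have [measurable]: "d y \<in> borel_measurable \<Omega>" for y using d by (simp add: martingale_differences_def)
  show ?case
  proof (cases "x \<in> S")
    case True
    then show ?thesis using insert by (simp add: insert_absorb)
  next
    case False
    let ?S = "\<lambda>w. \<Sum>y\<in>S. d y w"
    have intS: "integrable \<Omega> (\<lambda>w. (?S w)\<^sup>2)" and intd: "integrable \<Omega> (\<lambda>w. (d x w)\<^sup>2)"
      using insert by auto
    have int2: "integrable \<Omega> (\<lambda>w. ?S w * d x w)"
    proof (rule Bochner_Integration.integrable_bound[OF Bochner_Integration.integrable_add[OF intS intd]])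
      show "AE w in \<Omega>. norm (?S w * d x w) \<le> norm ((?S w)\<^sup>2 + (d x w)\<^sup>2)"
        using abs_mult_le_squares by (intro AE_I2) (simp add: abs_of_nonneg)
    qed measurable
    have zero: "(\<integral> w. ?S w * d x w \<partial>\<Omega>) = 0"
      by (rule expectation_past_times_difference[OF d insert(1) False insert(2), of "\<lambda>a. a"])
         (assumption, rule int2)
    have "(\<lambda>w. (\<Sum>y\<in>insert x S. d y w)\<^sup>2) = (\<lambda>w. (?S w)\<^sup>2 + 2 * (?S w * d x w) + (d x w)\<^sup>2)"
      using False insert(1) by (simp add: power2_eq_square algebra_simps)
    moreover have "(\<integral> w. (?S w)\<^sup>2 \<partial>\<Omega>) = (\<Sum>x\<in>S. \<integral> w. (d x w)\<^sup>2 \<partial>\<Omega>)"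
      using insert(3,4) by auto
    ultimately show ?thesis
      using intS intd int2 zero insert(1) False by simp
  qed
qed simp

end

section \<open>Infinite sums of martingale differences\<close>

lemma nn_integral_limit_le:
  fixes Y :: "nat \<Rightarrow> 'a \<Rightarrow> real"
  assumes [measurable]: "\<And>n. Y n \<in> borel_measurable M"
    and lim: "AE w in M. (\<lambda>n. Y n w) \<longlonglongrightarrow> Z w"
    and le: "\<And>n. (\<integral>\<^sup>+ w. ennreal (Y n w) \<partial>M) \<le> K"
  shows "(\<integral>\<^sup>+ w. ennreal (Z w) \<partial>M) \<le> K"
proof -
  have "(\<integral>\<^sup>+ w. ennreal (Z w) \<partial>M) = (\<integral>\<^sup>+ w. liminf (\<lambda>n. ennreal (Y n w)) \<partial>M)"
    using lim
    by (intro nn_integral_cong_AE, eventually_elim)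
       (auto intro!: lim_imp_Liminf[symmetric] tendsto_ennrealI)
  also have "\<dots> \<le> liminf (\<lambda>n. \<integral>\<^sup>+ w. ennreal (Y n w) \<partial>M)"
    by (rule nn_integral_liminf) measurable
  also have "\<dots> \<le> liminf (\<lambda>n. K)"
    by (intro Liminf_mono) (simp add: le)
  finally show ?thesis by (simp add: Liminf_const)
qed

lemma abs_le_add_square_divide:
  fixes y :: real assumes "0 < \<delta>" shows "\<bar>y\<bar> \<le> \<delta> + y\<^sup>2 / \<delta>"
proof (cases "\<bar>y\<bar> \<le> \<delta>")
  case False
  then have "\<bar>y\<bar> * \<delta> \<le> \<bar>y\<bar> * \<bar>y\<bar>" by (intro mult_left_mono) auto
  then have "\<bar>y\<bar> \<le> y\<^sup>2 / \<delta>" using assms by (simp add: pos_le_divide_eq power2_eq_square)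
  then show ?thesis using assms by linarith
next
  case True
  moreover have "0 \<le> y\<^sup>2 / \<delta>" using assms by simp
  ultimately show ?thesis by linarith
qed

text \<open>The coefficient of \<open>x\<^sup>2\<close> can be chosen arbitrarily close to 1, at the price of a large
  coefficient of \<open>(x - s)\<^sup>2\<close>.\<close>

lemma square_le_weighted:
  fixes x s :: real assumes "0 < \<epsilon>"
  shows "s\<^sup>2 \<le> (1 + \<epsilon>) * x\<^sup>2 + (1 + 1 / \<epsilon>) * (x - s)\<^sup>2"
proof -
  have "0 \<le> (\<epsilon> * x + (x - s))\<^sup>2 / \<epsilon>" using assms by simp
  also have "\<dots> = \<epsilon> * x\<^sup>2 + 2 * x * (x - s) + (x - s)\<^sup>2 / \<epsilon>"
    using assms by (simp add: field_simps power2_eq_square)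
  finally have "0 \<le> \<epsilon> * x\<^sup>2 + 2 * x * (x - s) + (x - s)\<^sup>2 / \<epsilon>" .
  moreover have "s\<^sup>2 = x\<^sup>2 - 2 * x * (x - s) + (x - s)\<^sup>2" by (simp add: power2_eq_square algebra_simps)
  moreover have "(1 + \<epsilon>) * x\<^sup>2 + (1 + 1 / \<epsilon>) * (x - s)\<^sup>2
      = x\<^sup>2 + \<epsilon> * x\<^sup>2 + (x - s)\<^sup>2 + (x - s)\<^sup>2 / \<epsilon>"
    by (simp only: distrib_right mult_1_left add.assoc times_divide_eq_left)
  ultimately show ?thesis by linarith
qed

context marked_branching
begin

abbreviation vsum :: "(nat list \<Rightarrow> config \<Rightarrow> real) \<Rightarrow> nat \<Rightarrow> config \<Rightarrow> real" where
  "vsum d n w \<equiv> (\<Sum>i<n. d (list_decode i) w)"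

lemma sum_list_decode: "(\<Sum>i\<in>I. f (list_decode i)) = sum f (list_decode ` I)"
  by (subst sum.reindex) (auto intro: inj_list_decode)

text \<open>The bound holds for all finite sets of vertices, hence for the partial sums of any
  enumeration, and passes to the limit by Fatou's lemma.\<close>

lemma moment_vertex_series:
  assumes d: "martingale_differences d" and p: "1 < p" "p \<le> 2"
    and int: "\<And>x. integrable \<Omega> (\<lambda>w. \<bar>d x w\<bar> powr p)"
    and lim: "AE w in \<Omega>. (\<lambda>n. vsum d n w) \<longlonglongrightarrow> X w"
  shows "(\<integral>\<^sup>+ w. ennreal (\<bar>X w\<bar> powr p) \<partial>\<Omega>)
    \<le> 6 * (\<Sum>i. \<integral>\<^sup>+ w. ennreal (\<bar>d (list_decode i) w\<bar> powr p) \<partial>\<Omega>)"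
proof (rule nn_integral_limit_le)
  have [measurable]: "d x \<in> borel_measurable \<Omega>" for x using d by (simp add: martingale_differences_def)
  show "(\<lambda>w. \<bar>vsum d n w\<bar> powr p) \<in> borel_measurable \<Omega>" for n by measurable
  show "AE w in \<Omega>. (\<lambda>n. \<bar>vsum d n w\<bar> powr p) \<longlonglongrightarrow> \<bar>X w\<bar> powr p"
    using lim
  proof eventually_elim
    case (elim w)
    have "continuous_on {0..} (\<lambda>x::real. x powr p)"
      using p by (intro continuous_on_powr') auto
    then show ?case
      using continuous_on_tendsto_compose[of "{0..}" "\<lambda>x. x powr p" "\<lambda>n. \<bar>vsum d n w\<bar>" "\<bar>X w\<bar>" sequentially]
        tendsto_rabs[OF elim] by auto
  qed
  fix n
  have vB: "integrable \<Omega> (\<lambda>w. \<bar>vsum d n w\<bar> powr p) \<and>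
     (\<integral> w. \<bar>vsum d n w\<bar> powr p \<partial>\<Omega>) \<le> 6 * (\<Sum>i<n. \<integral> w. \<bar>d (list_decode i) w\<bar> powr p \<partial>\<Omega>)"
    using von_Bahr_Esseen[OF d p finite_imageI[OF finite_lessThan] int, of list_decode n]
    unfolding sum_list_decode[symmetric] .
  have "(\<integral>\<^sup>+ w. ennreal (\<bar>vsum d n w\<bar> powr p) \<partial>\<Omega>) = ennreal (\<integral> w. \<bar>vsum d n w\<bar> powr p \<partial>\<Omega>)"
    using vB by (intro nn_integral_eq_integral) auto
  also have "\<dots> \<le> ennreal (6 * (\<Sum>i<n. \<integral> w. \<bar>d (list_decode i) w\<bar> powr p \<partial>\<Omega>))"
    using vB by (intro ennreal_leI) auto
  also have "\<dots> = 6 * (\<Sum>i<n. \<integral>\<^sup>+ w. ennreal (\<bar>d (list_decode i) w\<bar> powr p) \<partial>\<Omega>)"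
    using int by (simp add: ennreal_mult nn_integral_eq_integral sum_nonneg)
  also have "\<dots> \<le> 6 * (\<Sum>i. \<integral>\<^sup>+ w. ennreal (\<bar>d (list_decode i) w\<bar> powr p) \<partial>\<Omega>)"
    by (intro mult_left_mono sum_le_suminf) auto
  finally show "(\<integral>\<^sup>+ w. ennreal (\<bar>vsum d n w\<bar> powr p) \<partial>\<Omega>)
     \<le> 6 * (\<Sum>i. \<integral>\<^sup>+ w. ennreal (\<bar>d (list_decode i) w\<bar> powr p) \<partial>\<Omega>)" .
qed

text \<open>By orthogonality and Fatou's lemma, the mean square distance between \<open>X\<close> and the \<open>n\<close>-th
  partial sum is at most the tail of the series of variances. Hence first and second moments
  pass to the limit.\<close>

lemma vertex_series_L2:
  assumes d: "martingale_differences d" and X [measurable]: "X \<in> borel_measurable \<Omega>"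
    and int: "\<And>x. integrable \<Omega> (\<lambda>w. (d x w)\<^sup>2)"
    and sum: "(\<lambda>i. \<integral> w. (d (list_decode i) w)\<^sup>2 \<partial>\<Omega>) sums V"
    and lim: "AE w in \<Omega>. (\<lambda>n. vsum d n w) \<longlonglongrightarrow> X w"
  shows "integrable \<Omega> (\<lambda>w. (X w)\<^sup>2)" "(\<integral> w. (X w)\<^sup>2 \<partial>\<Omega>) = V"
    "integrable \<Omega> X" "(\<integral> w. X w \<partial>\<Omega>) = 0"
proof -
  have dm [measurable]: "d x \<in> borel_measurable \<Omega>" for x using d by (simp add: martingale_differences_def)
  define a where "a i = (\<integral> w. (d (list_decode i) w)\<^sup>2 \<partial>\<Omega>)" for i
  have a: "0 \<le> a i" for i by (simp add: a_def)
  have aV: "a sums V" using sum by (simp add: a_def[abs_def])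
  define tail where "tail n = V - sum a {..<n}" for n
  have tail0: "0 \<le> tail n" for n
    using aV a sum_le_suminf[of a "{..<n}"] by (auto simp: tail_def sums_iff)
  have tail_lim: "tail \<longlonglongrightarrow> 0"
    using tendsto_diff[OF tendsto_const[of V] aV[unfolded sums_def]] by (simp add: tail_def[abs_def])
  have var: "integrable \<Omega> (\<lambda>w. (\<Sum>i\<in>I. d (list_decode i) w)\<^sup>2)"
       "(\<integral> w. (\<Sum>i\<in>I. d (list_decode i) w)\<^sup>2 \<partial>\<Omega>) = sum a I" if "finite I" for I
    using variance_sum[OF d finite_imageI[OF that] int, of list_decode]
    unfolding sum_list_decode[symmetric] a_def by blast+
  have fatou: "(\<integral>\<^sup>+ w. ennreal ((X w - vsum d n w)\<^sup>2) \<partial>\<Omega>) \<le> ennreal (tail n)" for n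
  proof (rule nn_integral_limit_le)
    let ?Y = "\<lambda>m w. (vsum d (m + n) w - vsum d n w)\<^sup>2"
    show "?Y m \<in> borel_measurable \<Omega>" for m by measurable
    show "AE w in \<Omega>. (\<lambda>m. ?Y m w) \<longlonglongrightarrow> (X w - vsum d n w)\<^sup>2"
      using lim
    proof eventually_elim
      case (elim w)
      then have "(\<lambda>m. vsum d (m + n) w) \<longlonglongrightarrow> X w" by (rule LIMSEQ_ignore_initial_segment)
      then show ?case by (intro tendsto_intros)
    qed
    fix m
    have eq: "vsum d (m + n) w - vsum d n w = (\<Sum>i\<in>{n..<m+n}. d (list_decode i) w)" for w
    proof -
      have "{..<m+n} = {..<n} \<union> {n..<m+n}" by auto
      then show ?thesis by (simp add: sum.union_disjoint ivl_disj_int)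
    qed
    have "(\<integral>\<^sup>+ w. ennreal (?Y m w) \<partial>\<Omega>) = ennreal (sum a {n..<m+n})"
      unfolding eq using var[of "{n..<m+n}"] by (subst nn_integral_eq_integral) auto
    also have "sum a {n..<m+n} \<le> tail n"
    proof -
      have "{..<m+n} = {..<n} \<union> {n..<m+n}" by auto
      then have "sum a {..<m+n} = sum a {..<n} + sum a {n..<m+n}"
        by (simp add: sum.union_disjoint ivl_disj_int)
      moreover have "sum a {..<m+n} \<le> V" using tail0[of "m+n"] by (simp add: tail_def)
      ultimately show ?thesis by (simp add: tail_def)
    qed
    finally show "(\<integral>\<^sup>+ w. ennreal (?Y m w) \<partial>\<Omega>) \<le> ennreal (tail n)" by (simp add: ennreal_leI)
  qed
  have int_diff: "integrable \<Omega> (\<lambda>w. (X w - vsum d n w)\<^sup>2)"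
    and le_diff: "(\<integral> w. (X w - vsum d n w)\<^sup>2 \<partial>\<Omega>) \<le> tail n" for n
  proof -
    show i: "integrable \<Omega> (\<lambda>w. (X w - vsum d n w)\<^sup>2)"
      using fatou[of n] by (intro integrableI_bounded) (auto simp: less_top[symmetric] top_unique)
    show "(\<integral> w. (X w - vsum d n w)\<^sup>2 \<partial>\<Omega>) \<le> tail n"
      using fatou[of n] i tail0[of n] by (subst (asm) nn_integral_eq_integral) auto
  qed
  show intX2: "integrable \<Omega> (\<lambda>w. (X w)\<^sup>2)" using int_diff[of 0] by simp
  show intX: "integrable \<Omega> X" by (rule \<Omega>.square_integrable_imp_integrable[OF _ intX2]) simp
  \<comment> \<open>the case n = 0 of the previous bound gives the converse inequality\<close>
  have "V \<le> (1 + \<epsilon>) * (\<integral> w. (X w)\<^sup>2 \<partial>\<Omega>)" if \<epsilon>: "0 < \<epsilon>" for \<epsilon>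
  proof (rule LIMSEQ_le)
    show "(\<lambda>n. sum a {..<n}) \<longlonglongrightarrow> V" using aV by (simp add: sums_def)
    have "(\<lambda>n. (1 + \<epsilon>) * (\<integral> w. (X w)\<^sup>2 \<partial>\<Omega>) + (1 + 1 / \<epsilon>) * tail n)
        \<longlonglongrightarrow> (1 + \<epsilon>) * (\<integral> w. (X w)\<^sup>2 \<partial>\<Omega>) + (1 + 1 / \<epsilon>) * 0"
      by (intro tendsto_intros tail_lim)
    then show "(\<lambda>n. (1 + \<epsilon>) * (\<integral> w. (X w)\<^sup>2 \<partial>\<Omega>) + (1 + 1 / \<epsilon>) * tail n)
        \<longlonglongrightarrow> (1 + \<epsilon>) * (\<integral> w. (X w)\<^sup>2 \<partial>\<Omega>)" by simp
    show "\<exists>N. \<forall>n\<ge>N. sum a {..<n} \<le> (1 + \<epsilon>) * (\<integral> w. (X w)\<^sup>2 \<partial>\<Omega>) + (1 + 1 / \<epsilon>) * tail n"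
    proof (intro exI allI impI)
      fix n
      have "sum a {..<n} = (\<integral> w. (vsum d n w)\<^sup>2 \<partial>\<Omega>)" using var by simp
      also have "\<dots> \<le> (\<integral> w. (1 + \<epsilon>) * (X w)\<^sup>2 + (1 + 1 / \<epsilon>) * (X w - vsum d n w)\<^sup>2 \<partial>\<Omega>)"
        using var[of "{..<n}"] intX2 int_diff[of n] square_le_weighted[OF \<epsilon>]
        by (intro integral_mono) auto
      also have "\<dots> = (1 + \<epsilon>) * (\<integral> w. (X w)\<^sup>2 \<partial>\<Omega>) + (1 + 1 / \<epsilon>) * (\<integral> w. (X w - vsum d n w)\<^sup>2 \<partial>\<Omega>)"
        using intX2 int_diff[of n] by simp
      also have "\<dots> \<le> (1 + \<epsilon>) * (\<integral> w. (X w)\<^sup>2 \<partial>\<Omega>) + (1 + 1 / \<epsilon>) * tail n"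
        using \<epsilon> le_diff[of n] by (intro add_left_mono mult_left_mono) auto
      finally show "sum a {..<n} \<le> (1 + \<epsilon>) * (\<integral> w. (X w)\<^sup>2 \<partial>\<Omega>) + (1 + 1 / \<epsilon>) * tail n" .
    qed
  qed
  then have ev: "\<forall>\<^sub>F \<epsilon> in at_right 0. V \<le> (1 + \<epsilon>) * (\<integral> w. (X w)\<^sup>2 \<partial>\<Omega>)"
    unfolding eventually_at_filter by (intro always_eventually) simp
  have limV: "((\<lambda>\<epsilon>. (1 + \<epsilon>) * (\<integral> w. (X w)\<^sup>2 \<partial>\<Omega>)) \<longlongrightarrow> (1 + 0) * (\<integral> w. (X w)\<^sup>2 \<partial>\<Omega>)) (at_right 0)"
    by (intro tendsto_intros)
  have "V \<le> (1 + 0) * (\<integral> w. (X w)\<^sup>2 \<partial>\<Omega>)"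
    by (rule tendsto_lowerbound[OF limV ev]) simp
  then show "(\<integral> w. (X w)\<^sup>2 \<partial>\<Omega>) = V"
    using le_diff[of 0] by (simp add: tail_def)
  have intd: "integrable \<Omega> (d x)" for x
    by (rule \<Omega>.square_integrable_imp_integrable[OF _ int]) simp
  have zero: "(\<integral> w. d x w \<partial>\<Omega>) = 0" for x
    using expectation_past_times_difference[OF d, of "{}" x "\<lambda>_. 1"] intd by simp
  have "\<bar>\<integral> w. X w \<partial>\<Omega>\<bar> \<le> \<delta>" if \<delta>: "0 < \<delta>" for \<delta>
  proof (rule LIMSEQ_le_const)
    have "(\<lambda>n. \<delta> + tail n / \<delta>) \<longlonglongrightarrow> \<delta> + 0 / \<delta>"
      using \<delta> by (intro tendsto_intros tail_lim) auto
    then show "(\<lambda>n. \<delta> + tail n / \<delta>) \<longlonglongrightarrow> \<delta>" by simp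
    show "\<exists>N. \<forall>n\<ge>N. \<bar>\<integral> w. X w \<partial>\<Omega>\<bar> \<le> \<delta> + tail n / \<delta>"
    proof (intro exI allI impI)
      fix n
      have "(\<integral> w. X w \<partial>\<Omega>) = (\<integral> w. X w - vsum d n w \<partial>\<Omega>)"
        using intX intd zero by simp
      also have "\<bar>\<dots>\<bar> \<le> (\<integral> w. \<bar>X w - vsum d n w\<bar> \<partial>\<Omega>)" by (rule integral_abs_bound)
      also have "\<dots> \<le> (\<integral> w. \<delta> + (X w - vsum d n w)\<^sup>2 / \<delta> \<partial>\<Omega>)"
        using intX intd int_diff[of n] abs_le_add_square_divide[OF \<delta>]
        by (intro integral_mono) auto
      also have "\<dots> = \<delta> + (\<integral> w. (X w - vsum d n w)\<^sup>2 \<partial>\<Omega>) / \<delta>"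
        using int_diff[of n] by (simp add: \<Omega>.prob_space)
      also have "\<dots> \<le> \<delta> + tail n / \<delta>" using le_diff[of n] \<delta> by (simp add: divide_right_mono)
      finally show "\<bar>\<integral> w. X w \<partial>\<Omega>\<bar> \<le> \<delta> + tail n / \<delta>" .
    qed
  qed
  then have "\<bar>\<integral> w. X w \<partial>\<Omega>\<bar> \<le> 0" by (rule field_le_epsilon) simp
  then show "(\<integral> w. X w \<partial>\<Omega>) = 0" by simp
qed

section \<open>Convergence of the total reward\<close>

text \<open>The lifetime of \<open>x\<close> decides in which time window \<open>x\<close> dies, the other part of its mark
  decides what this death yields. The latter splits off, although the former need not be a
  product of a function of the lifetime and one of the other marks.\<close>

lemma nn_integral_resample_mark:
  assumes [measurable]: "H \<in> borel_measurable \<Omega>" "H' \<in> borel_measurable \<Omega>"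
      "\<And>w. w \<in> space \<Omega> \<Longrightarrow> k w \<in> borel_measurable borel" "h \<in> borel_measurable mark_space"
    and H: "\<And>w q. w \<in> space \<Omega> \<Longrightarrow> q \<in> space Q \<Longrightarrow> H (w(x := q)) = k w (fst q) * h (snd q)"
    and H': "\<And>w q. w \<in> space \<Omega> \<Longrightarrow> q \<in> space Q \<Longrightarrow> H' (w(x := q)) = k w (fst q)"
  shows "(\<integral>\<^sup>+ w. H w \<partial>\<Omega>) = (\<integral>\<^sup>+ w. H' w \<partial>\<Omega>) * (\<integral>\<^sup>+ r. h r \<partial>R)"
proof -
  have inner: "(\<integral>\<^sup>+ q. H (w(x := q)) \<partial>Q) = (\<integral>\<^sup>+ q. H' (w(x := q)) \<partial>Q) * (\<integral>\<^sup>+ r. h r \<partial>R)"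
    if w: "w \<in> space \<Omega>" for w
  proof -
    have [measurable]: "k w \<in> borel_measurable borel" using w by fact
    have "(\<integral>\<^sup>+ q. H (w(x := q)) \<partial>Q) = (\<integral>\<^sup>+ q. k w (fst q) * h (snd q) \<partial>Q)"
      using w by (intro nn_integral_cong H)
    also have "\<dots> = (\<integral>\<^sup>+ e. k w e \<partial>unit_exponential) * (\<integral>\<^sup>+ r. h r \<partial>R)"
      by (rule nn_integral_Q_times) measurable
    also have "(\<integral>\<^sup>+ e. k w e \<partial>unit_exponential) = (\<integral>\<^sup>+ q. k w (fst q) * 1 \<partial>Q)"
      by (subst nn_integral_Q_times) (auto simp: R.emeasure_space_1)
    also have "\<dots> = (\<integral>\<^sup>+ q. H' (w(x := q)) \<partial>Q)"
      using w by (intro nn_integral_cong) (simp add: H')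
    finally show ?thesis .
  qed
  have "(\<integral>\<^sup>+ w. H w \<partial>\<Omega>) = (\<integral>\<^sup>+ w. \<integral>\<^sup>+ q. H (w(x := q)) \<partial>Q \<partial>\<Omega>)"
    by (rule nn_integral_resample) fact
  also have "\<dots> = (\<integral>\<^sup>+ w. (\<integral>\<^sup>+ q. H' (w(x := q)) \<partial>Q) * (\<integral>\<^sup>+ r. h r \<partial>R) \<partial>\<Omega>)"
    by (intro nn_integral_cong inner)
  also have "\<dots> = (\<integral>\<^sup>+ w. \<integral>\<^sup>+ q. H' (w(x := q)) \<partial>Q \<partial>\<Omega>) * (\<integral>\<^sup>+ r. h r \<partial>R)"
  proof (rule nn_integral_multc)
    have "(\<lambda>p. H' ((snd p)(x := fst p))) \<in> borel_measurable (Q \<Otimes>\<^sub>M \<Omega>)"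
      using measurable_compose[OF measurable_upd assms(2), of x] by (simp add: split_beta')
    then have "(\<lambda>(w, q). H' (w(x := q))) \<in> borel_measurable (\<Omega> \<Otimes>\<^sub>M Q)"
      by (subst measurable_pair_swap_iff) (simp add: split_beta')
    then show "(\<lambda>w. \<integral>\<^sup>+ q. H' (w(x := q)) \<partial>Q) \<in> borel_measurable \<Omega>"
      by (rule Q.borel_measurable_nn_integral)
  qed
  also have "(\<integral>\<^sup>+ w. \<integral>\<^sup>+ q. H' (w(x := q)) \<partial>Q \<partial>\<Omega>) = (\<integral>\<^sup>+ w. H' w \<partial>\<Omega>)"
    by (rule nn_integral_resample[symmetric]) fact
  finally show ?thesis .
qed

lemma integral_Q_times:
  fixes f :: "real \<Rightarrow> real" and g :: "nat \<times> real \<times> (nat \<Rightarrow> real) \<Rightarrow> real"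
  assumes [measurable]: "f \<in> borel_measurable borel" and g: "integrable R g" and f: "\<And>e. \<bar>f e\<bar> \<le> B"
  shows "(\<integral> q. f (fst q) * g (snd q) \<partial>Q) = (\<integral> e. f e \<partial>unit_exponential) * (\<integral> r. g r \<partial>R)"
proof -
  have [measurable]: "g \<in> borel_measurable R" using g by auto
  have f': "integrable unit_exponential f"
    by (rule ex.integrable_const_bound[where B=B]) (auto simp: f)
  have int: "integrable (unit_exponential \<Otimes>\<^sub>M R) (\<lambda>q. f (fst q) * g (snd q))"
  proof (rule exR.Fubini_integrable)
    show "integrable unit_exponential (\<lambda>e. \<integral> r. norm (f (fst (e, r)) * g (snd (e, r))) \<partial>R)"
      using f' g by (simp add: abs_mult)
    show "AE e in unit_exponential. integrable R (\<lambda>r. f (fst (e, r)) * g (snd (e, r)))"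
      using g by simp
  qed measurable
  show ?thesis
    unfolding Q_def using exR.integral_fst'[OF int] by simp
qed

definition increment :: "real \<Rightarrow> real \<Rightarrow> nat list \<Rightarrow> config \<Rightarrow> real" where
  "increment s t x w = (if s < dies x w \<and> dies x w \<le> t then weight 1 x w * reward x w else 0)"

lemma measurable_increment [measurable]: "increment s t x \<in> borel_measurable \<Omega>"
  unfolding increment_def[abs_def] by measurable

lemma increment_limit:
  assumes "finite (past t w)" "s \<le> t"
  shows "(\<lambda>n. vsum (increment s t) n w) \<longlonglongrightarrow> total_reward t w - total_reward s w"
proof -
  let ?f = "\<lambda>x. exp (pos factor x w) * reward x w"
  have "(\<lambda>n. \<Sum>i<n. if list_decode i \<in> past t w - past s w then ?f (list_decode i) else 0)
      \<longlonglongrightarrow> sum ?f (past t w - past s w)"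
    using assms by (intro sum_eq_enumerated_limit) auto
  also have "sum ?f (past t w - past s w) = total_reward t w - total_reward s w"
    using assms past_mono[of s t w] by (simp add: Ctot_def sum_diff)
  also have "(\<lambda>n. \<Sum>i<n. if list_decode i \<in> past t w - past s w then ?f (list_decode i) else 0)
      = (\<lambda>n. vsum (increment s t) n w)"
    by (auto simp: increment_def dead_def weight_def intro!: sum.cong)
  finally show ?thesis .
qed

lemma martingale_differences_increment:
  assumes C: "integrable R (\<lambda>r. fst (snd r))" "(\<integral> r. fst (snd r) \<partial>R) = 0"
  shows "martingale_differences (increment s t)"
  unfolding martingale_differences_def
proof (intro conjI allI impI ballI)
  fix x y :: "nat list" and w q assume "x \<noteq> y" "length x \<le> length y"
  then show "increment s t x (w(y := q)) = increment s t x w"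
    by (simp add: increment_def dies_upd)
next
  fix x :: "nat list" and w :: config assume "w \<in> space \<Omega>"
  let ?f = "\<lambda>e. (if s < born x w + e \<and> born x w + e \<le> t then weight 1 x w else 0)"
  have "(\<integral> q. increment s t x (w(x := q)) \<partial>Q) = (\<integral> q. ?f (fst q) * fst (snd (snd q)) \<partial>Q)"
    by (intro Bochner_Integration.integral_cong) (auto simp: increment_def)
  also have "\<dots> = (\<integral> e. ?f e \<partial>unit_exponential) * (\<integral> r. fst (snd r) \<partial>R)"
    by (rule integral_Q_times[where g="\<lambda>r. fst (snd r)" and B="weight 1 x w"]) (use C in auto)
  finally show "(\<integral> q. increment s t x (w(x := q)) \<partial>Q) = 0" using C by simp
qed measurable

lemma weight_powr: "weight 1 x w powr p = weight p x w"
  by (simp add: weight_def powr_def)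

lemma moment_increment:
  "(\<integral>\<^sup>+ w. ennreal (\<bar>increment s t x w\<bar> powr p) \<partial>\<Omega>) =
    (\<integral>\<^sup>+ w. ennreal (if s < dies x w \<and> dies x w \<le> t then weight p x w else 0) \<partial>\<Omega>) *
    (\<integral>\<^sup>+ r. ennreal (\<bar>fst (snd r)\<bar> powr p) \<partial>R)"
  by (rule nn_integral_resample_mark[where x=x and
        k="\<lambda>w e. ennreal (if s < born x w + e \<and> born x w + e \<le> t then weight p x w else 0)"])
     (auto simp: increment_def abs_mult powr_mult weight_powr ennreal_mult)

text \<open>Vertices that die by time \<open>t\<close> may be discounted at any positive rate at the cost of a
  constant factor, here at the rate \<open>a = m(p) > \<Phi>(p)\<close>.\<close>

lemma integrable_moment_increment:
  assumes p: "integrable R (\<lambda>r. \<bar>fst (snd r)\<bar> powr p)" and "mom p < \<infinity>"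
  shows "integrable \<Omega> (\<lambda>w. \<bar>increment s t x w\<bar> powr p)"
proof -
  obtain a where a: "mom p = ennreal a" "0 \<le> a" using assms(2) by (cases "mom p") auto
  have "(\<integral>\<^sup>+ w. ennreal (weight p x w * exp (- a * born x w)) \<partial>\<Omega>) < \<infinity>"
  proof -
    have "(\<Sum>k. \<integral>\<^sup>+ w. ennreal (weight p (list_decode k) w * exp (- a * born (list_decode k) w)) \<partial>\<Omega>) < \<infinity>"
      using a by (intro suminf_weight_born_finite) (auto simp: ennreal_less_iff)
    moreover have "(\<integral>\<^sup>+ w. ennreal (weight p x w * exp (- a * born x w)) \<partial>\<Omega>)
       \<le> (\<Sum>k. \<integral>\<^sup>+ w. ennreal (weight p (list_decode k) w * exp (- a * born (list_decode k) w)) \<partial>\<Omega>)"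
      using sum_le_suminf[of "\<lambda>k. \<integral>\<^sup>+ w. ennreal (weight p (list_decode k) w * exp (- a * born (list_decode k) w)) \<partial>\<Omega>"
          "{list_encode x}"] by simp
    ultimately show ?thesis by simp
  qed
  then have fin: "(\<integral>\<^sup>+ w. ennreal (weight p x w * exp (- a * dies x w)) \<partial>\<Omega>) < \<infinity>"
    using a by (subst nn_integral_weight_dies) (auto simp: ennreal_mult_less_top)
  have "(\<integral>\<^sup>+ w. ennreal (if s < dies x w \<and> dies x w \<le> t then weight p x w else 0) \<partial>\<Omega>)
      \<le> (\<integral>\<^sup>+ w. ennreal (exp (a * t)) * ennreal (weight p x w * exp (- a * dies x w)) \<partial>\<Omega>)"
  proof (rule nn_integral_mono)
    fix w
    have "weight p x w \<le> exp (a * t) * (weight p x w * exp (- a * dies x w))" if "dies x w \<le> t"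
    proof -
      have "a * dies x w \<le> a * t" using mult_left_mono[OF that a(2)] .
      then have "1 \<le> exp (a * t) * exp (- a * dies x w)" by (simp add: exp_add[symmetric])
      then have "weight p x w * 1 \<le> weight p x w * (exp (a * t) * exp (- a * dies x w))"
        by (rule mult_left_mono) simp
      then show ?thesis by (simp add: mult_ac)
    qed
    then show "ennreal (if s < dies x w \<and> dies x w \<le> t then weight p x w else 0)
        \<le> ennreal (exp (a * t)) * ennreal (weight p x w * exp (- a * dies x w))"
      by (auto simp: ennreal_mult[symmetric] intro!: ennreal_leI)
  qed
  also have "\<dots> < \<infinity>" using fin by (subst nn_integral_cmult) (auto simp: ennreal_mult_less_top)
  finally show ?thesis
    using p unfolding integrable_iff_bounded
    by (auto simp: moment_increment ennreal_mult_less_top)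
qed

end

locale nonexplosive_branching = marked_branching +
  assumes AE_finite_past': "AE w in \<Omega>. \<forall>t. finite (past t w)"
begin

lemma AE_increment_limit:
  "s \<le> t \<Longrightarrow> AE w in \<Omega>. (\<lambda>n. vsum (increment s t) n w) \<longlonglongrightarrow> total_reward t w - total_reward s w"
  using AE_finite_past' by eventually_elim (auto intro: increment_limit)

text \<open>For vertices that die after \<open>s\<close>, the factor \<open>exp (\<kappa> (D(x) - s))\<close> is at least 1. The sum of
  \<open>exp (p V(x) + \<kappa> D(x))\<close> over the whole tree is integrable because \<open>\<Phi>(p) < - \<kappa>\<close>.\<close>

lemma moment_total_increment:
  assumes C: "integrable R (\<lambda>r. fst (snd r))" "(\<integral> r. fst (snd r) \<partial>R) = 0"
    and p: "1 < p" "p \<le> 2" "integrable R (\<lambda>r. \<bar>fst (snd r)\<bar> powr p)"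
    and \<kappa>: "0 < \<kappa>" "\<kappa> < 1" "mom p < ennreal (1 - \<kappa>)"
  shows "\<exists>K\<ge>0. \<forall>s t. s \<le> t \<longrightarrow>
    (\<integral>\<^sup>+ w. ennreal (\<bar>total_reward t w - total_reward s w\<bar> powr p) \<partial>\<Omega>) \<le> ennreal (K * exp (- \<kappa> * s))"
proof -
  let ?c = "\<integral>\<^sup>+ r. ennreal (\<bar>fst (snd r)\<bar> powr p) \<partial>R"
  let ?W = "\<Sum>k. \<integral>\<^sup>+ w. ennreal (weight p (list_decode k) w * exp (- (- \<kappa>) * dies (list_decode k) w)) \<partial>\<Omega>"
  have "?W = (\<Sum>k. \<integral>\<^sup>+ w. ennreal (weight p (list_decode k) w * exp (- (- \<kappa>) * born (list_decode k) w)) \<partial>\<Omega>)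
      * ennreal (1 / (1 + - \<kappa>))"
    using \<kappa> by (subst nn_integral_weight_dies) (auto simp: ennreal_suminf_multc)
  also have "\<dots> < \<infinity>"
    using suminf_weight_born_finite[of "- \<kappa>" p] \<kappa> by (auto simp: ennreal_mult_less_top)
  finally have W: "?W < \<infinity>" .
  have c: "?c < \<infinity>" using p(3) by (auto simp: integrable_iff_bounded)
  obtain K where K: "6 * (?W * ?c) = ennreal K" "0 \<le> K"
    using W c by (cases "6 * (?W * ?c)") (auto simp: ennreal_mult_eq_top_iff)
  have fin: "mom p < \<infinity>" using \<kappa>(3) by (rule less_trans) simp
  show ?thesis
  proof (intro exI[of _ K] conjI allI impI K(2))
    fix s t :: real assume st: "s \<le> t"
    have "(\<integral>\<^sup>+ w. ennreal (\<bar>total_reward t w - total_reward s w\<bar> powr p) \<partial>\<Omega>)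
        \<le> 6 * (\<Sum>i. \<integral>\<^sup>+ w. ennreal (\<bar>increment s t (list_decode i) w\<bar> powr p) \<partial>\<Omega>)"
      by (rule moment_vertex_series[OF martingale_differences_increment[OF C] p(1,2)
            integrable_moment_increment[OF p(3) fin] AE_increment_limit[OF st]])
    also have "(\<Sum>i. \<integral>\<^sup>+ w. ennreal (\<bar>increment s t (list_decode i) w\<bar> powr p) \<partial>\<Omega>)
        \<le> (\<Sum>i. ennreal (exp (- \<kappa> * s)) *
            ((\<integral>\<^sup>+ w. ennreal (weight p (list_decode i) w * exp (- (- \<kappa>) * dies (list_decode i) w)) \<partial>\<Omega>) * ?c))"
    proof (intro suminf_le)
      fix i
      let ?x = "list_decode i"
      have "(\<integral>\<^sup>+ w. ennreal (if s < dies ?x w \<and> dies ?x w \<le> t then weight p ?x w else 0) \<partial>\<Omega>)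
        \<le> (\<integral>\<^sup>+ w. ennreal (exp (- \<kappa> * s)) * ennreal (weight p ?x w * exp (- (- \<kappa>) * dies ?x w)) \<partial>\<Omega>)"
      proof (rule nn_integral_mono)
        fix w
        have "weight p ?x w \<le> exp (- \<kappa> * s) * (weight p ?x w * exp (- (- \<kappa>) * dies ?x w))" if "s < dies ?x w"
        proof -
          have "\<kappa> * s \<le> \<kappa> * dies ?x w" using that \<kappa> by (intro mult_left_mono) auto
          then have "1 \<le> exp (- \<kappa> * s) * exp (- (- \<kappa>) * dies ?x w)" by (simp add: exp_add[symmetric])
          then have "weight p ?x w * 1 \<le> weight p ?x w * (exp (- \<kappa> * s) * exp (- (- \<kappa>) * dies ?x w))"
            by (rule mult_left_mono) simp
          then show ?thesis by (simp add: mult_ac)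
        qed
        then show "ennreal (if s < dies ?x w \<and> dies ?x w \<le> t then weight p ?x w else 0)
            \<le> ennreal (exp (- \<kappa> * s)) * ennreal (weight p ?x w * exp (- (- \<kappa>) * dies ?x w))"
          by (auto simp: ennreal_mult[symmetric] intro!: ennreal_leI)
      qed
      also have "\<dots> = ennreal (exp (- \<kappa> * s)) *
          (\<integral>\<^sup>+ w. ennreal (weight p ?x w * exp (- (- \<kappa>) * dies ?x w)) \<partial>\<Omega>)"
        by (rule nn_integral_cmult) measurable
      finally show "(\<integral>\<^sup>+ w. ennreal (\<bar>increment s t ?x w\<bar> powr p) \<partial>\<Omega>)
          \<le> ennreal (exp (- \<kappa> * s)) *
            ((\<integral>\<^sup>+ w. ennreal (weight p ?x w * exp (- (- \<kappa>) * dies ?x w)) \<partial>\<Omega>) * ?c)"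
        unfolding moment_increment mult.assoc[symmetric] by (intro mult_right_mono) auto
    qed auto
    also have "\<dots> = ennreal (exp (- \<kappa> * s)) * (?W * ?c)"
      by (simp only: ennreal_suminf_cmult ennreal_suminf_multc)
    also have "6 * (ennreal (exp (- \<kappa> * s)) * (?W * ?c)) = ennreal (exp (- \<kappa> * s)) * (6 * (?W * ?c))"
      by (rule mult.left_commute)
    also have "\<dots> = ennreal (K * exp (- \<kappa> * s))"
      unfolding K(1) by (simp add: ennreal_mult K(2) mult.commute)
    finally show "(\<integral>\<^sup>+ w. ennreal (\<bar>total_reward t w - total_reward s w\<bar> powr p) \<partial>\<Omega>) \<le> ennreal (K * exp (- \<kappa> * s))"
      by (simp add: mult_left_mono)
  qed
qed

text \<open>The increments decay exponentially in the \<open>p\<close>-th mean and hence in \<open>L\<^sup>1\<close>. The totals at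
  integer times thus converge almost surely, and the same bound compares them with all other
  times.\<close>

theorem total_converges_in_probability:
  assumes C: "integrable R (\<lambda>r. fst (snd r))" "(\<integral> r. fst (snd r) \<partial>R) = 0"
    and p: "1 < p" "p \<le> 2" "integrable R (\<lambda>r. \<bar>fst (snd r)\<bar> powr p)" and m: "mom p < 1"
  shows "\<exists>C_inf. tendsto_in_prob \<Omega> total_reward C_inf at_top"
proof -
  obtain a where a: "mom p = ennreal a" "0 \<le> a" using m by (cases "mom p") auto
  have "a < 1" using m a by (simp add: ennreal_less_one_iff)
  define \<kappa> where "\<kappa> = (1 - a) / 2"
  have \<kappa>: "0 < \<kappa>" "\<kappa> < 1" "mom p < ennreal (1 - \<kappa>)"
    using a \<open>a < 1\<close> by (auto simp: \<kappa>_def ennreal_less_iff field_simps)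
  obtain K where K: "0 \<le> K" "\<And>s t. s \<le> t \<Longrightarrow>
      (\<integral>\<^sup>+ w. ennreal (\<bar>total_reward t w - total_reward s w\<bar> powr p) \<partial>\<Omega>) \<le> ennreal (K * exp (- \<kappa> * s))"
    using moment_total_increment[OF C p \<kappa>] by blast
  define b where "b s = (1 + K) * exp (- (\<kappa> / 2) * s)" for s
  have L1: "(\<integral>\<^sup>+ w. ennreal \<bar>total_reward t w - total_reward s w\<bar> \<partial>\<Omega>) \<le> ennreal (b s)" if st: "0 \<le> s" "s \<le> t" for s t
  proof -
    \<comment> \<open>values below this threshold are bounded by it, larger ones by their p-th power\<close>
    define \<delta> where "\<delta> = exp (- (\<kappa> / 2) * s)"
    have \<delta>: "0 < \<delta>" by (simp add: \<delta>_def)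
    have pw: "\<bar>y\<bar> \<le> \<delta> + \<delta> powr (1 - p) * \<bar>y\<bar> powr p" for y
    proof (cases "\<bar>y\<bar> \<le> \<delta>")
      case False
      then have "\<bar>y\<bar> powr (1 - p) \<le> \<delta> powr (1 - p)" using \<delta> p by (intro powr_mono2') auto
      then have "\<bar>y\<bar> powr (1 - p) * \<bar>y\<bar> powr p \<le> \<delta> powr (1 - p) * \<bar>y\<bar> powr p"
        by (rule mult_right_mono) simp
      moreover have "\<bar>y\<bar> powr (1 - p) * \<bar>y\<bar> powr p = \<bar>y\<bar>"
        using False \<delta> powr_add[of "\<bar>y\<bar>" "1 - p" p] by simp
      ultimately show ?thesis using \<delta> by linarith
    qed (simp add: add_increasing2)
    have "(\<integral>\<^sup>+ w. ennreal \<bar>total_reward t w - total_reward s w\<bar> \<partial>\<Omega>)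
        \<le> (\<integral>\<^sup>+ w. ennreal \<delta> + ennreal (\<delta> powr (1 - p)) * ennreal (\<bar>total_reward t w - total_reward s w\<bar> powr p) \<partial>\<Omega>)"
      using pw \<delta> by (intro nn_integral_mono)
        (simp add: ennreal_mult[symmetric] ennreal_plus[symmetric] del: ennreal_plus)
    also have "\<dots> = ennreal \<delta> + ennreal (\<delta> powr (1 - p)) *
        (\<integral>\<^sup>+ w. ennreal (\<bar>total_reward t w - total_reward s w\<bar> powr p) \<partial>\<Omega>)"
      by (simp add: nn_integral_add nn_integral_cmult \<Omega>.emeasure_space_1)
    also have "\<dots> \<le> ennreal \<delta> + ennreal (\<delta> powr (1 - p)) * ennreal (K * exp (- \<kappa> * s))"
      by (intro add_left_mono mult_left_mono K(2) st) auto
    also have "\<dots> = ennreal (\<delta> + \<delta> powr (1 - p) * (K * exp (- \<kappa> * s)))"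
      using \<delta> K(1) by (simp add: ennreal_mult[symmetric] ennreal_plus[symmetric] del: ennreal_plus)
    also have "\<dots> \<le> ennreal (b s)"
    proof (rule ennreal_leI)
      have "\<delta> powr (1 - p) * exp (- \<kappa> * s) = exp (\<kappa> / 2 * s * (p - 1) - \<kappa> * s)"
      proof -
        have "\<delta> powr (1 - p) = exp ((1 - p) * (- (\<kappa> / 2) * s))" by (simp add: \<delta>_def powr_def)
        moreover have "(1 - p) * (- (\<kappa> / 2) * s) + - \<kappa> * s = \<kappa> / 2 * s * (p - 1) - \<kappa> * s"
          by (simp add: field_simps)
        ultimately show ?thesis by (simp only: exp_add[symmetric])
      qed
      also have "\<dots> \<le> \<delta>"
      proof -
        have "\<kappa> / 2 * s * (p - 1) \<le> \<kappa> / 2 * s * 1" using \<kappa> st p by (intro mult_left_mono) auto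
        then show ?thesis by (simp add: \<delta>_def algebra_simps)
      qed
      finally have "K * (\<delta> powr (1 - p) * exp (- \<kappa> * s)) \<le> K * \<delta>" by (rule mult_left_mono[OF _ K(1)])
      then show "\<delta> + \<delta> powr (1 - p) * (K * exp (- \<kappa> * s)) \<le> b s"
        by (simp add: b_def \<delta>_def algebra_simps)
    qed
    finally show ?thesis .
  qed
  define r where "r = exp (- (\<kappa> / 2))"
  have r: "0 \<le> r" "r < 1" using \<kappa> by (auto simp: r_def)
  have b_nat: "b (real n) = (1 + K) * r ^ n" for n
    by (simp add: b_def r_def exp_of_nat_mult[symmetric] mult_ac)
  have "(\<integral>\<^sup>+ w. (\<Sum>n. ennreal \<bar>total_reward (real (Suc n)) w - total_reward (real n) w\<bar>) \<partial>\<Omega>)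
      = (\<Sum>n. \<integral>\<^sup>+ w. ennreal \<bar>total_reward (real (Suc n)) w - total_reward (real n) w\<bar> \<partial>\<Omega>)"
    by (rule nn_integral_suminf) measurable
  also have "\<dots> \<le> (\<Sum>n. ennreal (b (real n)))"
    by (intro suminf_le L1) auto
  also have "\<dots> = ennreal (\<Sum>n. b (real n))"
    using r K(1) by (intro suminf_ennreal2) (auto simp: b_nat intro!: summable_mult summable_geometric)
  also have "\<dots> < \<infinity>" by simp
  finally have "AE w in \<Omega>. (\<Sum>n. ennreal \<bar>total_reward (real (Suc n)) w - total_reward (real n) w\<bar>) \<noteq> \<infinity>"
    by (intro nn_integral_PInf_AE) (auto simp del: of_nat_Suc)
  then have conv: "AE w in \<Omega>. (\<lambda>n. total_reward (real n) w) \<longlonglongrightarrow> lim (\<lambda>n. total_reward (real n) w)"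
  proof eventually_elim
    case (elim w)
    then have "summable (\<lambda>n. \<bar>total_reward (real (Suc n)) w - total_reward (real n) w\<bar>)"
      by (intro summable_suminf_not_top) auto
    then have "summable (\<lambda>n. total_reward (real (Suc n)) w - total_reward (real n) w)"
      by (rule summable_rabs_cancel)
    then have "(\<lambda>n. (\<Sum>i<n. total_reward (real (Suc i)) w - total_reward (real i) w) + total_reward (real 0) w)
        \<longlonglongrightarrow> (\<Sum>i. total_reward (real (Suc i)) w - total_reward (real i) w) + total_reward (real 0) w"
      by (intro tendsto_add tendsto_const summable_LIMSEQ)
    also have "(\<lambda>n. (\<Sum>i<n. total_reward (real (Suc i)) w - total_reward (real i) w) + total_reward (real 0) w)
        = (\<lambda>n. total_reward (real n) w)"
      using sum_lessThan_telescope[of "\<lambda>i. total_reward (real i) w"] by simp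
    finally have "convergent (\<lambda>n. total_reward (real n) w)" by (rule convergentI)
    then show ?case by (simp only: convergent_LIMSEQ_iff)
  qed
  define C_inf where "C_inf w = lim (\<lambda>n. total_reward (real n) w)" for w
  have C_inf [measurable]: "C_inf \<in> borel_measurable \<Omega>" unfolding C_inf_def[abs_def] by measurable
  have bound: "(\<integral>\<^sup>+ w. ennreal \<bar>total_reward t w - C_inf w\<bar> \<partial>\<Omega>) \<le> ennreal (b t)" if t: "0 \<le> t" for t
  proof (rule nn_integral_limit_le)
    define n where "n = nat \<lceil>t\<rceil>"
    have n: "t \<le> real n" by (simp add: n_def real_nat_ceiling_ge)
    show "(\<lambda>w. \<bar>total_reward t w - total_reward (real (m + n)) w\<bar>) \<in> borel_measurable \<Omega>" for m by measurable
    show "AE w in \<Omega>. (\<lambda>m. \<bar>total_reward t w - total_reward (real (m + n)) w\<bar>) \<longlonglongrightarrow> \<bar>total_reward t w - C_inf w\<bar>"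
      using conv
    proof eventually_elim
      case (elim w)
      then have "(\<lambda>m. total_reward (real (m + n)) w) \<longlonglongrightarrow> C_inf w"
        unfolding C_inf_def by (rule LIMSEQ_ignore_initial_segment)
      then show ?case by (intro tendsto_intros)
    qed
    fix m show "(\<integral>\<^sup>+ w. ennreal \<bar>total_reward t w - total_reward (real (m + n)) w\<bar> \<partial>\<Omega>) \<le> ennreal (b t)"
      using L1[of t "real (m + n)"] t n by (simp add: abs_minus_commute)
  qed
  have "((\<lambda>t. measure \<Omega> {w \<in> space \<Omega>. \<delta> < \<bar>total_reward t w - C_inf w\<bar>}) \<longlongrightarrow> 0) at_top" if \<delta>: "0 < \<delta>" for \<delta>
  proof (rule tendsto_sandwich[OF _ _ tendsto_const])
    show "\<forall>\<^sub>F t in at_top. 0 \<le> measure \<Omega> {w \<in> space \<Omega>. \<delta> < \<bar>total_reward t w - C_inf w\<bar>}" by simp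
    show "\<forall>\<^sub>F t in at_top. measure \<Omega> {w \<in> space \<Omega>. \<delta> < \<bar>total_reward t w - C_inf w\<bar>} \<le> b t / \<delta>"
      using eventually_ge_at_top[of "0::real"]
    proof eventually_elim
      case (elim t)
      have "ennreal (measure \<Omega> {w \<in> space \<Omega>. \<delta> < \<bar>total_reward t w - C_inf w\<bar>})
          = (\<integral>\<^sup>+ w. indicator {w \<in> space \<Omega>. \<delta> < \<bar>total_reward t w - C_inf w\<bar>} w \<partial>\<Omega>)"
        by (simp add: \<Omega>.emeasure_eq_measure)
      also have "\<dots> \<le> (\<integral>\<^sup>+ w. ennreal (1 / \<delta>) * ennreal \<bar>total_reward t w - C_inf w\<bar> \<partial>\<Omega>)"
        using \<delta> by (intro nn_integral_mono)
          (auto simp: indicator_def ennreal_mult[symmetric] pos_le_divide_eq less_imp_le)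
      also have "\<dots> = ennreal (1 / \<delta>) * (\<integral>\<^sup>+ w. ennreal \<bar>total_reward t w - C_inf w\<bar> \<partial>\<Omega>)"
        by (rule nn_integral_cmult) measurable
      also have "\<dots> \<le> ennreal (1 / \<delta>) * ennreal (b t)"
        by (intro mult_left_mono bound elim) auto
      also have "\<dots> = ennreal (b t / \<delta>)"
        using \<delta> K(1) by (simp add: ennreal_mult[symmetric] b_def)
      finally show ?case
        using \<delta> K(1) by (subst (asm) ennreal_le_iff) (auto simp: b_def)
    qed
    have "LIM t at_top. - (\<kappa> / 2) * t :> at_bot"
      by (rule filterlim_tendsto_neg_mult_at_bot[OF tendsto_const _ filterlim_ident]) (use \<kappa> in simp)
    then have "((\<lambda>t. exp (- (\<kappa> / 2) * t)) \<longlongrightarrow> 0) at_top"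
      by (rule filterlim_compose[OF exp_at_bot])
    then have "((\<lambda>t. (1 + K) * exp (- (\<kappa> / 2) * t) / \<delta>) \<longlongrightarrow> (1 + K) * 0 / \<delta>) at_top"
      using \<delta> by (intro tendsto_intros) auto
    then show "((\<lambda>t. b t / \<delta>) \<longlongrightarrow> 0) at_top" by (simp add: b_def[abs_def])
  qed
  then show ?thesis
    unfolding tendsto_in_prob_def by (intro exI[of _ C_inf]) auto
qed

end

section \<open>The additive martingale\<close>

lemma nn_integral_memoryless:
  assumes [measurable]: "f \<in> borel_measurable borel" and u: "0 \<le> u"
  shows "(\<integral>\<^sup>+ e. (if u < e then f e else 0) \<partial>unit_exponential)
    = ennreal (exp (- u)) * (\<integral>\<^sup>+ e. f (u + e) \<partial>unit_exponential)"
proof -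
  have "(\<integral>\<^sup>+ e. (if u < e then f e else 0) \<partial>unit_exponential)
      = (\<integral>\<^sup>+ e. ennreal (exponential_density 1 e) * (if u < e then f e else 0) \<partial>lborel)"
    unfolding unit_exponential_def by (subst nn_integral_density) auto
  also have "\<dots> = (\<integral>\<^sup>+ e. ennreal (exponential_density 1 (u + e)) * (if 0 < e then f (u + e) else 0) \<partial>lborel)"
    by (subst nn_integral_real_affine[where c=1 and t=u]) (auto intro!: nn_integral_cong)
  also have "\<dots> = (\<integral>\<^sup>+ e. ennreal (exp (- u)) * (ennreal (exponential_density 1 e) * f (u + e)) \<partial>lborel)"
    by (rule nn_integral_cong_AE, use AE_lborel_singleton[of "0::real"] in eventually_elim)
       (use u in \<open>auto simp: exponential_density_def mult.assoc[symmetric] ennreal_mult[symmetric] exp_add[symmetric]\<close>)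
  also have "\<dots> = ennreal (exp (- u)) * (\<integral>\<^sup>+ e. ennreal (exponential_density 1 e) * f (u + e) \<partial>lborel)"
    by (rule nn_integral_cmult) measurable
  also have "(\<integral>\<^sup>+ e. ennreal (exponential_density 1 e) * f (u + e) \<partial>lborel)
      = (\<integral>\<^sup>+ e. f (u + e) \<partial>unit_exponential)"
    unfolding unit_exponential_def by (subst nn_integral_density) auto
  finally show ?thesis .
qed

lemma nn_integral_exp_upto:
  assumes m: "0 \<le> m" and u: "0 \<le> u"
  shows "(\<integral>\<^sup>+ e. (if e \<le> u then ennreal (m * exp (- (m - 1) * e)) else 0) \<partial>unit_exponential)
    = ennreal (1 - exp (- m * u))"
proof -
  have "(\<integral>\<^sup>+ e. (if e \<le> u then ennreal (m * exp (- (m - 1) * e)) else 0) \<partial>unit_exponential)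
      = (\<integral>\<^sup>+ e. ennreal (exponential_density 1 e) * (if e \<le> u then ennreal (m * exp (- (m - 1) * e)) else 0) \<partial>lborel)"
    unfolding unit_exponential_def by (subst nn_integral_density) auto
  also have "\<dots> = (\<integral>\<^sup>+ e. ennreal (m * exp (- m * e)) * indicator {0..u} e \<partial>lborel)"
    using m by (intro nn_integral_cong)
      (auto simp: exponential_density_def indicator_def ennreal_mult[symmetric] exp_add[symmetric] algebra_simps
        mult.left_commute[of "exp _" m])
  also have "\<dots> = ennreal (- exp (- m * u) - (- exp (- m * 0)))"
    using m u by (intro nn_integral_FTC_Icc) (auto intro!: derivative_eq_intros)
  finally show ?thesis by simp
qed

text \<open>All proper ancestors of a vertex born by time \<open>s\<close> have died by time \<open>s\<close>, so a vertex \<open>x\<close>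
  that dies later is not among them.\<close>

lemma adapted_path:
  assumes y: "y \<in> tree w" "born y w \<le> s" and pos: "positive_lifetimes w"
    and x: "s < dies x w"
  shows "y \<in> tree (w(x := q)) \<and> born y (w(x := q)) = born y w \<and> pos factor y (w(x := q)) = pos factor y w"
  using y
proof (induction y rule: list.induct)
  case (Cons i z)
  have "born (i # z) w = dies z w" by (simp add: death_def)
  then have z: "dies z w \<le> s" using Cons by simp
  then have "z \<noteq> x" using x by auto
  moreover have "born z w \<le> s" using born_le_dies[OF pos, of z] z by linarith
  moreover have "z \<in> tree w" using Cons.prems by simp
  ultimately have IH: "z \<in> tree (w(x := q)) \<and> born z (w(x := q)) = born z w \<and>
      pos factor z (w(x := q)) = pos factor z w"
    by (intro Cons.IH)
  have "offspring z (w(x := q)) = offspring z w" "lifetime z (w(x := q)) = lifetime z w"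
    "factor z (w(x := q)) = factor z w"
    using \<open>z \<noteq> x\<close> by simp_all
  then show ?case
    using Cons.prems(1) IH by (simp only: tree_Cons birth.simps pos.simps simp_thms)
qed simp

lemma live_upd:
  assumes pos: "positive_lifetimes w" "positive_lifetimes (w(x := q))"
    and x: "s < dies x w" "s < dies x (w(x := q))"
  shows "live s (w(x := q)) = live s w"
proof -
  have sub: "live s w' \<subseteq> live s (w'(x := q'))"
    if "positive_lifetimes w'" "s < dies x w'" "s < dies x (w'(x := q'))" for w' q'
  proof
    fix y assume "y \<in> live s w'"
    then have y: "y \<in> tree w'" "born y w' \<le> s" "s < dies y w'" by (auto simp: alive_def)
    have "s < dies y (w'(x := q'))"
      using adapted_path[OF y(1,2) that(1,2), of q'] y(3) that(3)
      by (cases "y = x") (auto simp: death_def)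
    then show "y \<in> live s (w'(x := q'))"
      using adapted_path[OF y(1,2) that(1,2), of q'] y by (auto simp: alive_def)
  qed
  have "live s (w(x := q)) \<subseteq> live s ((w(x := q))(x := w x))"
    using sub[of "w(x := q)" "w x"] pos x by simp
  then show ?thesis using sub[of w q] pos x by auto
qed

text \<open>Every vertex born by time \<open>t\<close>, except for the root, is one of finitely many children of a
  vertex that has died by time \<open>t\<close>.\<close>

lemma finite_live:
  assumes "finite (past t w)"
  shows "finite (live t w)" "finite {x \<in> tree w. born x w \<le> t}"
proof -
  have "{x \<in> tree w. born x w \<le> t} \<subseteq> insert [] ((\<lambda>(x, k). k # x) ` Sigma (past t w) (\<lambda>x. {..<offspring x w}))"
  proof
    fix y assume y: "y \<in> {x \<in> tree w. born x w \<le> t}"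
    show "y \<in> insert [] ((\<lambda>(x, k). k # x) ` Sigma (past t w) (\<lambda>x. {..<offspring x w}))"
    proof (cases y)
      case (Cons k x)
      then have "(x, k) \<in> Sigma (past t w) (\<lambda>x. {..<offspring x w})"
        using y by (auto simp: dead_def death_def)
      then show ?thesis using Cons by force
    qed simp
  qed
  moreover have "finite (insert [] ((\<lambda>(x, k). k # x) ` Sigma (past t w) (\<lambda>x. {..<offspring x w})))"
    using assms by (intro finite.insertI finite_imageI finite_SigmaI) auto
  ultimately show "finite {x \<in> tree w. born x w \<le> t}" by (rule finite_subset)
  then show "finite (live t w)" by (rule rev_finite_subset) (auto simp: alive_def)
qed

abbreviation additive_process :: "real \<Rightarrow> real \<Rightarrow> real \<Rightarrow> config \<Rightarrow> real" where
  "additive_process \<phi> \<gamma> \<equiv> Mart \<phi> lifetime offspring factor \<gamma>"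

lemma additive_eq: "additive_process \<phi> \<gamma> t w = exp (- \<phi> * t) * live_sum \<gamma> t w"
  by (simp add: Mart_def live_sum_def)

text \<open>The factor by which a vertex with mark \<open>q\<close> changes its own contribution to the additive
  martingale within time \<open>u\<close> of its birth: it either survives or is replaced by its children.\<close>

definition split_factor :: "real \<Rightarrow> real \<Rightarrow> real \<Rightarrow> mark \<Rightarrow> real" where
  "split_factor \<phi> \<gamma> u q = (if u < fst q then exp (- \<phi> * u) else exp (- \<phi> * fst q) * power_sum \<gamma> (snd q))"

lemma split_factor_nonneg [simp]: "0 \<le> split_factor \<phi> \<gamma> u q"
  by (simp add: split_factor_def)

text \<open>The net effect of the life of \<open>x\<close> up to time \<open>t\<close> on the additive martingale. It has mean
  zero given the marks of all other vertices.\<close>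

definition compensated :: "real \<Rightarrow> real \<Rightarrow> real \<Rightarrow> nat list \<Rightarrow> config \<Rightarrow> real" where
  "compensated \<phi> \<gamma> t x w = (if born x w \<le> t
     then weight \<gamma> x w * exp (- \<phi> * born x w) * (split_factor \<phi> \<gamma> (t - born x w) (w x) - 1) else 0)"

text \<open>\<open>Z\<close> depends only on the evolution up to time \<open>s\<close>: it does not change with the mark of a
  vertex which outlives time \<open>s\<close> both before and after the change. This form of measurability
  with respect to the past fits the resampling of marks.\<close>

definition (in marked_branching) adapted :: "real \<Rightarrow> (config \<Rightarrow> real) \<Rightarrow> bool" where
  "adapted s Z \<longleftrightarrow> (\<forall>w x q. w \<in> space \<Omega> \<longrightarrow> q \<in> space Q \<longrightarrow> positive_lifetimes w \<longrightarrow> 0 < fst q \<longrightarrow>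
     s < dies x w \<longrightarrow> s < born x w + fst q \<longrightarrow> Z (w(x := q)) = Z w)"

text \<open>The sum telescopes. What the death of a vertex adds is subtracted again at the births of
  its children, so only the vertices alive at time \<open>t\<close> and the initial value 1 of the root
  remain.\<close>

lemma vertex_sum_eq_additive:
  assumes t: "0 \<le> t" and fin: "finite (past t w)" and pos: "positive_lifetimes w"
    and A: "\<And>x k. 0 < factor x w k"
  shows "(\<Sum>x\<in>{x \<in> tree w. born x w \<le> t}. compensated \<phi> \<gamma> t x w) = additive_process \<phi> \<gamma> t w - 1"
proof -
  let ?D = "{x \<in> tree w. born x w \<le> t}"
  define a where "a x = exp (\<gamma> * pos factor x w) * exp (- \<phi> * born x w)" for x
  have finD: "finite ?D" by (rule finite_live[OF fin])
  have D: "?D = past t w \<union> live t w" "past t w \<inter> live t w = {}"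
    using born_le_dies[OF pos] by (auto simp: alive_def dead_def intro: order_trans)
  have live: "compensated \<phi> \<gamma> t x w = exp (- \<phi> * t) * exp (\<gamma> * pos factor x w) - a x" if "x \<in> live t w" for x
  proof -
    have "exp (- \<phi> * born x w) * exp (- \<phi> * (t - born x w)) = exp (- \<phi> * t)"
      by (simp add: exp_add[symmetric] algebra_simps)
    moreover have "t - born x w < fst (w x)" using that by (auto simp: alive_def death_def lifetime_def)
    ultimately show ?thesis
      using that by (auto simp: compensated_def split_factor_def weight_def a_def alive_def algebra_simps)
  qed
  have past: "compensated \<phi> \<gamma> t x w = (\<Sum>k<offspring x w. a (k # x)) - a x" if "x \<in> past t w" for x
  proof -
    have "\<not> t - born x w < fst (w x)" using that by (auto simp: dead_def death_def lifetime_def)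
    moreover have "born x w \<le> t" "x \<in> tree w"
      using that born_le_dies[OF pos, of x] by (auto simp: dead_def)
    moreover have "exp (\<gamma> * pos factor x w) * exp (- \<phi> * born x w) * (exp (- \<phi> * fst (w x)) * power_sum \<gamma> (snd (w x)))
        = (\<Sum>k<offspring x w. a (k # x))"
    proof -
      have "a (k # x) = exp (\<gamma> * pos factor x w) * exp (- \<phi> * born x w) * (exp (- \<phi> * fst (w x)) * factor x w k powr \<gamma>)" for k
        using A[of x k] by (simp add: a_def powr_def lifetime_def exp_add[symmetric] algebra_simps)
      then show ?thesis
        by (simp add: power_sum_def sum_distrib_left offspring_def factor_def)
    qed
    ultimately show ?thesis
      by (simp add: compensated_def split_factor_def weight_def a_def right_diff_distrib)
  qed
  have bij: "bij_betw (\<lambda>(x, k). k # x) (Sigma (past t w) (\<lambda>x. {..<offspring x w})) (?D - {[]})"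
  proof (rule bij_betwI[where g="\<lambda>y. (tl y, hd y)"])
    show "(\<lambda>y. (tl y, hd y)) \<in> ?D - {[]} \<rightarrow> Sigma (past t w) (\<lambda>x. {..<offspring x w})"
    proof
      fix y assume "y \<in> ?D - {[]}"
      then show "(tl y, hd y) \<in> Sigma (past t w) (\<lambda>x. {..<offspring x w})"
        by (cases y) (auto simp: dead_def death_def)
    qed
  qed (auto simp: dead_def death_def)
  have "(\<Sum>x\<in>past t w. \<Sum>k<offspring x w. a (k # x)) = (\<Sum>y\<in>?D - {[]}. a y)"
    using fin by (subst sum.Sigma) (auto simp: split_beta' sum.reindex_bij_betw[OF bij, symmetric])
  moreover have "a [] + (\<Sum>y\<in>?D - {[]}. a y) = (\<Sum>y\<in>?D. a y)"
    using t finD by (subst sum.remove[of ?D "[]"]) auto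
  moreover have "(\<Sum>y\<in>?D. a y) = (\<Sum>y\<in>past t w. a y) + (\<Sum>y\<in>live t w. a y)"
    unfolding D(1) using fin finite_live(1)[OF fin] D(2) by (rule sum.union_disjoint)
  moreover have "(\<Sum>x\<in>?D. compensated \<phi> \<gamma> t x w)
      = (\<Sum>x\<in>past t w. compensated \<phi> \<gamma> t x w) + (\<Sum>x\<in>live t w. compensated \<phi> \<gamma> t x w)"
    unfolding D(1) using fin finite_live(1)[OF fin] D(2) by (rule sum.union_disjoint)
  moreover have "a [] = 1" by (simp add: a_def)
  ultimately show ?thesis
    by (simp add: past live sum_subtractf additive_eq live_sum_def sum_distrib_left)
qed

lemma integral_series_zero:
  fixes f :: "nat \<Rightarrow> 'a \<Rightarrow> real"
  assumes [measurable]: "\<And>i. f i \<in> borel_measurable M"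
    and fin: "(\<Sum>i. \<integral>\<^sup>+ w. ennreal \<bar>f i w\<bar> \<partial>M) < \<infinity>"
    and zero: "\<And>i. (\<integral> w. f i w \<partial>M) = 0"
    and lim: "AE w in M. (\<lambda>n. \<Sum>i<n. f i w) \<longlonglongrightarrow> X w" and [measurable]: "X \<in> borel_measurable M"
  shows "integrable M X" "(\<integral> w. X w \<partial>M) = 0"
proof -
  have each: "(\<integral>\<^sup>+ w. ennreal \<bar>f i w\<bar> \<partial>M) < \<infinity>" for i
    using sum_le_suminf[of "\<lambda>i. \<integral>\<^sup>+ w. ennreal \<bar>f i w\<bar> \<partial>M" "{i}"] fin by (auto intro: le_less_trans)
  have int: "integrable M (f i)" for i
    using each[of i] by (intro integrableI_bounded) auto
  have "(\<integral>\<^sup>+ w. (\<Sum>i. ennreal \<bar>f i w\<bar>) \<partial>M) \<noteq> \<infinity>"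
    using fin by (subst nn_integral_suminf) auto
  then have "AE w in M. (\<Sum>i. ennreal \<bar>f i w\<bar>) \<noteq> \<infinity>"
    by (intro nn_integral_PInf_AE) auto
  then have summ: "AE w in M. summable (\<lambda>i. norm (f i w))"
    by eventually_elim (auto intro: summable_suminf_not_top)
  have "(\<integral>\<^sup>+ w. ennreal \<bar>f i w\<bar> \<partial>M) = ennreal (\<integral> w. norm (f i w) \<partial>M)" for i
    using int[of i] by (subst nn_integral_eq_integral) auto
  then have summ2: "summable (\<lambda>i. \<integral> w. norm (f i w) \<partial>M)"
    using fin by (intro summable_suminf_not_top) auto
  have X: "AE w in M. (\<Sum>i. f i w) = X w"
    using lim by eventually_elim (simp add: sums_def[symmetric] sums_iff)
  have "integrable M (\<lambda>w. \<Sum>i. f i w)" by (rule integrable_suminf[OF int summ summ2])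
  then show "integrable M X" by (rule integrable_cong_AE_imp) (use X in auto)
  have "(\<integral> w. X w \<partial>M) = (\<integral> w. (\<Sum>i. f i w) \<partial>M)"
    using X by (intro integral_cong_AE) auto
  also have "\<dots> = (\<Sum>i. \<integral> w. f i w \<partial>M)" by (rule integral_suminf[OF int summ summ2])
  finally show "(\<integral> w. X w \<partial>M) = 0" by (simp add: zero)
qed

context marked_branching
begin

lemma adaptedD:
  "adapted s Z \<Longrightarrow> w \<in> space \<Omega> \<Longrightarrow> q \<in> space Q \<Longrightarrow> positive_lifetimes w \<Longrightarrow> 0 < fst q \<Longrightarrow>
    s < dies x w \<Longrightarrow> s < born x w + fst q \<Longrightarrow> Z (w(x := q)) = Z w"
  unfolding adapted_def by blast

lemma measurable_split_factor [measurable]: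
  "split_factor \<phi> \<gamma> u \<in> borel_measurable (borel \<Otimes>\<^sub>M mark_space)"
  unfolding split_factor_def[abs_def] by measurable

lemma measurable_compensated [measurable]: "compensated \<phi> \<gamma> t x \<in> borel_measurable \<Omega>"
proof -
  have "compensated \<phi> \<gamma> t x = (\<lambda>w. if born x w \<le> t
     then weight \<gamma> x w * exp (- \<phi> * born x w) *
       ((if t - born x w < lifetime x w then exp (- \<phi> * (t - born x w))
         else exp (- \<phi> * lifetime x w) * power_sum \<gamma> (snd (w x))) - 1) else 0)"
    by (auto simp: compensated_def split_factor_def lifetime_def fun_eq_iff)
  also have "\<dots> \<in> borel_measurable \<Omega>" by measurable
  finally show ?thesis .
qed

lemma adapted_additive: "s' \<le> s \<Longrightarrow> adapted s (additive_process \<phi> \<gamma> s')"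
  unfolding adapted_def
proof (intro allI impI)
  fix w :: config and x :: "nat list" and q :: mark
  assume s: "s' \<le> s" and w: "positive_lifetimes w" "0 < fst q" "s < dies x w" "s < born x w + fst q"
  have pos: "positive_lifetimes (w(x := q))" using w by (auto simp: positive_lifetimes_def)
  have live: "live s' (w(x := q)) = live s' w"
    using w s pos by (intro live_upd) auto
  have "pos factor y (w(x := q)) = pos factor y w" if "y \<in> live s' w" for y
    using adapted_path[of y w s' x q] that w s by (auto simp: alive_def)
  then show "additive_process \<phi> \<gamma> s' (w(x := q)) = additive_process \<phi> \<gamma> s' w"
    by (simp add: additive_eq live_sum_def live)
qed

context
  fixes \<gamma> m \<phi> :: real
  assumes m: "mom \<gamma> = ennreal m" "0 \<le> m" and \<phi>: "\<phi> = m - 1"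
begin

text \<open>A survivor contributes \<open>exp (- \<phi> u)\<close> with probability \<open>exp (- u)\<close>, which makes
  \<open>exp (- m u)\<close>, and death at time \<open>e \<le> u\<close> has density \<open>exp (- e)\<close> and mean contribution
  \<open>m exp (- \<phi> e)\<close>, which makes \<open>1 - exp (- m u)\<close>.\<close>

lemma nn_integral_split_factor:
  assumes u: "0 \<le> u"
  shows "(\<integral>\<^sup>+ q. ennreal (split_factor \<phi> \<gamma> u q) \<partial>Q) = 1"
proof -
  have "(\<integral>\<^sup>+ q. ennreal (split_factor \<phi> \<gamma> u q) \<partial>Q)
      = (\<integral>\<^sup>+ e. \<integral>\<^sup>+ r. ennreal (split_factor \<phi> \<gamma> u (e, r)) \<partial>R \<partial>unit_exponential)"
    by (rule nn_integral_Q) measurable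
  also have "\<dots> = (\<integral>\<^sup>+ e. (if u < e then ennreal (exp (- \<phi> * u)) else 0) +
      (if e \<le> u then ennreal (m * exp (- (m - 1) * e)) else 0) \<partial>unit_exponential)"
  proof (rule nn_integral_cong)
    fix e :: real
    have "(\<integral>\<^sup>+ r. ennreal (exp (- \<phi> * e) * power_sum \<gamma> r) \<partial>R) = ennreal (exp (- \<phi> * e)) * mom \<gamma>"
      unfolding mom_def by (subst nn_integral_cmult[symmetric]) (auto simp: ennreal_mult)
    also have "\<dots> = ennreal (m * exp (- (m - 1) * e))"
      using m by (simp add: \<phi> ennreal_mult[symmetric] mult.commute)
    finally show "(\<integral>\<^sup>+ r. ennreal (split_factor \<phi> \<gamma> u (e, r)) \<partial>R)
        = (if u < e then ennreal (exp (- \<phi> * u)) else 0) + (if e \<le> u then ennreal (m * exp (- (m - 1) * e)) else 0)"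
      by (cases "u < e") (simp_all add: split_factor_def R.emeasure_space_1)
  qed
  also have "\<dots> = (\<integral>\<^sup>+ e. (if u < e then ennreal (exp (- \<phi> * u)) else 0) \<partial>unit_exponential) +
      (\<integral>\<^sup>+ e. (if e \<le> u then ennreal (m * exp (- (m - 1) * e)) else 0) \<partial>unit_exponential)"
    by (rule nn_integral_add) measurable
  also have "(\<integral>\<^sup>+ e. (if u < e then ennreal (exp (- \<phi> * u)) else 0) \<partial>unit_exponential) = ennreal (exp (- m * u))"
    using nn_integral_memoryless[OF _ u, of "\<lambda>_. ennreal (exp (- \<phi> * u))"] ex.emeasure_space_1
    by (simp add: ennreal_mult[symmetric] exp_add[symmetric] \<phi> algebra_simps)
  also have "(\<integral>\<^sup>+ e. (if e \<le> u then ennreal (m * exp (- (m - 1) * e)) else 0) \<partial>unit_exponential)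
      = ennreal (1 - exp (- m * u))"
    by (rule nn_integral_exp_upto[OF m(2) u])
  also have "ennreal (exp (- m * u)) + \<dots> = 1"
    using m u by (subst ennreal_plus[symmetric]) auto
  finally show ?thesis .
qed

lemma integral_split_factor:
  assumes u: "0 \<le> u"
  shows "integrable Q (split_factor \<phi> \<gamma> u)" "(\<integral> q. split_factor \<phi> \<gamma> u q \<partial>Q) = 1"
proof -
  show "integrable Q (split_factor \<phi> \<gamma> u)"
    using nn_integral_split_factor[OF u] by (intro integrableI_bounded) auto
  show "(\<integral> q. split_factor \<phi> \<gamma> u q \<partial>Q) = 1"
    using nn_integral_split_factor[OF u] by (subst integral_eq_nn_integral) auto
qed

lemma integral_compensated:
  shows "integrable Q (\<lambda>q. compensated \<phi> \<gamma> t x (w(x := q)))" "(\<integral> q. compensated \<phi> \<gamma> t x (w(x := q)) \<partial>Q) = 0"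
proof -
  show "integrable Q (\<lambda>q. compensated \<phi> \<gamma> t x (w(x := q)))"
    unfolding compensated_def
    by (cases "born x w \<le> t") (auto intro!: integrable_mult_right Bochner_Integration.integrable_diff integral_split_factor)
  show "(\<integral> q. compensated \<phi> \<gamma> t x (w(x := q)) \<partial>Q) = 0"
    unfolding compensated_def using integral_split_factor[of "t - born x w"]
    by (cases "born x w \<le> t") (simp_all add: Q.prob_space)
qed

text \<open>Only vertices born by time \<open>t\<close> contribute. For them the discount factor \<open>exp (- m B(x))\<close>
  is bounded below, and with this rate \<open>m > \<Phi>(\<gamma>)\<close> the weights are summable.\<close>

lemma suminf_compensated_finite:
  assumes t: "0 \<le> t"
  shows "(\<Sum>i. \<integral>\<^sup>+ w. ennreal \<bar>compensated \<phi> \<gamma> t (list_decode i) w\<bar> \<partial>\<Omega>) < \<infinity>"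
proof -
  define K where "K = exp (\<bar>\<phi>\<bar> * t) * exp (m * t) * exp (\<bar>\<phi>\<bar> * t)"
  let ?J = "\<lambda>x. \<integral>\<^sup>+ w. ennreal (weight \<gamma> x w * exp (- m * born x w)) \<partial>\<Omega>"
  have "(\<integral>\<^sup>+ w. ennreal \<bar>compensated \<phi> \<gamma> t x w\<bar> \<partial>\<Omega>) \<le> ?J x * (ennreal K * (2 + mom \<gamma>))" for x
  proof -
    have bound: "\<bar>compensated \<phi> \<gamma> t x w\<bar>
        \<le> weight \<gamma> x w * exp (- m * born x w) * (K * (2 + power_sum \<gamma> (snd (w x))))"
      if pos: "positive_lifetimes w" for w
    proof (cases "born x w \<le> t")
      case True
      have b: "0 \<le> born x w" using born_nonneg[OF pos] .
      have e1: "exp (- \<phi> * v) \<le> exp (\<bar>\<phi>\<bar> * t)" if "0 \<le> v" "v \<le> t" for v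
      proof -
        have "- \<phi> * v \<le> \<bar>\<phi>\<bar> * v" using that by (intro mult_right_mono) auto
        also have "\<dots> \<le> \<bar>\<phi>\<bar> * t" using that by (intro mult_left_mono) auto
        finally show ?thesis by simp
      qed
      have one: "1 \<le> exp (\<bar>\<phi>\<bar> * t)" using t by simp
      have "0 < fst (w x)" using pos by (auto simp: positive_lifetimes_def lifetime_def)
      then have "split_factor \<phi> \<gamma> (t - born x w) (w x) \<le> exp (\<bar>\<phi>\<bar> * t) * (1 + power_sum \<gamma> (snd (w x)))"
      proof (cases "t - born x w < fst (w x)")
        case less: True
        have "exp (- \<phi> * (t - born x w)) * 1 \<le> exp (\<bar>\<phi>\<bar> * t) * (1 + power_sum \<gamma> (snd (w x)))"
          using True b by (intro mult_mono e1) auto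
        then show ?thesis using less by (simp add: split_factor_def)
      next
        case False
        have "exp (- \<phi> * fst (w x)) * power_sum \<gamma> (snd (w x)) \<le> exp (\<bar>\<phi>\<bar> * t) * (1 + power_sum \<gamma> (snd (w x)))"
          using \<open>0 < fst (w x)\<close> False b by (intro mult_mono e1) auto
        then show ?thesis using False by (simp add: split_factor_def)
      qed
      moreover have "1 \<le> exp (\<bar>\<phi>\<bar> * t) * 1" using one by simp
      ultimately have "\<bar>split_factor \<phi> \<gamma> (t - born x w) (w x) - 1\<bar>
          \<le> exp (\<bar>\<phi>\<bar> * t) * (1 + power_sum \<gamma> (snd (w x))) + exp (\<bar>\<phi>\<bar> * t) * 1"
        using split_factor_nonneg[of \<phi> \<gamma> "t - born x w" "w x"] by linarith
      then have s: "\<bar>split_factor \<phi> \<gamma> (t - born x w) (w x) - 1\<bar> \<le> exp (\<bar>\<phi>\<bar> * t) * (2 + power_sum \<gamma> (snd (w x)))"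
        by (simp add: algebra_simps)
      have w1: "weight \<gamma> x w * exp (- \<phi> * born x w) \<le> weight \<gamma> x w * exp (- m * born x w) * (exp (\<bar>\<phi>\<bar> * t) * exp (m * t))"
      proof -
        have "m * born x w \<le> m * t" using True m by (intro mult_left_mono) auto
        then have "1 \<le> exp (- m * born x w) * exp (m * t)" by (simp add: exp_add[symmetric])
        then have "exp (- \<phi> * born x w) * 1 \<le> exp (\<bar>\<phi>\<bar> * t) * (exp (- m * born x w) * exp (m * t))"
          using e1[OF b True] by (intro mult_mono) auto
        then have "weight \<gamma> x w * (exp (- \<phi> * born x w) * 1)
            \<le> weight \<gamma> x w * (exp (\<bar>\<phi>\<bar> * t) * (exp (- m * born x w) * exp (m * t)))"
          by (rule mult_left_mono) simp
        then show ?thesis by (simp add: mult_ac)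
      qed
      have "\<bar>compensated \<phi> \<gamma> t x w\<bar>
          = weight \<gamma> x w * exp (- \<phi> * born x w) * \<bar>split_factor \<phi> \<gamma> (t - born x w) (w x) - 1\<bar>"
        using True by (simp add: compensated_def abs_mult)
      also have "\<dots> \<le> (weight \<gamma> x w * exp (- m * born x w) * (exp (\<bar>\<phi>\<bar> * t) * exp (m * t))) *
          (exp (\<bar>\<phi>\<bar> * t) * (2 + power_sum \<gamma> (snd (w x))))"
        by (rule mult_mono[OF w1 s]) auto
      finally show ?thesis by (simp add: K_def mult_ac)
    qed (simp add: compensated_def K_def)
    have "(\<integral>\<^sup>+ w. ennreal \<bar>compensated \<phi> \<gamma> t x w\<bar> \<partial>\<Omega>)
        \<le> (\<integral>\<^sup>+ w. ennreal (weight \<gamma> x w * exp (- m * born x w)) *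
             ennreal (K * (2 + power_sum \<gamma> (snd (w x)))) \<partial>\<Omega>)"
    proof (rule nn_integral_mono_AE, use AE_positive_lifetimes in eventually_elim)
      case (elim w)
      have "ennreal \<bar>compensated \<phi> \<gamma> t x w\<bar>
          \<le> ennreal (weight \<gamma> x w * exp (- m * born x w) * (K * (2 + power_sum \<gamma> (snd (w x)))))"
        by (rule ennreal_leI[OF bound[OF elim]])
      then show ?case by (subst ennreal_mult[symmetric]) (auto simp: K_def add_nonneg_nonneg)
    qed
    also have "\<dots> = ?J x * ((\<integral>\<^sup>+ e. 1 \<partial>unit_exponential) * (\<integral>\<^sup>+ r. ennreal (K * (2 + power_sum \<gamma> r)) \<partial>R))"
    proof (rule nn_integral_resample_times[where x=x])
      show "(\<lambda>w. ennreal (weight \<gamma> x w * exp (- m * born x w)) *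
             ennreal (K * (2 + power_sum \<gamma> (snd (w x))))) \<in> borel_measurable \<Omega>" by measurable
    qed simp_all
    also have "(\<integral>\<^sup>+ r. ennreal (K * (2 + power_sum \<gamma> r)) \<partial>R) = ennreal K * (2 + mom \<gamma>)"
    proof -
      have "(\<integral>\<^sup>+ r. ennreal (K * (2 + power_sum \<gamma> r)) \<partial>R) = (\<integral>\<^sup>+ r. ennreal K * (2 + ennreal (power_sum \<gamma> r)) \<partial>R)"
        by (intro nn_integral_cong) (simp add: ennreal_mult K_def)
      then show ?thesis
        unfolding mom_def by (simp add: nn_integral_cmult nn_integral_add R.emeasure_space_1)
    qed
    finally show ?thesis using ex.emeasure_space_1 by simp
  qed
  then have "(\<Sum>i. \<integral>\<^sup>+ w. ennreal \<bar>compensated \<phi> \<gamma> t (list_decode i) w\<bar> \<partial>\<Omega>)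
      \<le> (\<Sum>i. ?J (list_decode i) * (ennreal K * (2 + mom \<gamma>)))"
    by (intro suminf_le) auto
  also have "\<dots> = (\<Sum>i. ?J (list_decode i)) * (ennreal K * (2 + mom \<gamma>))"
    by (rule ennreal_suminf_multc)
  also have "\<dots> < \<infinity>"
    using suminf_weight_born_finite[of m \<gamma>] m by (auto simp: ennreal_mult_less_top ennreal_less_iff)
  finally show ?thesis .
qed

end

end

context nonexplosive_branching
begin

lemma AE_compensated_limit:
  assumes t: "0 \<le> t"
  shows "AE w in \<Omega>. (\<lambda>n. vsum (compensated \<phi> \<gamma> t) n w) \<longlonglongrightarrow> additive_process \<phi> \<gamma> t w - 1"
  using AE_finite_past' AE_positive_lifetimes AE_space
proof eventually_elim
  case (elim w)
  let ?D = "{x \<in> tree w. born x w \<le> t}"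
  have "(\<lambda>n. \<Sum>i<n. if list_decode i \<in> ?D then compensated \<phi> \<gamma> t (list_decode i) w else 0)
      \<longlonglongrightarrow> (\<Sum>x\<in>?D. compensated \<phi> \<gamma> t x w)"
    using elim by (intro sum_eq_enumerated_limit finite_live) auto
  also have "(\<Sum>x\<in>?D. compensated \<phi> \<gamma> t x w) = additive_process \<phi> \<gamma> t w - 1"
    using elim factor_pos t by (intro vertex_sum_eq_additive) auto
  also have "(\<lambda>n. \<Sum>i<n. if list_decode i \<in> ?D then compensated \<phi> \<gamma> t (list_decode i) w else 0)
      = (\<lambda>n. vsum (compensated \<phi> \<gamma> t) n w)"
    by (intro ext sum.cong) (auto simp: compensated_def weight_def)
  finally show ?case .
qed

context
  fixes \<gamma> m \<phi> :: real
  assumes m: "mom \<gamma> = ennreal m" "0 \<le> m" and \<phi>: "\<phi> = m - 1"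
begin

lemma expectation_additive:
  assumes t: "0 \<le> t"
  shows "integrable \<Omega> (additive_process \<phi> \<gamma> t)" "(\<integral> w. additive_process \<phi> \<gamma> t w \<partial>\<Omega>) = 1"
proof -
  have fin: "(\<Sum>i. \<integral>\<^sup>+ w. ennreal \<bar>compensated \<phi> \<gamma> t (list_decode i) w\<bar> \<partial>\<Omega>) < \<infinity>"
    by (rule suminf_compensated_finite[OF m \<phi> t])
  have int: "integrable \<Omega> (compensated \<phi> \<gamma> t x)" for x
  proof (rule integrableI_bounded)
    have "(\<integral>\<^sup>+ w. ennreal \<bar>compensated \<phi> \<gamma> t x w\<bar> \<partial>\<Omega>)
       \<le> (\<Sum>i. \<integral>\<^sup>+ w. ennreal \<bar>compensated \<phi> \<gamma> t (list_decode i) w\<bar> \<partial>\<Omega>)"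
      using sum_le_suminf[of "\<lambda>i. \<integral>\<^sup>+ w. ennreal \<bar>compensated \<phi> \<gamma> t (list_decode i) w\<bar> \<partial>\<Omega>" "{list_encode x}"] by simp
    then show "(\<integral>\<^sup>+ w. ennreal (norm (compensated \<phi> \<gamma> t x w)) \<partial>\<Omega>) < \<infinity>"
      using fin by (auto intro: le_less_trans)
  qed measurable
  have zero: "(\<integral> w. compensated \<phi> \<gamma> t x w \<partial>\<Omega>) = 0" for x
    using integral_compensated(2)[OF m \<phi>, of t x] by (subst integral_resample[OF int, where x=x]) simp
  note * = integral_series_zero[OF _ fin zero AE_compensated_limit[OF t, of \<phi> \<gamma>]]
  have "integrable \<Omega> (\<lambda>w. additive_process \<phi> \<gamma> t w - 1)" "(\<integral> w. additive_process \<phi> \<gamma> t w - 1 \<partial>\<Omega>) = 0"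
    by (rule *; measurable)+
  then have i: "integrable \<Omega> (\<lambda>w. (additive_process \<phi> \<gamma> t w - 1) + 1)" by (intro Bochner_Integration.integrable_add) auto
  then show "integrable \<Omega> (additive_process \<phi> \<gamma> t)" by simp
  then show "(\<integral> w. additive_process \<phi> \<gamma> t w \<partial>\<Omega>) = 1"
    using \<open>(\<integral> w. additive_process \<phi> \<gamma> t w - 1 \<partial>\<Omega>) = 0\<close> by (simp add: \<Omega>.prob_space)
qed

text \<open>The increment of the process over \<open>[s, t]\<close> is the sum over the vertices of the differences
  of their compensated terms. At a vertex that has died by time \<open>s\<close> the difference vanishes. At
  any other vertex \<open>Z\<close> is insensitive to the mark, over which the difference averages to zero.\<close>

lemma additive_martingale:
  assumes s: "0 \<le> s" "s \<le> t" and Z: "adapted s Z" "Z \<in> borel_measurable \<Omega>" "\<And>w. \<bar>Z w\<bar> \<le> B"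
  shows "(\<integral> w. (additive_process \<phi> \<gamma> t w - additive_process \<phi> \<gamma> s w) * Z w \<partial>\<Omega>) = 0"
proof -
  note [measurable] = Z(2)
  let ?d = "\<lambda>x w. compensated \<phi> \<gamma> t x w - compensated \<phi> \<gamma> s x w"
  have t: "0 \<le> t" using s by simp
  have fint: "(\<Sum>i. \<integral>\<^sup>+ w. ennreal \<bar>compensated \<phi> \<gamma> t (list_decode i) w\<bar> \<partial>\<Omega>) < \<infinity>"
    by (rule suminf_compensated_finite[OF m \<phi> t])
  have fins: "(\<Sum>i. \<integral>\<^sup>+ w. ennreal \<bar>compensated \<phi> \<gamma> s (list_decode i) w\<bar> \<partial>\<Omega>) < \<infinity>"
    by (rule suminf_compensated_finite[OF m \<phi> s(1)])
  have le: "(\<integral>\<^sup>+ w. ennreal \<bar>?d x w * Z w\<bar> \<partial>\<Omega>) \<le> ennreal B *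
      ((\<integral>\<^sup>+ w. ennreal \<bar>compensated \<phi> \<gamma> t x w\<bar> \<partial>\<Omega>) + (\<integral>\<^sup>+ w. ennreal \<bar>compensated \<phi> \<gamma> s x w\<bar> \<partial>\<Omega>))" for x
  proof -
    have B: "0 \<le> B" using Z(3)[of undefined] by linarith
    have "(\<integral>\<^sup>+ w. ennreal \<bar>?d x w * Z w\<bar> \<partial>\<Omega>)
       \<le> (\<integral>\<^sup>+ w. ennreal B * (ennreal \<bar>compensated \<phi> \<gamma> t x w\<bar> + ennreal \<bar>compensated \<phi> \<gamma> s x w\<bar>) \<partial>\<Omega>)"
    proof (rule nn_integral_mono)
      fix w
      have "\<bar>?d x w * Z w\<bar> = \<bar>Z w\<bar> * \<bar>?d x w\<bar>" by (simp add: abs_mult)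
      also have "\<dots> \<le> B * (\<bar>compensated \<phi> \<gamma> t x w\<bar> + \<bar>compensated \<phi> \<gamma> s x w\<bar>)"
        using Z(3)[of w] B by (intro mult_mono abs_triangle_ineq4) auto
      finally show "ennreal \<bar>?d x w * Z w\<bar> \<le> ennreal B * (ennreal \<bar>compensated \<phi> \<gamma> t x w\<bar> + ennreal \<bar>compensated \<phi> \<gamma> s x w\<bar>)"
        using B by (simp add: ennreal_mult[symmetric] ennreal_plus[symmetric] ennreal_leI del: ennreal_plus)
    qed
    then show ?thesis by (simp add: nn_integral_cmult nn_integral_add)
  qed
  have fin: "(\<Sum>i. \<integral>\<^sup>+ w. ennreal \<bar>?d (list_decode i) w * Z w\<bar> \<partial>\<Omega>) < \<infinity>"
  proof -
    have "(\<Sum>i. \<integral>\<^sup>+ w. ennreal \<bar>?d (list_decode i) w * Z w\<bar> \<partial>\<Omega>) \<le> (\<Sum>i. ennreal B *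
      ((\<integral>\<^sup>+ w. ennreal \<bar>compensated \<phi> \<gamma> t (list_decode i) w\<bar> \<partial>\<Omega>) + (\<integral>\<^sup>+ w. ennreal \<bar>compensated \<phi> \<gamma> s (list_decode i) w\<bar> \<partial>\<Omega>)))"
      by (intro suminf_le le) auto
    also have "\<dots> = ennreal B * ((\<Sum>i. \<integral>\<^sup>+ w. ennreal \<bar>compensated \<phi> \<gamma> t (list_decode i) w\<bar> \<partial>\<Omega>) +
        (\<Sum>i. \<integral>\<^sup>+ w. ennreal \<bar>compensated \<phi> \<gamma> s (list_decode i) w\<bar> \<partial>\<Omega>))"
      by (subst ennreal_suminf_cmult, subst suminf_add) auto
    also have "\<dots> < \<infinity>" using fint fins by (auto simp: ennreal_mult_less_top)
    finally show ?thesis .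
  qed
  have int: "integrable \<Omega> (\<lambda>w. ?d x w * Z w)" for x
  proof (rule integrableI_bounded)
    have "(\<integral>\<^sup>+ w. ennreal \<bar>?d x w * Z w\<bar> \<partial>\<Omega>)
       \<le> (\<Sum>i. \<integral>\<^sup>+ w. ennreal \<bar>?d (list_decode i) w * Z w\<bar> \<partial>\<Omega>)"
      using sum_le_suminf[of "\<lambda>i. \<integral>\<^sup>+ w. ennreal \<bar>?d (list_decode i) w * Z w\<bar> \<partial>\<Omega>" "{list_encode x}"] by simp
    then show "(\<integral>\<^sup>+ w. ennreal (norm (?d x w * Z w)) \<partial>\<Omega>) < \<infinity>"
      using fin by (auto intro: le_less_trans)
  qed measurable
  have inner: "(\<integral> q. ?d x (w(x := q)) * Z (w(x := q)) \<partial>Q) = 0"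
    if w: "w \<in> space \<Omega>" "positive_lifetimes w" for x w
  proof -
    \<comment> \<open>a reference mark with which x outlives time s: Z may be evaluated there\<close>
    define q0 where "q0 = (\<bar>s - born x w\<bar> + 1, snd (w x))"
    have q0: "q0 \<in> space Q" "0 < fst q0" "s < born x w + fst q0"
      using w by (auto simp: q0_def space_Q space_\<Omega> Pi_iff mem_Times_iff)
    let ?w0 = "w(x := q0)"
    have w0: "?w0 \<in> space \<Omega>" "positive_lifetimes ?w0"
      using w q0 by (auto intro: upd_in_space simp: positive_lifetimes_def)
    have "AE q in Q. ?d x (w(x := q)) * Z (w(x := q)) = ?d x (w(x := q)) * Z ?w0"
      using AE_mark_lifetime_pos AE_space
    proof eventually_elim
      case (elim q)
      show ?case
      proof (cases "s < born x w + fst q")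
        case True
        have "Z (?w0(x := q)) = Z ?w0"
          using w0 elim q0 True by (intro adaptedD[OF Z(1)]) simp_all
        then show ?thesis by (simp only: fun_upd_upd)
      next
        case False
        have "born x w \<le> s" "born x w \<le> t" "\<not> s - born x w < fst q" "\<not> t - born x w < fst q"
          using False elim s by linarith+
        then have "?d x (w(x := q)) = 0" by (simp add: compensated_def split_factor_def)
        then show ?thesis by simp
      qed
    qed
    moreover have "(\<lambda>q. ?d x (w(x := q)) * Z (w(x := q))) \<in> borel_measurable Q"
    proof -
      have "(\<lambda>p. w(x := p)) \<in> Q \<rightarrow>\<^sub>M \<Omega>"
        using measurable_compose[OF measurable_Pair2'[OF w(1)] measurable_upd] by simp
      moreover have "(\<lambda>w. ?d x w * Z w) \<in> borel_measurable \<Omega>" by measurable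
      ultimately show ?thesis by (rule measurable_compose)
    qed
    moreover have "integrable Q (\<lambda>q. ?d x (w(x := q)))"
      by (intro Bochner_Integration.integrable_diff integral_compensated[OF m \<phi>])
    ultimately have "(\<integral> q. ?d x (w(x := q)) * Z (w(x := q)) \<partial>Q) = (\<integral> q. ?d x (w(x := q)) * Z ?w0 \<partial>Q)"
      by (intro integral_cong_AE) auto
    also have "\<dots> = (\<integral> q. ?d x (w(x := q)) \<partial>Q) * Z ?w0" by simp
    also have "(\<integral> q. ?d x (w(x := q)) \<partial>Q) = 0"
      by (subst Bochner_Integration.integral_diff) (simp_all add: integral_compensated[OF m \<phi>])
    finally show ?thesis by (simp add: fun_upd_def)
  qed
  have zero: "(\<integral> w. ?d x w * Z w \<partial>\<Omega>) = 0" for x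
  proof -
    have "(\<integral> w. ?d x w * Z w \<partial>\<Omega>) = (\<integral> w. \<integral> q. ?d x (w(x := q)) * Z (w(x := q)) \<partial>Q \<partial>\<Omega>)"
      by (rule integral_resample[OF int])
    also have "\<dots> = 0"
      using AE_positive_lifetimes AE_space
      by (intro integral_eq_zero_AE, eventually_elim) (rule inner)
    finally show ?thesis .
  qed
  have lim: "AE w in \<Omega>. (\<lambda>n. \<Sum>i<n. ?d (list_decode i) w * Z w) \<longlonglongrightarrow> (additive_process \<phi> \<gamma> t w - additive_process \<phi> \<gamma> s w) * Z w"
    using AE_compensated_limit[OF t, of \<phi> \<gamma>] AE_compensated_limit[OF s(1), of \<phi> \<gamma>]
  proof eventually_elim
    case (elim w)
    have "(\<lambda>n. (vsum (compensated \<phi> \<gamma> t) n w - vsum (compensated \<phi> \<gamma> s) n w) * Z w)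
        \<longlonglongrightarrow> ((additive_process \<phi> \<gamma> t w - 1) - (additive_process \<phi> \<gamma> s w - 1)) * Z w"
      using elim by (intro tendsto_intros)
    then show ?case by (simp add: sum_subtractf[symmetric] sum_distrib_right)
  qed
  show ?thesis by (rule integral_series_zero(2)[OF _ fin zero lim]) measurable
qed

end

end

section \<open>Upcrossings and almost sure convergence\<close>

text \<open>The strategy of Doob's upcrossing inequality: buy as soon as the process is below \<open>a\<close>,
  sell as soon as it is above \<open>b\<close>.\<close>

primrec holding :: "real \<Rightarrow> real \<Rightarrow> (nat \<Rightarrow> real) \<Rightarrow> nat \<Rightarrow> bool" where
  "holding a b X 0 \<longleftrightarrow> X 0 < a"
| "holding a b X (Suc n) \<longleftrightarrow> (if holding a b X n then X (Suc n) \<le> b else X (Suc n) < a)"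

primrec upcount :: "real \<Rightarrow> real \<Rightarrow> (nat \<Rightarrow> real) \<Rightarrow> nat \<Rightarrow> nat" where
  "upcount a b X 0 = 0"
| "upcount a b X (Suc n) = upcount a b X n + (if holding a b X n \<and> b < X (Suc n) then 1 else 0)"

text \<open>The function \<open>f\<close> makes \<open>k\<close> successive upcrossings of \<open>[a, b]\<close> at times in \<open>D\<close> up to time
  \<open>t\<close>. As it refers to an arbitrary set of times, this applies to the dyadic grids as well as to
  their dense union.\<close>

primrec crossings :: "real set \<Rightarrow> (real \<Rightarrow> real) \<Rightarrow> real \<Rightarrow> real \<Rightarrow> nat \<Rightarrow> real \<Rightarrow> bool" where
  "crossings D f a b 0 t \<longleftrightarrow> True"
| "crossings D f a b (Suc k) t \<longleftrightarrow>
     (\<exists>s\<in>D. \<exists>r\<in>D. s < r \<and> r \<le> t \<and> f s < a \<and> b < f r \<and> crossings D f a b k s)"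

definition grid :: "nat \<Rightarrow> real set" where
  "grid m = range (\<lambda>j::nat. real j / 2 ^ m)"

text \<open>Each completed upcrossing gains at least \<open>b - a\<close>. A position that is still open was bought
  below \<open>a\<close>.\<close>

lemma upcount_gain:
  assumes "a < b"
  shows "(b - a) * real (upcount a b X n) + (if holding a b X n then X n - a else 0)
    \<le> (\<Sum>j<n. if holding a b X j then X (Suc j) - X j else 0)"
  using assms by (induction n) (auto simp: algebra_simps split: if_splits)

lemma upcount_mono: "i \<le> n \<Longrightarrow> upcount a b X i \<le> upcount a b X n"
  by (induction n) (auto simp: le_Suc_eq)

lemma upcount_step:
  assumes "holding a b X i" "i < j" "b < X j"
  shows "upcount a b X i + 1 \<le> upcount a b X j"
proof -
  have *: "holding a b X l \<or> upcount a b X i + 1 \<le> upcount a b X l" if "i \<le> l" for l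
    using that
  proof (induction l rule: dec_induct)
    case (step l)
    then show ?case using upcount_mono[of i l a b X] by (auto simp: not_le)
  qed (use assms in simp)
  obtain l where l: "j = Suc l" "i \<le> l" using assms(2) by (cases j) auto
  show ?thesis using *[OF l(2)] assms(3) l upcount_mono[OF l(2), of a b X] by auto
qed

lemma holding_below:
  assumes "a < b" "X i < a" shows "holding a b X i"
  using assms by (cases i) auto

lemma upcount_ge_crossings:
  assumes ab: "a < b"
  shows "crossings (grid m) f a b k (real n / 2 ^ m) \<Longrightarrow> k \<le> upcount a b (\<lambda>j. f (real j / 2 ^ m)) n"
proof (induction k arbitrary: n)
  case (Suc k)
  then obtain i j where ij: "real i / 2 ^ m < real j / 2 ^ m" "real j / 2 ^ m \<le> real n / 2 ^ m"
      "f (real i / 2 ^ m) < a" "b < f (real j / 2 ^ m)" "crossings (grid m) f a b k (real i / 2 ^ m)"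
    by (auto simp: grid_def)
  then have "i < j" "j \<le> n" by (auto simp: divide_less_cancel divide_le_cancel)
  have "k \<le> upcount a b (\<lambda>j. f (real j / 2 ^ m)) i" by (rule Suc.IH) fact
  moreover have "upcount a b (\<lambda>j. f (real j / 2 ^ m)) i + 1 \<le> upcount a b (\<lambda>j. f (real j / 2 ^ m)) j"
    using ij \<open>i < j\<close> holding_below[OF ab, of "\<lambda>j. f (real j / 2 ^ m)" i]
    by (intro upcount_step) auto
  moreover have "upcount a b (\<lambda>j. f (real j / 2 ^ m)) j \<le> upcount a b (\<lambda>j. f (real j / 2 ^ m)) n"
    using \<open>j \<le> n\<close> by (rule upcount_mono)
  ultimately show ?case by linarith
qed simp

lemma measurable_holding:
  assumes [measurable]: "\<And>j. (\<lambda>w. X w j) \<in> borel_measurable M"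
  shows "Measurable.pred M (\<lambda>w. holding a b (X w) j)"
  by (induction j) simp_all

lemma measurable_upcount:
  assumes [measurable]: "\<And>j. (\<lambda>w. X w j) \<in> borel_measurable M"
  shows "(\<lambda>w. upcount a b (X w) j) \<in> M \<rightarrow>\<^sub>M count_space UNIV"
proof (induction j)
  case (Suc j)
  note [measurable] = Suc measurable_holding[OF assms]
  show ?case unfolding upcount.simps by measurable
qed simp

lemma crossings_mono:
  "D \<subseteq> D' \<Longrightarrow> t \<le> t' \<Longrightarrow> crossings D f a b k t \<Longrightarrow> crossings D' f a b k t'"
proof (induction k arbitrary: t t')
  case (Suc k)
  then obtain s r where "s \<in> D" "r \<in> D" "s < r" "r \<le> t" "f s < a" "b < f r" "crossings D f a b k s"
    by auto
  then have "s \<in> D'" "r \<in> D'" "s < r" "r \<le> t'" "f s < a" "b < f r" "crossings D' f a b k s"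
    using Suc by auto
  then show ?case unfolding crossings.simps by blast
qed simp

lemma grid_mono: "m \<le> m' \<Longrightarrow> grid m \<subseteq> grid m'"
proof
  fix x assume "m \<le> m'" "x \<in> grid m"
  then obtain j where "x = real j / 2 ^ m" by (auto simp: grid_def)
  also have "\<dots> = real (j * 2 ^ (m' - m)) / 2 ^ m'"
    using power_add[of "2::real" m "m' - m"] \<open>m \<le> m'\<close> by (simp add: field_simps)
  finally show "x \<in> grid m'" unfolding grid_def by blast
qed

lemma crossings_grid:
  "crossings (\<Union>m. grid m) f a b k t \<Longrightarrow> \<exists>m. crossings (grid m) f a b k t"
proof (induction k arbitrary: t)
  case (Suc k)
  then obtain s r m1 m2 where sr: "s \<in> grid m1" "r \<in> grid m2" "s < r" "r \<le> t" "f s < a" "b < f r"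
      "crossings (\<Union>m. grid m) f a b k s"
    by auto
  obtain m3 where m3: "crossings (grid m3) f a b k s" using Suc.IH[OF sr(7)] by blast
  let ?m = "m1 + m2 + m3"
  have "crossings (grid ?m) f a b k s" using crossings_mono[OF grid_mono order_refl m3, of ?m] by simp
  moreover have "s \<in> grid ?m" "r \<in> grid ?m" using sr grid_mono[of m1 ?m] grid_mono[of m2 ?m] by auto
  ultimately show ?case using sr unfolding crossings.simps by blast
qed simp

lemma countable_grid: "countable (\<Union>m. grid m)"
  by (intro countable_UN) (auto simp: grid_def)

lemma grid_dense:
  assumes "0 \<le> t" "t < u"
  shows "\<exists>s\<in>(\<Union>m. grid m). t < s \<and> s < u"
proof -
  obtain m where m: "(1 / 2) ^ m < u - t"
    using real_arch_pow_inv[of "u - t" "1/2"] assms by auto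
  define j where "j = nat (\<lfloor>t * 2 ^ m\<rfloor> + 1)"
  have j: "real j = of_int \<lfloor>t * 2 ^ m\<rfloor> + 1"
    using assms by (simp add: j_def)
  have "t * 2 ^ m < real j" "real j \<le> t * 2 ^ m + 1" unfolding j by linarith+
  then have "t < real j / 2 ^ m" "real j / 2 ^ m \<le> t + (1 / 2) ^ m"
    by (auto simp: field_simps power_one_over)
  then have "t < real j / 2 ^ m \<and> real j / 2 ^ m < u" using m by linarith
  then show ?thesis by (intro bexI[of _ "real j / 2 ^ m"]) (auto simp: grid_def)
qed

lemma pred_countable_Bex:
  assumes "countable D" "\<And>s. s \<in> D \<Longrightarrow> Measurable.pred M (P s)"
  shows "Measurable.pred M (\<lambda>w. \<exists>s\<in>D. P s w)"
proof -
  have "{w \<in> space M. \<exists>s\<in>D. P s w} = (\<Union>s\<in>D. {w \<in> space M. P s w})" by blast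
  also have "\<dots> \<in> sets M" using assms by (intro sets.countable_UN') (auto simp: pred_def)
  finally show ?thesis by (simp add: pred_def)
qed

text \<open>If the lower and the upper limit were different, an interval with rational endpoints
  between them would be crossed arbitrarily often, and by right continuity also along the dense
  grid. The limit is finite since \<open>f\<close> does not exceed \<open>B\<close> for infinitely many integers.\<close>

lemma convergent_if_few_crossings:
  fixes f :: "real \<Rightarrow> real"
  assumes nonneg: "\<And>t. 0 \<le> f t"
    and right: "\<And>t. 0 \<le> t \<Longrightarrow> (f \<longlongrightarrow> f t) (at_right t)"
    and few: "\<And>a b. a \<in> \<rat> \<Longrightarrow> b \<in> \<rat> \<Longrightarrow> 0 < a \<Longrightarrow> a < b \<Longrightarrow> \<exists>k. \<forall>t. \<not> crossings (\<Union>m. grid m) f a b k t"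
    and bounded: "\<exists>\<^sub>F n in sequentially. f (real n) \<le> B"
  shows "\<exists>L. (f \<longlongrightarrow> L) at_top"
proof -
  let ?l = "Liminf at_top (\<lambda>t. ereal (f t))" and ?u = "Limsup at_top (\<lambda>t. ereal (f t))"
  have "?l \<le> ?u" by (rule Liminf_le_Limsup) simp
  have l0: "0 \<le> ?l" by (rule Liminf_bounded) (simp add: nonneg)
  have "\<not> ?l < ?u"
  proof
    assume "?l < ?u"
    then obtain a' where a': "?l < ereal a'" "ereal a' < ?u" using ereal_dense2 by blast
    then obtain b' where b': "ereal a' < ereal b'" "ereal b' < ?u" using ereal_dense2 by blast
    obtain a b where ab: "a \<in> \<rat>" "b \<in> \<rat>" "a' < a" "a < b" "b < b'"
      using b'(1) Rats_dense_in_real by (metis less_ereal.simps(1))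
    have la: "?l < ereal a" by (rule less_trans[OF a'(1)]) (use ab in simp)
    have bu: "ereal b < ?u" by (rule less_trans[OF _ b'(2)]) (use ab in simp)
    have "0 < a" using l0 la by (metis ereal_less(2) le_less_trans)
    have low: "\<exists>s\<in>(\<Union>m. grid m). T < s \<and> f s < a" for T
    proof -
      have "\<not> (\<forall>\<^sub>F t in at_top. ereal a \<le> ereal (f t))"
        using la Liminf_bounded[of "ereal a" "\<lambda>t. ereal (f t)" at_top] by (auto simp: not_le[symmetric])
      then have "\<not> (\<forall>t\<ge>max 0 (T + 1). a \<le> f t)"
        using eventually_at_top_linorderI[of "max 0 (T + 1)" "\<lambda>t. ereal a \<le> ereal (f t)"] by auto
      then obtain t where t: "0 \<le> t" "T < t" "f t < a" by (auto simp: not_le)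
      have "\<forall>\<^sub>F s in at_right t. f s < a" using right[OF t(1)] t(3) by (rule order_tendstoD)
      then obtain u where u: "t < u" "\<And>s. t < s \<Longrightarrow> s < u \<Longrightarrow> f s < a"
        unfolding eventually_at_right_field by blast
      obtain s where "s \<in> (\<Union>m. grid m)" "t < s" "s < u" using grid_dense[OF t(1) u(1)] by blast
      then show ?thesis using u(2)[of s] t by (intro bexI[of _ s]) auto
    qed
    have high: "\<exists>s\<in>(\<Union>m. grid m). T < s \<and> b < f s" for T
    proof -
      have "\<not> (\<forall>\<^sub>F t in at_top. ereal (f t) \<le> ereal b)"
        using bu Limsup_bounded[of "\<lambda>t. ereal (f t)" "ereal b" at_top] by (auto simp: not_le[symmetric])
      then have "\<not> (\<forall>t\<ge>max 0 (T + 1). f t \<le> b)"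
        using eventually_at_top_linorderI[of "max 0 (T + 1)" "\<lambda>t. ereal (f t) \<le> ereal b"] by auto
      then obtain t where t: "0 \<le> t" "T < t" "b < f t" by (auto simp: not_le)
      have "\<forall>\<^sub>F s in at_right t. b < f s" using right[OF t(1)] t(3) by (rule order_tendstoD)
      then obtain u where u: "t < u" "\<And>s. t < s \<Longrightarrow> s < u \<Longrightarrow> b < f s"
        unfolding eventually_at_right_field by blast
      obtain s where "s \<in> (\<Union>m. grid m)" "t < s" "s < u" using grid_dense[OF t(1) u(1)] by blast
      then show ?thesis using u(2)[of s] t by (intro bexI[of _ s]) auto
    qed
    have "\<exists>t. crossings (\<Union>m. grid m) f a b k t" for k
    proof (induction k)
      case (Suc k)
      then obtain t where t: "crossings (\<Union>m. grid m) f a b k t" by blast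
      obtain s where s: "s \<in> (\<Union>m. grid m)" "t < s" "f s < a" using low by blast
      obtain r where r: "r \<in> (\<Union>m. grid m)" "s < r" "b < f r" using high by blast
      have "crossings (\<Union>m. grid m) f a b k s" using t s by (intro crossings_mono[OF order_refl _ t]) simp
      then show ?case using s r unfolding crossings.simps by blast
    qed simp
    then show False using few[OF ab(1,2) \<open>0 < a\<close> ab(4)] by blast
  qed
  then have eq: "?l = ?u" using \<open>?l \<le> ?u\<close> by auto
  have "?l \<le> ereal B"
  proof (rule ccontr)
    assume "\<not> ?l \<le> ereal B"
    then have "\<forall>\<^sub>F t in at_top. ereal B < ereal (f t)" by (intro less_LiminfD) auto
    then have "\<forall>\<^sub>F n in sequentially. ereal B < ereal (f (real n))"
      by (rule eventually_compose_filterlim[OF _ filterlim_real_sequentially])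
    then show False using bounded by (simp add: frequently_def not_le)
  qed
  then obtain L where L: "?l = ereal L" using l0 by (cases ?l) auto
  have "((\<lambda>t. ereal (f t)) \<longlongrightarrow> ereal L) at_top"
    using L eq by (intro Liminf_eq_Limsup) auto
  then show ?thesis by auto
qed

text \<open>Only finitely many vertices die before time \<open>t + 1\<close>, so there is a first death after time
  \<open>t\<close>, and the population is constant until then.\<close>

lemma live_right_constant:
  assumes fin: "finite (past (t + 1) w)" and t: "0 \<le> t"
  shows "\<forall>\<^sub>F s in at_right t. live s w = live t w"
proof -
  let ?T = "insert (t + 1) ((\<lambda>x. dies x w) ` {x \<in> past (t + 1) w. t < dies x w})"
  define u where "u = Min ?T"
  have finT: "finite ?T" using fin by simp
  have "u \<in> ?T" unfolding u_def by (rule Min_in) (use finT in auto)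
  then have tu: "t < u" by auto
  have no_death: "\<not> (t < dies x w \<and> dies x w \<le> s)" if "s < u" "x \<in> tree w" for x s
  proof
    assume d: "t < dies x w \<and> dies x w \<le> s"
    have "u \<le> t + 1" unfolding u_def using finT by (intro Min_le) auto
    then have "x \<in> past (t + 1) w" using d that by (auto simp: dead_def)
    then have "u \<le> dies x w" unfolding u_def using finT d by (intro Min_le) auto
    then show False using d that by linarith
  qed
  have "live s w = live t w" if s: "t < s" "s < u" for s
  proof (intro set_eqI iffI)
    fix x assume "x \<in> live s w"
    then have x: "x \<in> tree w" "born x w \<le> s" "s < dies x w" by (auto simp: alive_def)
    have "born x w \<le> t"
    proof (cases x)
      case (Cons i z)
      then have "z \<in> tree w" "born x w = dies z w" using x by (auto simp: death_def)
      then show ?thesis using no_death[OF s(2), of z] x(2) by auto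
    qed (use t in simp)
    then show "x \<in> live t w" using x s tu by (auto simp: alive_def) 
  next
    fix x assume "x \<in> live t w"
    then show "x \<in> live s w" using no_death[OF s(2), of x] s by (auto simp: alive_def not_le)
  qed
  then show ?thesis using tu unfolding eventually_at_right_field by blast
qed

lemma additive_right_continuous:
  assumes fin: "finite (past (t + 1) w)" and t: "0 \<le> t"
  shows "((\<lambda>s. additive_process \<phi> \<gamma> s w) \<longlongrightarrow> additive_process \<phi> \<gamma> t w) (at_right t)"
proof -
  have "((\<lambda>s. exp (- \<phi> * s) * live_sum \<gamma> t w) \<longlongrightarrow> exp (- \<phi> * t) * live_sum \<gamma> t w) (at_right t)"
    by (intro tendsto_intros)
  moreover have "\<forall>\<^sub>F s in at_right t. exp (- \<phi> * s) * live_sum \<gamma> t w = additive_process \<phi> \<gamma> s w"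
    using live_right_constant[OF fin t] by eventually_elim (simp add: additive_eq live_sum_def)
  ultimately show ?thesis
    using tendsto_cong[of "\<lambda>s. exp (- \<phi> * s) * live_sum \<gamma> t w" "\<lambda>s. additive_process \<phi> \<gamma> s w" "at_right t"]
    by (simp add: additive_eq)
qed

lemma additive_nonneg [simp]: "0 \<le> additive_process \<phi> \<gamma> t w"
  by (simp add: additive_eq)

context nonexplosive_branching
begin

context
  fixes \<gamma> m \<phi> :: real
  assumes m: "mom \<gamma> = ennreal m" "0 \<le> m" and \<phi>: "\<phi> = m - 1"
begin

text \<open>Whether the position is open at a grid time depends on the past only, so by the martingale
  property the strategy gains nothing on average. It gains \<open>b - a\<close> per upcrossing and loses at
  most \<open>a\<close> on an open position, the process being nonnegative.\<close>

lemma upcrossing_inequality: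
  assumes ab: "0 < a" "a < b"
  shows "measure \<Omega> {w \<in> space \<Omega>. k \<le> upcount a b (\<lambda>j. additive_process \<phi> \<gamma> (real j / 2 ^ g) w) n} * real k
    \<le> a / (b - a)"
proof -
  define X where "X w j = additive_process \<phi> \<gamma> (real j / 2 ^ g) w" for w j
  have X [measurable]: "(\<lambda>w. X w j) \<in> borel_measurable \<Omega>" for j by (simp add: X_def)
  have hold [measurable]: "Measurable.pred \<Omega> (\<lambda>w. holding a b (X w) j)" for j
    by (rule measurable_holding) measurable
  have [measurable]: "(\<lambda>w. upcount a b (X w) j) \<in> \<Omega> \<rightarrow>\<^sub>M count_space UNIV" for j
    by (rule measurable_upcount) measurable
  have adapted_hold: "adapted (real j / 2 ^ g) (\<lambda>w. of_bool (holding a b (X w) j))" for j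
  proof -
    have "holding a b (X (w(x := q))) i = holding a b (X w) i"
      if "i \<le> j" "w \<in> space \<Omega>" "q \<in> space Q" "positive_lifetimes w" "0 < fst q"
        "real j / 2 ^ g < dies x w" "real j / 2 ^ g < born x w + fst q" for i w x q
    proof -
      have "X (w(x := q)) i = X w i" if "i \<le> j" for i
        unfolding X_def using that \<open>w \<in> space \<Omega>\<close> \<open>q \<in> space Q\<close> \<open>positive_lifetimes w\<close> \<open>0 < fst q\<close>
          \<open>real j / 2 ^ g < dies x w\<close> \<open>real j / 2 ^ g < born x w + fst q\<close>
        by (intro adaptedD[OF adapted_additive]) (auto simp: divide_right_mono)
      then show ?thesis using \<open>i \<le> j\<close> by (induction i) auto
    qed
    then show ?thesis unfolding adapted_def by auto
  qed
  have int: "integrable \<Omega> (\<lambda>w. X w j)" for j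
    unfolding X_def by (rule expectation_additive[OF m \<phi>]) simp
  let ?G = "\<lambda>w j. if holding a b (X w) j then X w (Suc j) - X w j else 0"
  have G_eq: "?G w j = (X w (Suc j) - X w j) * of_bool (holding a b (X w) j)" for w j by simp
  have intG: "integrable \<Omega> (\<lambda>w. ?G w j)" for j
    unfolding G_eq
    by (rule Bochner_Integration.integrable_bound[OF Bochner_Integration.integrable_diff[OF int int, of "Suc j" j]])
       (auto simp: of_bool_def)
  have zero: "(\<integral> w. ?G w j \<partial>\<Omega>) = 0" for j
    unfolding G_eq unfolding X_def
    by (rule additive_martingale[OF m \<phi>, where B=1])
       (use adapted_hold[of j, unfolded X_def] hold[of j, unfolded X_def] in
         \<open>auto simp: divide_right_mono\<close>)
  have pw: "(b - a) * real (upcount a b (X w) n) - a \<le> (\<Sum>j<n. ?G w j)" for w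
  proof -
    have "0 \<le> X w n" by (simp add: X_def)
    then show ?thesis
      using upcount_gain[OF ab(2), of "X w" n] ab(1) by (cases "holding a b (X w) n") auto
  qed
  define A where "A = {w \<in> space \<Omega>. k \<le> upcount a b (X w) n}"
  have A: "A \<in> sets \<Omega>" unfolding A_def by measurable
  have intA: "integrable \<Omega> (\<lambda>w. (b - a) * (real k * indicator A w))"
    using A by (intro integrable_mult_right) (auto simp: less_top[symmetric])
  have "(b - a) * (real k * measure \<Omega> A) - a = (\<integral> w. (b - a) * (real k * indicator A w) - a \<partial>\<Omega>)"
    using A intA by (subst Bochner_Integration.integral_diff) (auto simp: \<Omega>.prob_space)
  also have "\<dots> \<le> (\<integral> w. (\<Sum>j<n. ?G w j) \<partial>\<Omega>)"
  proof (rule integral_mono)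
    show "integrable \<Omega> (\<lambda>w. (b - a) * (real k * indicator A w) - a)"
      using intA by (rule Bochner_Integration.integrable_diff) simp
    show "integrable \<Omega> (\<lambda>w. \<Sum>j<n. ?G w j)" using intG by simp
    fix w
    have "real k * indicator A w \<le> real (upcount a b (X w) n)"
      by (auto simp: indicator_def A_def)
    then have "(b - a) * (real k * indicator A w) \<le> (b - a) * real (upcount a b (X w) n)"
      using ab by (intro mult_left_mono) auto
    then show "(b - a) * (real k * indicator A w) - a \<le> (\<Sum>j<n. ?G w j)"
      using pw[of w] by linarith
  qed
  also have "\<dots> = 0" using intG zero by simp
  finally have "measure \<Omega> A * real k \<le> a / (b - a)" using ab by (simp add: field_simps)
  then show ?thesis by (simp add: A_def X_def[abs_def])
qed

lemma measurable_crossings [measurable]: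
  "Measurable.pred \<Omega> (\<lambda>w. crossings (\<Union>g. grid g) (\<lambda>t. additive_process \<phi> \<gamma> t w) a b k t)"
  "Measurable.pred \<Omega> (\<lambda>w. crossings (grid g) (\<lambda>t. additive_process \<phi> \<gamma> t w) a b k t)"
proof -
  have "Measurable.pred \<Omega> (\<lambda>w. crossings D (\<lambda>t. additive_process \<phi> \<gamma> t w) a b k t)"
    if "countable D" for D
  proof (induction k arbitrary: t)
    case (Suc k)
    note [measurable] = Suc
    show ?case unfolding crossings.simps
      by (intro pred_countable_Bex that) measurable
  qed simp
  moreover have "countable (grid g)" by (simp add: grid_def)
  ultimately show "Measurable.pred \<Omega> (\<lambda>w. crossings (\<Union>g. grid g) (\<lambda>t. additive_process \<phi> \<gamma> t w) a b k t)"
    "Measurable.pred \<Omega> (\<lambda>w. crossings (grid g) (\<lambda>t. additive_process \<phi> \<gamma> t w) a b k t)"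
    using countable_grid by auto
qed

text \<open>The bound \<open>a / ((b - a) k)\<close> on the probability of \<open>k\<close> upcrossings depends neither on the
  mesh nor on the time horizon, and therefore carries over to the union of all grids.\<close>

lemma AE_few_crossings:
  assumes ab: "0 < a" "a < b"
  shows "AE w in \<Omega>. \<exists>k. \<forall>t. \<not> crossings (\<Union>g. grid g) (\<lambda>t. additive_process \<phi> \<gamma> t w) a b k t"
proof -
  let ?A = "\<lambda>k g. {w \<in> space \<Omega>. crossings (grid g) (\<lambda>t. additive_process \<phi> \<gamma> t w) a b k (real g)}"
  have A: "?A k g \<in> sets \<Omega>" for k g by measurable
  have inc: "incseq (?A k)" for k
  proof (intro monoI subsetI)
    fix g g' :: nat and w assume g: "g \<le> g'" and w: "w \<in> ?A k g"
    then have "crossings (grid g') (\<lambda>t. additive_process \<phi> \<gamma> t w) a b k (real g')"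
      by (intro crossings_mono[OF grid_mono[OF g], of "real g" "real g'"]) auto
    then show "w \<in> ?A k g'" using w by simp
  qed
  have le: "measure \<Omega> (\<Union>g. ?A k g) * real k \<le> a / (b - a)" for k
  proof (rule LIMSEQ_le_const2)
    show "(\<lambda>g. measure \<Omega> (?A k g) * real k) \<longlonglongrightarrow> measure \<Omega> (\<Union>g. ?A k g) * real k"
      using A inc by (intro tendsto_mult tendsto_const \<Omega>.finite_Lim_measure_incseq) auto
    show "\<exists>N. \<forall>g\<ge>N. measure \<Omega> (?A k g) * real k \<le> a / (b - a)"
    proof (intro exI allI impI)
      fix g
      let ?U = "{w \<in> space \<Omega>. k \<le> upcount a b (\<lambda>j. additive_process \<phi> \<gamma> (real j / 2 ^ g) w) (g * 2 ^ g)}"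
      have "?A k g \<subseteq> ?U"
        using upcount_ge_crossings[OF ab(2), of g _ k "g * 2 ^ g"] by auto
      moreover have "?U \<in> sets \<Omega>"
      proof -
        have [measurable]: "(\<lambda>w. upcount a b (\<lambda>j. additive_process \<phi> \<gamma> (real j / 2 ^ g) w) j) \<in> \<Omega> \<rightarrow>\<^sub>M count_space UNIV" for j
          by (rule measurable_upcount) measurable
        show ?thesis by measurable
      qed
      ultimately have "measure \<Omega> (?A k g) \<le> measure \<Omega> ?U" by (rule \<Omega>.finite_measure_mono)
      then have "measure \<Omega> (?A k g) * real k \<le> measure \<Omega> ?U * real k" by (rule mult_right_mono) simp
      also have "\<dots> \<le> a / (b - a)" by (rule upcrossing_inequality[OF ab])
      finally show "measure \<Omega> (?A k g) * real k \<le> a / (b - a)" .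
    qed
  qed
  let ?N = "\<Inter>k. \<Union>g. ?A k g"
  have N: "?N \<in> sets \<Omega>" using A by auto
  have "measure \<Omega> ?N * real k \<le> a / (b - a)" for k
  proof -
    have "measure \<Omega> ?N \<le> measure \<Omega> (\<Union>g. ?A k g)" using A by (intro \<Omega>.finite_measure_mono) auto
    then have "measure \<Omega> ?N * real k \<le> measure \<Omega> (\<Union>g. ?A k g) * real k" by (rule mult_right_mono) simp
    then show ?thesis using le[of k] by linarith
  qed
  then have "measure \<Omega> ?N = 0"
  proof -
    assume *: "\<And>k. measure \<Omega> ?N * real k \<le> a / (b - a)"
    show ?thesis
    proof (rule ccontr)
      assume "measure \<Omega> ?N \<noteq> 0"
      then have "0 < measure \<Omega> ?N" by (simp add: zero_less_measure_iff)
      then obtain k where "a / (b - a) < real k * measure \<Omega> ?N" using reals_Archimedean3 by blast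
      then show False using *[of k] by (simp add: mult.commute)
    qed
  qed
  then have "AE w in \<Omega>. w \<notin> ?N"
    using N by (intro AE_not_in) (auto simp: null_sets_def \<Omega>.emeasure_eq_measure)
  then show ?thesis
    using AE_space
  proof eventually_elim
    case (elim w)
    then obtain k where k: "\<And>g. \<not> crossings (grid g) (\<lambda>t. additive_process \<phi> \<gamma> t w) a b k (real g)" by auto
    have "\<not> crossings (\<Union>g. grid g) (\<lambda>t. additive_process \<phi> \<gamma> t w) a b k t" for t
    proof
      assume "crossings (\<Union>g. grid g) (\<lambda>t. additive_process \<phi> \<gamma> t w) a b k t"
      then obtain g where g: "crossings (grid g) (\<lambda>t. additive_process \<phi> \<gamma> t w) a b k t"
        using crossings_grid by blast
      obtain n where n: "t \<le> real n" using real_arch_simple by blast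
      have "crossings (grid (g + n)) (\<lambda>t. additive_process \<phi> \<gamma> t w) a b k (real (g + n))"
        using n by (intro crossings_mono[OF grid_mono _ g]) auto
      then show False using k by blast
    qed
    then show ?case by blast
  qed
qed

definition limit_additive :: "config \<Rightarrow> real" where
  "limit_additive w = lim (\<lambda>n. additive_process \<phi> \<gamma> (real n) w)"

lemma measurable_limit_additive [measurable]: "limit_additive \<in> borel_measurable \<Omega>"
  unfolding limit_additive_def[abs_def] by measurable

text \<open>Infinitely many upcrossings of rational intervals are excluded almost surely, and Fatou's
  lemma bounds the lower limit along the integers.\<close>

theorem AE_additive_converges:
  "AE w in \<Omega>. ((\<lambda>t. additive_process \<phi> \<gamma> t w) \<longlongrightarrow> limit_additive w) at_top"
proof -
  have "(\<integral>\<^sup>+ w. liminf (\<lambda>n. ennreal (additive_process \<phi> \<gamma> (real n) w)) \<partial>\<Omega>)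
      \<le> liminf (\<lambda>n. \<integral>\<^sup>+ w. ennreal (additive_process \<phi> \<gamma> (real n) w) \<partial>\<Omega>)"
    by (rule nn_integral_liminf) measurable
  also have "(\<lambda>n. \<integral>\<^sup>+ w. ennreal (additive_process \<phi> \<gamma> (real n) w) \<partial>\<Omega>) = (\<lambda>n. 1)"
    using expectation_additive[OF m \<phi>] by (subst nn_integral_eq_integral) auto
  finally have "(\<integral>\<^sup>+ w. liminf (\<lambda>n. ennreal (additive_process \<phi> \<gamma> (real n) w)) \<partial>\<Omega>) \<noteq> \<infinity>"
    by (auto simp: Liminf_const top_unique)
  then have finite_liminf: "AE w in \<Omega>. liminf (\<lambda>n. ennreal (additive_process \<phi> \<gamma> (real n) w)) \<noteq> \<infinity>"
    by (intro nn_integral_PInf_AE) auto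
  have "AE w in \<Omega>. \<forall>(a, b)\<in>(\<rat> \<times> \<rat>). 0 < a \<longrightarrow> a < b \<longrightarrow>
      (\<exists>k. \<forall>t. \<not> crossings (\<Union>g. grid g) (\<lambda>t. additive_process \<phi> \<gamma> t w) a b k t)"
    using countable_rat by (subst AE_ball_countable) (auto intro: AE_few_crossings)
  then have "AE w in \<Omega>. \<exists>L. ((\<lambda>t. additive_process \<phi> \<gamma> t w) \<longlongrightarrow> L) at_top"
    using finite_liminf AE_finite_past'
  proof eventually_elim
    case (elim w)
    obtain r where r: "liminf (\<lambda>n. ennreal (additive_process \<phi> \<gamma> (real n) w)) = ennreal r" "0 \<le> r"
      using elim(2) by (cases "liminf (\<lambda>n. ennreal (additive_process \<phi> \<gamma> (real n) w))") auto
    define B where "B = r + 1"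
    have B: "liminf (\<lambda>n. ennreal (additive_process \<phi> \<gamma> (real n) w)) < ennreal B"
      using r by (simp add: B_def ennreal_less_iff)
    show ?case
    proof (rule convergent_if_few_crossings)
      show "((\<lambda>t. additive_process \<phi> \<gamma> t w) \<longlongrightarrow> additive_process \<phi> \<gamma> t w) (at_right t)" if "0 \<le> t" for t
        using elim(3) that by (intro additive_right_continuous) blast+
      show "\<exists>\<^sub>F n in sequentially. additive_process \<phi> \<gamma> (real n) w \<le> B"
      proof (rule ccontr)
        assume "\<not> ?thesis"
        then have "\<forall>\<^sub>F n in sequentially. ennreal B \<le> ennreal (additive_process \<phi> \<gamma> (real n) w)"
          unfolding frequently_def by (auto elim!: eventually_mono intro: ennreal_leI)
        then have "ennreal B \<le> liminf (\<lambda>n. ennreal (additive_process \<phi> \<gamma> (real n) w))"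
          by (rule Liminf_bounded)
        then show False using B by simp
      qed
    qed (use elim(1) in auto)
  qed
  then show ?thesis
  proof eventually_elim
    case (elim w)
    then obtain L where L: "((\<lambda>t. additive_process \<phi> \<gamma> t w) \<longlongrightarrow> L) at_top" by blast
    then have "(\<lambda>n. additive_process \<phi> \<gamma> (real n) w) \<longlonglongrightarrow> L"
      by (rule filterlim_compose[OF _ filterlim_real_sequentially])
    then have "limit_additive w = L" unfolding limit_additive_def by (rule limI)
    then show ?case using L by simp
  qed
qed

end

end

section \<open>Second moments\<close>

lemma suminf_labels:
  fixes f :: "nat list \<Rightarrow> real"
  assumes "finite D" "\<And>x. x \<in> D \<Longrightarrow> 0 \<le> f x"
  shows "(\<Sum>i. ennreal (if list_decode i \<in> D then f (list_decode i) else 0)) = ennreal (sum f D)"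
  using sum_eq_enumerated_limit[OF assms(1), of f] assms(2)
  by (intro suminf_ennreal_eq) (auto simp: sums_def)

context marked_branching
begin

definition past_mass :: "real \<Rightarrow> real \<Rightarrow> nat list \<Rightarrow> ennreal" where
  "past_mass \<gamma> t x = (\<integral>\<^sup>+ w. ennreal (if dies x w \<le> t then weight \<gamma> x w else 0) \<partial>\<Omega>)"

lemma suminf_past_mass_finite:
  assumes m: "mom \<gamma> = ennreal m" "0 \<le> m"
  shows "(\<Sum>i. past_mass \<gamma> t (list_decode i)) < \<infinity>"
proof -
  let ?J = "\<lambda>x. \<integral>\<^sup>+ w. ennreal (weight \<gamma> x w * exp (- m * dies x w)) \<partial>\<Omega>"
  have "past_mass \<gamma> t x \<le> ennreal (exp (m * t)) * ?J x" for x
  proof -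
    have "past_mass \<gamma> t x \<le> (\<integral>\<^sup>+ w. ennreal (exp (m * t)) * ennreal (weight \<gamma> x w * exp (- m * dies x w)) \<partial>\<Omega>)"
      unfolding past_mass_def
    proof (rule nn_integral_mono)
      fix w
      have "weight \<gamma> x w \<le> exp (m * t) * (weight \<gamma> x w * exp (- m * dies x w))" if "dies x w \<le> t"
      proof -
        have "m * dies x w \<le> m * t" using mult_left_mono[OF that m(2)] .
        then have "1 \<le> exp (m * t) * exp (- m * dies x w)" by (simp add: exp_add[symmetric])
        then have "weight \<gamma> x w * 1 \<le> weight \<gamma> x w * (exp (m * t) * exp (- m * dies x w))"
          by (rule mult_left_mono) simp
        then show ?thesis by (simp add: mult_ac)
      qed
      then show "ennreal (if dies x w \<le> t then weight \<gamma> x w else 0)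
          \<le> ennreal (exp (m * t)) * ennreal (weight \<gamma> x w * exp (- m * dies x w))"
        by (auto simp: ennreal_mult[symmetric] intro!: ennreal_leI)
    qed
    also have "\<dots> = ennreal (exp (m * t)) * ?J x" by (rule nn_integral_cmult) measurable
    finally show ?thesis .
  qed
  then have "(\<Sum>i. past_mass \<gamma> t (list_decode i)) \<le> (\<Sum>i. ennreal (exp (m * t)) * ?J (list_decode i))"
    by (intro suminf_le) auto
  also have "\<dots> = ennreal (exp (m * t)) * ((\<Sum>i. \<integral>\<^sup>+ w. ennreal (weight \<gamma> (list_decode i) w *
      exp (- m * born (list_decode i) w)) \<partial>\<Omega>) * ennreal (1 / (1 + m)))"
    using m by (subst nn_integral_weight_dies) (auto simp: ennreal_suminf_cmult ennreal_suminf_multc)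
  also have "\<dots> < \<infinity>"
    using suminf_weight_born_finite[of m \<gamma>] m by (auto simp: ennreal_mult_less_top ennreal_less_iff)
  finally show ?thesis .
qed

end

context nonexplosive_branching
begin

text \<open>Let \<open>G\<close> be the expected sum of \<open>exp (\<gamma> V(x))\<close> over the vertices that have died by time
  \<open>t\<close>. Since every death replaces the term of a vertex by those of its children,
  \<open>exp (\<phi> t) + G = 1 + m G\<close>, which determines \<open>G\<close>.\<close>

lemma suminf_past_mass:
  assumes m: "mom \<gamma> = ennreal m" "0 \<le> m" and \<phi>: "\<phi> = m - 1" "\<phi> \<noteq> 0" and t: "0 \<le> t"
  shows "(\<Sum>i. past_mass \<gamma> t (list_decode i)) = ennreal ((exp (\<phi> * t) - 1) / \<phi>)"
proof -
  let ?e = "\<lambda>w x. exp (\<gamma> * pos factor x w)"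
  let ?S = "\<lambda>w x. power_sum \<gamma> (snd (w x))"
  have e [measurable]: "(\<lambda>w. ?e w x) \<in> borel_measurable \<Omega>" for x by measurable
  have pm [measurable]: "(\<lambda>w. \<Sum>x\<in>past t w. ?e w x) \<in> borel_measurable \<Omega>"
    "(\<lambda>w. \<Sum>x\<in>past t w. ?e w x * ?S w x) \<in> borel_measurable \<Omega>"
    by (intro borel_measurable_sum_labels measurable_past; measurable)+
  have lm [measurable]: "live_sum \<gamma> t \<in> borel_measurable \<Omega>"
    unfolding live_sum_def[abs_def] by (intro borel_measurable_sum_labels measurable_live) measurable
  have balance: "AE w in \<Omega>. live_sum \<gamma> t w + (\<Sum>x\<in>past t w. ?e w x) = 1 + (\<Sum>x\<in>past t w. ?e w x * ?S w x)"
    using AE_finite_past' AE_positive_lifetimes AE_space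
  proof eventually_elim
    case (elim w)
    let ?D = "{x \<in> tree w. born x w \<le> t}"
    have fin: "finite ?D" "finite (past t w)" using elim finite_live by auto
    have sub: "past t w \<subseteq> ?D"
      using born_le_dies[OF elim(2)] by (auto simp: dead_def intro: order_trans)
    have "(\<Sum>x\<in>?D. compensated 0 \<gamma> t x w) = live_sum \<gamma> t w - 1"
      using vertex_sum_eq_additive[of t w 0 \<gamma>] elim factor_pos[of w] t by (simp add: additive_eq)
    moreover have "(\<Sum>x\<in>?D. compensated 0 \<gamma> t x w) = (\<Sum>x\<in>past t w. ?e w x * (?S w x - 1))"
    proof (rule sum.mono_neutral_cong_right[OF fin(1) sub])
      show "\<forall>x\<in>?D - past t w. compensated 0 \<gamma> t x w = 0"
        by (auto simp: compensated_def split_factor_def dead_def death_def lifetime_def)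
      fix x assume "x \<in> past t w"
      then show "compensated 0 \<gamma> t x w = ?e w x * (?S w x - 1)"
        using sub by (auto simp: compensated_def split_factor_def dead_def death_def lifetime_def weight_def)
    qed
    ultimately show ?case by (simp add: right_diff_distrib sum_subtractf)
  qed
  have G: "(\<integral>\<^sup>+ w. ennreal (\<Sum>x\<in>past t w. ?e w x) \<partial>\<Omega>) = (\<Sum>i. past_mass \<gamma> t (list_decode i))"
  proof -
    have "(\<integral>\<^sup>+ w. ennreal (\<Sum>x\<in>past t w. ?e w x) \<partial>\<Omega>)
        = (\<integral>\<^sup>+ w. (\<Sum>i. ennreal (if dies (list_decode i) w \<le> t then weight \<gamma> (list_decode i) w else 0)) \<partial>\<Omega>)"
    proof (rule nn_integral_cong_AE, use AE_finite_past' in eventually_elim)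
      case (elim w)
      have "(\<Sum>i. ennreal (if dies (list_decode i) w \<le> t then weight \<gamma> (list_decode i) w else 0))
        = (\<Sum>i. ennreal (if list_decode i \<in> past t w then ?e w (list_decode i) else 0))"
        by (intro suminf_cong) (auto simp: dead_def weight_def)
      also have "\<dots> = ennreal (\<Sum>x\<in>past t w. ?e w x)"
        by (rule suminf_labels) (use elim in auto)
      finally show ?case by (rule sym)
    qed
    then show ?thesis unfolding past_mass_def by (subst (asm) nn_integral_suminf) auto
  qed
  have GS: "(\<integral>\<^sup>+ w. ennreal (\<Sum>x\<in>past t w. ?e w x * ?S w x) \<partial>\<Omega>)
      = (\<Sum>i. past_mass \<gamma> t (list_decode i)) * mom \<gamma>"
  proof -
    let ?f = "\<lambda>x w. ennreal (if dies x w \<le> t then weight \<gamma> x w else 0) * ennreal (?S w x)"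
    have each: "(\<integral>\<^sup>+ w. ?f x w \<partial>\<Omega>) = past_mass \<gamma> t x * mom \<gamma>" for x
      unfolding past_mass_def mom_def
      by (rule nn_integral_resample_mark[where x=x and
            k="\<lambda>w e. ennreal (if born x w + e \<le> t then weight \<gamma> x w else 0)"]) auto
    have "(\<integral>\<^sup>+ w. ennreal (\<Sum>x\<in>past t w. ?e w x * ?S w x) \<partial>\<Omega>)
        = (\<integral>\<^sup>+ w. (\<Sum>i. ?f (list_decode i) w) \<partial>\<Omega>)"
    proof (rule nn_integral_cong_AE, use AE_finite_past' in eventually_elim)
      case (elim w)
      have "(\<Sum>i. ?f (list_decode i) w)
        = (\<Sum>i. ennreal (if list_decode i \<in> past t w then ?e w (list_decode i) * ?S w (list_decode i) else 0))"
        by (intro suminf_cong) (auto simp: dead_def weight_def ennreal_mult)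
      also have "\<dots> = ennreal (\<Sum>x\<in>past t w. ?e w x * ?S w x)"
        by (rule suminf_labels) (use elim in auto)
      finally show ?case by (rule sym)
    qed
    also have "\<dots> = (\<Sum>i. \<integral>\<^sup>+ w. ?f (list_decode i) w \<partial>\<Omega>)" by (rule nn_integral_suminf) measurable
    also have "\<dots> = (\<Sum>i. past_mass \<gamma> t (list_decode i) * mom \<gamma>)" by (simp only: each)
    finally show ?thesis by (simp only: ennreal_suminf_multc)
  qed
  obtain g where g: "(\<Sum>i. past_mass \<gamma> t (list_decode i)) = ennreal g" "0 \<le> g"
    using suminf_past_mass_finite[OF m, of t] by (cases "\<Sum>i. past_mass \<gamma> t (list_decode i)") auto
  have live: "(\<integral>\<^sup>+ w. ennreal (live_sum \<gamma> t w) \<partial>\<Omega>) = ennreal (exp (\<phi> * t))"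
  proof -
    have "ennreal (live_sum \<gamma> t w) = ennreal (exp (\<phi> * t)) * ennreal (additive_process \<phi> \<gamma> t w)" for w
      by (simp add: additive_eq ennreal_mult[symmetric] mult.assoc[symmetric] exp_add[symmetric])
    then have "(\<integral>\<^sup>+ w. ennreal (live_sum \<gamma> t w) \<partial>\<Omega>)
        = ennreal (exp (\<phi> * t)) * (\<integral>\<^sup>+ w. ennreal (additive_process \<phi> \<gamma> t w) \<partial>\<Omega>)"
      by (simp add: nn_integral_cmult)
    also have "(\<integral>\<^sup>+ w. ennreal (additive_process \<phi> \<gamma> t w) \<partial>\<Omega>) = 1"
      using expectation_additive[OF m \<phi>(1) t] by (subst nn_integral_eq_integral) auto
    finally show ?thesis by simp
  qed
  have "(\<integral>\<^sup>+ w. ennreal (live_sum \<gamma> t w) + ennreal (\<Sum>x\<in>past t w. ?e w x) \<partial>\<Omega>)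
      = (\<integral>\<^sup>+ w. 1 + ennreal (\<Sum>x\<in>past t w. ?e w x * ?S w x) \<partial>\<Omega>)"
  proof (rule nn_integral_cong_AE, use balance in eventually_elim)
    case (elim w)
    have "0 \<le> (\<Sum>x\<in>past t w. ?e w x)" "0 \<le> (\<Sum>x\<in>past t w. ?e w x * ?S w x)"
      by (intro sum_nonneg; simp)+
    then show ?case using elim
      by (simp add: ennreal_plus[symmetric] ennreal_1[symmetric] del: ennreal_plus ennreal_1)
  qed
  then have "ennreal (exp (\<phi> * t)) + ennreal g = 1 + ennreal g * ennreal m"
    by (simp add: nn_integral_add G GS live g m(1) \<Omega>.emeasure_space_1)
  then have "ennreal (exp (\<phi> * t) + g) = ennreal (1 + g * m)"
    using g(2) m(2) by (simp add: ennreal_mult)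
  then have "exp (\<phi> * t) + g = 1 + g * m"
    using g(2) m(2) by (subst (asm) ennreal_inj) (auto intro: add_nonneg_nonneg)
  then have "g * \<phi> = exp (\<phi> * t) - 1" unfolding \<phi>(1) by (simp add: algebra_simps)
  then have "g = (exp (\<phi> * t) - 1) / \<phi>" using \<phi>(2) by (simp add: field_simps)
  then show ?thesis using g by simp
qed

lemma abs_powr_2: "\<bar>y::real\<bar> powr 2 = y\<^sup>2"
  by (cases "y = 0") (simp_all add: powr_numeral)

text \<open>By orthogonality, the variance is the second moment of \<open>C\<close> times the expected sum of
  \<open>exp (2 V(x))\<close> over the vertices that die between \<open>s\<close> and \<open>t\<close>.\<close>

lemma total_increment_moments:
  assumes C: "integrable R (\<lambda>r. fst (snd r))" "(\<integral> r. fst (snd r) \<partial>R) = 0"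
      "integrable R (\<lambda>r. (fst (snd r))\<^sup>2)" "(\<integral> r. (fst (snd r))\<^sup>2 \<partial>R) = \<sigma>2"
    and m: "mom 2 = ennreal m" "0 \<le> m" and \<phi>: "\<phi> = m - 1" "\<phi> \<noteq> 0" and st: "0 \<le> s" "s \<le> t"
  shows "integrable \<Omega> (\<lambda>w. (total_reward t w - total_reward s w)\<^sup>2)"
    "(\<integral> w. (total_reward t w - total_reward s w)\<^sup>2 \<partial>\<Omega>) = \<sigma>2 * ((exp (\<phi> * t) - exp (\<phi> * s)) / \<phi>)"
    "integrable \<Omega> (\<lambda>w. total_reward t w - total_reward s w)" "(\<integral> w. total_reward t w - total_reward s w \<partial>\<Omega>) = 0"
proof -
  have int: "integrable \<Omega> (\<lambda>w. (increment s t x w)\<^sup>2)" for x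
    using integrable_moment_increment[of 2 s t x] C(3) m by (simp only: abs_powr_2) simp
  let ?M = "\<lambda>x. \<integral>\<^sup>+ w. ennreal (if s < dies x w \<and> dies x w \<le> t then weight 2 x w else 0) \<partial>\<Omega>"
  have \<sigma>2: "0 \<le> \<sigma>2" unfolding C(4)[symmetric] by simp
  have M: "ennreal (\<integral> w. (increment s t x w)\<^sup>2 \<partial>\<Omega>) = ?M x * ennreal \<sigma>2" for x
  proof -
    have "ennreal (\<integral> w. (increment s t x w)\<^sup>2 \<partial>\<Omega>) = (\<integral>\<^sup>+ w. ennreal ((increment s t x w)\<^sup>2) \<partial>\<Omega>)"
      using int by (subst nn_integral_eq_integral) auto
    also have "\<dots> = ?M x * (\<integral>\<^sup>+ r. ennreal ((fst (snd r))\<^sup>2) \<partial>R)"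
      using moment_increment[of s t x 2] by (simp only: abs_powr_2)
    also have "(\<integral>\<^sup>+ r. ennreal ((fst (snd r))\<^sup>2) \<partial>R) = ennreal \<sigma>2"
      using C(3,4) by (subst nn_integral_eq_integral) auto
    finally show ?thesis .
  qed
  have split: "past_mass 2 t x = past_mass 2 s x + ?M x" for x
  proof -
    have "past_mass 2 t x = (\<integral>\<^sup>+ w. ennreal (if dies x w \<le> s then weight 2 x w else 0) +
        ennreal (if s < dies x w \<and> dies x w \<le> t then weight 2 x w else 0) \<partial>\<Omega>)"
      unfolding past_mass_def using st by (intro nn_integral_cong) auto
    also have "\<dots> = past_mass 2 s x + ?M x"
      unfolding past_mass_def by (rule nn_integral_add) measurable
    finally show ?thesis .
  qed
  define g where "g t = (exp (\<phi> * t) - 1) / \<phi>" for t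
  have g0: "0 \<le> g t" if "0 \<le> t" for t
    using \<phi>(2) that by (cases "0 < \<phi>") (auto simp: g_def divide_nonneg_nonneg divide_nonpos_neg mult_nonneg_nonneg mult_nonpos_nonneg)
  have sum_M: "(\<Sum>i. ?M (list_decode i)) = ennreal (g t - g s)"
  proof -
    have "ennreal (g t) = (\<Sum>i. past_mass 2 s (list_decode i) + ?M (list_decode i))"
      using suminf_past_mass[OF m \<phi>, of t] st by (simp add: split[symmetric] g_def)
    also have "\<dots> = ennreal (g s) + (\<Sum>i. ?M (list_decode i))"
      using suminf_past_mass[OF m \<phi>, of s] st by (subst suminf_add[symmetric]) (auto simp: g_def)
    finally have eq: "ennreal (g t) = ennreal (g s) + (\<Sum>i. ?M (list_decode i))" .
    then have "(\<Sum>i. ?M (list_decode i)) = ennreal (g t) - ennreal (g s)"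
      by simp
    then show ?thesis using g0[OF st(1)] by (simp add: ennreal_minus)
  qed
  have gst: "0 \<le> g t - g s"
  proof -
    have "g t - g s = (exp (\<phi> * t) - exp (\<phi> * s)) / \<phi>" by (simp add: g_def diff_divide_distrib)
    also have "0 \<le> \<dots>"
      using \<phi>(2) st by (cases "0 < \<phi>") (auto intro!: divide_nonneg_nonneg divide_nonpos_neg simp: mult_left_mono mult_left_mono_neg)
    finally show ?thesis .
  qed
  have "(\<lambda>i. \<integral> w. (increment s t (list_decode i) w)\<^sup>2 \<partial>\<Omega>) sums ((g t - g s) * \<sigma>2)"
  proof -
    have "(\<Sum>i. ennreal (\<integral> w. (increment s t (list_decode i) w)\<^sup>2 \<partial>\<Omega>)) = ennreal ((g t - g s) * \<sigma>2)"
      unfolding M ennreal_suminf_multc sum_M by (rule ennreal_mult[OF gst \<sigma>2, symmetric])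
    moreover have "summable (\<lambda>i. \<integral> w. (increment s t (list_decode i) w)\<^sup>2 \<partial>\<Omega>)"
      by (rule summable_suminf_not_top) (auto simp: calculation)
    ultimately have "ennreal (\<Sum>i. \<integral> w. (increment s t (list_decode i) w)\<^sup>2 \<partial>\<Omega>) = ennreal ((g t - g s) * \<sigma>2)"
      by (subst (asm) suminf_ennreal2) auto
    then have "(\<Sum>i. \<integral> w. (increment s t (list_decode i) w)\<^sup>2 \<partial>\<Omega>) = (g t - g s) * \<sigma>2"
      using gst \<sigma>2 \<open>summable _\<close> by (subst (asm) ennreal_inj) (auto intro!: suminf_nonneg)
    then show ?thesis using \<open>summable _\<close> by (simp add: sums_iff)
  qed
  then have sums: "(\<lambda>i. \<integral> w. (increment s t (list_decode i) w)\<^sup>2 \<partial>\<Omega>) sums (\<sigma>2 * ((exp (\<phi> * t) - exp (\<phi> * s)) / \<phi>))"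
    by (simp add: g_def diff_divide_distrib mult.commute)
  have "(\<lambda>w. total_reward t w - total_reward s w) \<in> borel_measurable \<Omega>" by measurable
  note L2 = vertex_series_L2[OF martingale_differences_increment[OF C(1,2)] this int sums AE_increment_limit[OF st(2)]]
  show "integrable \<Omega> (\<lambda>w. (total_reward t w - total_reward s w)\<^sup>2)"
    "(\<integral> w. (total_reward t w - total_reward s w)\<^sup>2 \<partial>\<Omega>) = \<sigma>2 * ((exp (\<phi> * t) - exp (\<phi> * s)) / \<phi>)"
    "integrable \<Omega> (\<lambda>w. total_reward t w - total_reward s w)" "(\<integral> w. total_reward t w - total_reward s w \<partial>\<Omega>) = 0"
    by (rule L2)+
qed

lemma AE_total_0: "AE w in \<Omega>. total_reward 0 w = 0"
  using AE_positive_lifetimes by eventually_elim (simp add: Ctot_def past_neg)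

end

section \<open>Expansions of characteristic functions\<close>

text \<open>Both functions have the same expansion of second order at 0, so their difference is at
  most \<open>\<epsilon> r\<^sup>2\<close> for small \<open>r\<close>. For other \<open>r\<close> it is at most 2, and \<open>\<bar>r\<bar>^p\<close> is bounded away from
  0.\<close>

lemma (in prob_space) characteristic_function_near_gaussian:
  fixes X :: "'a \<Rightarrow> real"
  assumes X: "integrable M X" "expectation X = 0" "integrable M (\<lambda>w. (X w)\<^sup>2)" "expectation (\<lambda>w. (X w)\<^sup>2) = v"
    and \<epsilon>: "0 < \<epsilon>" and p: "0 < p"
  shows "\<exists>K\<ge>0. \<forall>r. cmod ((\<integral> w. iexp (r * X w) \<partial>M) - exp (- (r\<^sup>2 * v / 2))) \<le> \<epsilon> * r\<^sup>2 + K * \<bar>r\<bar> powr p"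
proof -
  have [measurable]: "X \<in> borel_measurable M" using X by auto
  define \<psi> where "\<psi> r = (\<integral> w. iexp (r * X w) \<partial>M)" for r
  have v: "0 \<le> v" unfolding X(4)[symmetric] by simp
  have norm\<psi>: "cmod (\<psi> r) \<le> 1" for r
  proof -
    have "cmod (\<psi> r) \<le> (\<integral> w. cmod (iexp (r * X w)) \<partial>M)"
      unfolding \<psi>_def by (rule integral_norm_bound)
    then show ?thesis by (simp add: prob_space)
  qed
  have char: "char (distr M borel X) r = \<psi> r" for r
    unfolding char_def \<psi>_def by (subst integral_distr) auto
  define h where "h r = expectation (\<lambda>w. min (6 * (X w)\<^sup>2) (\<bar>r\<bar> * \<bar>X w\<bar> ^ 3))" for r
  have var: "variance X = v" using X by simp
  have app: "cmod (\<psi> r - (1 - r\<^sup>2 * v / 2)) \<le> r\<^sup>2 / 6 * h r" for r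
    using char_approx3'[OF _ X(1) X(3) X(2) var refl, of r] by (simp add: char h_def)
  have "(h \<longlongrightarrow> (\<integral> w. 0 \<partial>M)) (at 0)"
    unfolding tendsto_at_iff_sequentially comp_def h_def
  proof (intro allI impI)
    fix Y :: "nat \<Rightarrow> real" assume Y: "Y \<longlonglongrightarrow> 0"
    show "(\<lambda>n. expectation (\<lambda>w. min (6 * (X w)\<^sup>2) (\<bar>Y n\<bar> * \<bar>X w\<bar> ^ 3))) \<longlonglongrightarrow> (\<integral> w. 0 \<partial>M)"
    proof (rule integral_dominated_convergence)
      show "AE w in M. (\<lambda>n. min (6 * (X w)\<^sup>2) (\<bar>Y n\<bar> * \<bar>X w\<bar> ^ 3)) \<longlonglongrightarrow> 0"
      proof (rule AE_I2)
        fix w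
        have "(\<lambda>n. min (6 * (X w)\<^sup>2) (\<bar>Y n\<bar> * \<bar>X w\<bar> ^ 3)) \<longlonglongrightarrow> min (6 * (X w)\<^sup>2) (\<bar>0\<bar> * \<bar>X w\<bar> ^ 3)"
          by (intro tendsto_intros Y)
        then show "(\<lambda>n. min (6 * (X w)\<^sup>2) (\<bar>Y n\<bar> * \<bar>X w\<bar> ^ 3)) \<longlonglongrightarrow> 0" by simp
      qed
      show "integrable M (\<lambda>w. 6 * (X w)\<^sup>2)" using X by simp
    qed auto
  qed
  then have "(h \<longlongrightarrow> 0) (at 0)" by simp
  then have "((\<lambda>r. h r / 6 + r\<^sup>2 * v\<^sup>2 / 8) \<longlongrightarrow> 0 / 6 + 0\<^sup>2 * v\<^sup>2 / 8) (at 0)"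
    by (intro tendsto_intros) auto
  then have "\<forall>\<^sub>F r in at 0. h r / 6 + r\<^sup>2 * v\<^sup>2 / 8 < \<epsilon>"
    using \<epsilon> by (intro order_tendstoD) auto
  then obtain r0 where r0: "r0 > 0" "\<And>r. r \<noteq> 0 \<Longrightarrow> \<bar>r\<bar> < r0 \<Longrightarrow> h r / 6 + r\<^sup>2 * v\<^sup>2 / 8 < \<epsilon>"
    unfolding eventually_at by (auto simp: dist_real_def)
  define K where "K = 2 / r0 powr p"
  have K: "0 \<le> K" by (simp add: K_def)
  show ?thesis
  proof (intro exI[of _ K] conjI allI K)
    fix r
    show "cmod ((\<integral> w. iexp (r * X w) \<partial>M) - exp (- (r\<^sup>2 * v / 2))) \<le> \<epsilon> * r\<^sup>2 + K * \<bar>r\<bar> powr p"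
    proof (cases "\<bar>r\<bar> < r0")
      case True
      define y where "y = r\<^sup>2 * v / 2"
      have y: "0 \<le> y" using v by (simp add: y_def)
      have exp_y: "\<bar>exp (- y) - (1 - y)\<bar> \<le> y\<^sup>2 / 2"
      proof -
        have "1 - y \<le> exp (- y)" using exp_ge_add_one_self[of "- y"] by simp
        moreover have "exp (- y) \<le> 1 - y + y\<^sup>2 / 2"
        proof -
          have d: "((\<lambda>y. 1 - y + y\<^sup>2 / 2 - exp (- y)) has_real_derivative (- 1 + x + exp (- x))) (at x)" for x :: real
            by (auto intro!: derivative_eq_intros)
          have "1 - 0 + 0\<^sup>2 / 2 - exp (- 0) \<le> 1 - y + y\<^sup>2 / 2 - exp (- y)"
          proof (rule DERIV_nonneg_imp_nondecreasing[OF y])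
            fix x :: real
            show "\<exists>d. ((\<lambda>y. 1 - y + y\<^sup>2 / 2 - exp (- y)) has_real_derivative d) (at x) \<and> 0 \<le> d"
              using d[of x] exp_ge_add_one_self[of "- x"] by (intro exI[of _ "- 1 + x + exp (- x)"]) auto
          qed
          then show ?thesis by simp
        qed
        ultimately show ?thesis by auto
      qed
      have "cmod (\<psi> r - exp (- y)) \<le> cmod (\<psi> r - (1 - y)) + cmod (complex_of_real (1 - y) - exp (- y))"
        using norm_triangle_ineq[of "\<psi> r - (1 - y)" "complex_of_real (1 - y) - exp (- y)"] by simp
      also have "cmod (complex_of_real (1 - y) - exp (- y)) = \<bar>exp (- y) - (1 - y)\<bar>"
        by (metis norm_minus_commute norm_of_real of_real_diff)
      also have "cmod (\<psi> r - (1 - y)) + \<bar>exp (- y) - (1 - y)\<bar> \<le> r\<^sup>2 / 6 * h r + y\<^sup>2 / 2"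
        using app[of r] exp_y by (intro add_mono) (auto simp: y_def)
      also have "\<dots> = r\<^sup>2 * (h r / 6 + r\<^sup>2 * v\<^sup>2 / 8)"
        by (simp add: y_def power2_eq_square field_simps)
      also have "\<dots> \<le> r\<^sup>2 * \<epsilon>"
        using r0(2)[of r] True by (cases "r = 0") (auto intro: mult_left_mono)
      finally have "cmod (\<psi> r - exp (- y)) \<le> \<epsilon> * r\<^sup>2" by (simp add: mult.commute)
      moreover have "0 \<le> K * \<bar>r\<bar> powr p" using K by simp
      ultimately show ?thesis by (simp add: \<psi>_def y_def)
    next
      case False
      have "cmod (\<psi> r - exp (- (r\<^sup>2 * v / 2))) \<le> cmod (\<psi> r) + cmod (complex_of_real (exp (- (r\<^sup>2 * v / 2))))"
        by (rule norm_triangle_ineq4)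
      also have "\<dots> \<le> 1 + 1" using norm\<psi>[of r] v by (intro add_mono) auto
      also have "\<dots> \<le> K * \<bar>r\<bar> powr p"
      proof -
        have "r0 powr p \<le> \<bar>r\<bar> powr p" using False r0 p by (intro powr_mono2) auto
        then show ?thesis using r0 by (simp add: K_def field_simps)
      qed
      finally have "cmod (\<psi> r - exp (- (r\<^sup>2 * v / 2))) \<le> K * \<bar>r\<bar> powr p" .
      moreover have "0 \<le> \<epsilon> * r\<^sup>2" using \<epsilon> by simp
      ultimately show ?thesis by (simp add: \<psi>_def)
    qed
  qed
qed

section \<open>Comparison of the two renewal equations\<close>

lemma integral_memoryless:
  fixes f :: "real \<Rightarrow> complex"
  assumes [measurable]: "f \<in> borel_measurable borel" and s: "0 \<le> s"
  shows "(\<integral> e. (if s < e then f (e - s) else 0) \<partial>unit_exponential)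
    = exp (- s) *\<^sub>R (\<integral> e. f e \<partial>unit_exponential)"
proof -
  have "(\<integral> e. (if s < e then f (e - s) else 0) \<partial>unit_exponential)
      = (\<integral> e. exponential_density 1 e *\<^sub>R (if s < e then f (e - s) else 0) \<partial>lborel)"
    unfolding unit_exponential_def
    by (rule integral_density) (auto simp: exponential_density_nonneg)
  also have "\<dots> = (\<integral> e. exponential_density 1 (s + e) *\<^sub>R (if 0 < e then f e else 0) \<partial>lborel)"
    by (subst lborel_integral_real_affine[where c=1 and t=s]) (auto intro!: Bochner_Integration.integral_cong)
  also have "\<dots> = (\<integral> e. exp (- s) *\<^sub>R (exponential_density 1 e *\<^sub>R f e) \<partial>lborel)"
  proof (rule integral_cong_AE)
    show "AE e in lborel. exponential_density 1 (s + e) *\<^sub>R (if 0 < e then f e else 0)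
        = exp (- s) *\<^sub>R (exponential_density 1 e *\<^sub>R f e)"
      using AE_lborel_singleton[of "0::real"]
    proof eventually_elim
      case (elim e)
      have "exp (- (s + e)) = exp (- s) * exp (- e)" by (simp add: exp_add[symmetric])
      then show ?case using s elim by (auto simp: exponential_density_def)
    qed
  qed measurable
  also have "\<dots> = exp (- s) *\<^sub>R (\<integral> e. exponential_density 1 e *\<^sub>R f e \<partial>lborel)"
    by (rule integral_scaleR_right)
  also have "(\<integral> e. exponential_density 1 e *\<^sub>R f e \<partial>lborel) = (\<integral> e. f e \<partial>unit_exponential)"
    unfolding unit_exponential_def
    by (rule integral_density[symmetric]) (auto simp: exponential_density_nonneg)
  finally show ?thesis .
qed

text \<open>The integrand of the branching renewal equation: if the root dies by time \<open>s\<close>, its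
  children start anew with the remaining time, and their factors scale the argument.\<close>

definition branch_prod :: "(real \<Rightarrow> real \<Rightarrow> complex) \<Rightarrow> real \<Rightarrow> real \<Rightarrow> mark \<Rightarrow> complex" where
  "branch_prod f s \<theta> q =
     (if fst q \<le> s then \<Prod>k<fst (snd q). f (s - fst q) (\<theta> * snd (snd (snd q)) k) else 0)"

context nonexplosive_branching
begin

definition well_behaved :: "config \<Rightarrow> bool" where
  "well_behaved w \<longleftrightarrow> positive_lifetimes w \<and> (\<forall>t. finite (past t w))"

lemma AE_well_behaved_subtrees: "AE \<eta> in \<Omega>s. \<forall>k. well_behaved (\<eta> k)"
  by (rule AE_subtrees) (use AE_positive_lifetimes AE_finite_past' in eventually_elim, simp add: well_behaved_def)

text \<open>Its expectation is the characteristic function of the reward collected in the time window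
  \<open>(s, s + u]\<close>.\<close>

definition phase :: "real \<Rightarrow> real \<Rightarrow> real \<Rightarrow> config \<Rightarrow> complex" where
  "phase u s \<theta> w = iexp (\<theta> * (total_reward (s + u) w - total_reward s w))"

text \<open>The Gaussian counterpart of \<open>phase\<close>: the characteristic function of a centred normal
  variable whose variance is \<open>v\<close> times the sum of \<open>exp (2 V(x))\<close> over the vertices \<open>x\<close> alive at
  time \<open>s\<close>, given these vertices.\<close>

definition gauss :: "real \<Rightarrow> real \<Rightarrow> real \<Rightarrow> config \<Rightarrow> complex" where
  "gauss v s \<theta> w = complex_of_real (exp (- (\<theta>\<^sup>2 * v / 2 * live_sum 2 s w)))"

lemma measurable_live_sum [measurable]: "live_sum \<gamma> t \<in> borel_measurable \<Omega>"
  unfolding live_sum_def[abs_def] by (intro borel_measurable_sum_labels measurable_live) measurable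

lemma measurable_phase [measurable]: "phase u s \<theta> \<in> borel_measurable \<Omega>"
  unfolding phase_def[abs_def] by measurable

lemma measurable_gauss [measurable]: "gauss v s \<theta> \<in> borel_measurable \<Omega>"
  unfolding gauss_def[abs_def] by measurable

lemma norm_phase: "cmod (phase u s \<theta> w) = 1"
  unfolding phase_def by (rule norm_exp_i_times)

lemma norm_gauss: "0 \<le> v \<Longrightarrow> cmod (gauss v s \<theta> w) \<le> 1"
  by (simp add: gauss_def)

lemma integrable_phase [simp]: "integrable \<Omega> (phase u s \<theta>)"
  by (rule \<Omega>.integrable_const_bound[where B=1]) (auto simp: norm_phase)

lemma integrable_gauss: "0 \<le> v \<Longrightarrow> integrable \<Omega> (gauss v s \<theta>)"
  by (rule \<Omega>.integrable_const_bound[where B=1]) (auto simp: norm_gauss)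

text \<open>If the root outlives time \<open>s\<close>, the window sees a tree whose root has just been born and
  has the residual lifetime. Otherwise the rewards of the subtrees add up.\<close>

lemma phase_glue:
  assumes \<eta>: "\<And>k. well_behaved (\<eta> k)" and q: "\<And>k. 0 < snd (snd (snd q)) k" and u: "0 \<le> u"
  shows "phase u s \<theta> (glue (q, \<eta>)) = (if s < fst q then phase u 0 \<theta> (glue ((fst q - s, snd q), \<eta>))
    else (\<Prod>k<fst (snd q). phase u (s - fst q) (\<theta> * snd (snd (snd q)) k) (\<eta> k)))"
proof -
  note tg = total_glue[of \<eta>, OF \<eta>[unfolded well_behaved_def, THEN conjunct1] _ ]
  have fin: "finite (past t (\<eta> k))" for t k using \<eta> by (simp add: well_behaved_def)
  show ?thesis
  proof (cases "s < fst q")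
    case True
    have "total_reward (s + u) (glue (q, \<eta>)) = total_reward u (glue ((fst q - s, snd q), \<eta>))"
      using q fin by (auto simp: tg add.commute algebra_simps)
    moreover have "total_reward s (glue (q, \<eta>)) = 0" using q fin True by (simp add: tg)
    moreover have "total_reward 0 (glue ((fst q - s, snd q), \<eta>)) = 0" using q fin True by (simp add: tg)
    ultimately show ?thesis using True by (simp add: phase_def)
  next
    case False
    then have "total_reward (s + u) (glue (q, \<eta>)) - total_reward s (glue (q, \<eta>))
        = (\<Sum>k<fst (snd q). snd (snd (snd q)) k *
            (total_reward (s - fst q + u) (\<eta> k) - total_reward (s - fst q) (\<eta> k)))"
      using q fin u by (simp add: tg right_diff_distrib sum_subtractf algebra_simps)
    then have "\<i> * complex_of_real (\<theta> * (total_reward (s + u) (glue (q, \<eta>)) - total_reward s (glue (q, \<eta>))))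
        = (\<Sum>k<fst (snd q). \<i> * complex_of_real (\<theta> * snd (snd (snd q)) k *
            (total_reward (s - fst q + u) (\<eta> k) - total_reward (s - fst q) (\<eta> k))))"
      by (simp add: sum_distrib_left mult.assoc)
    then show ?thesis using False by (simp add: phase_def exp_sum)
  qed
qed

lemma gauss_glue:
  assumes \<eta>: "\<And>k. well_behaved (\<eta> k)" and q: "\<And>k. 0 < snd (snd (snd q)) k" and s: "0 \<le> s"
  shows "gauss v s \<theta> (glue (q, \<eta>)) = (if s < fst q then complex_of_real (exp (- (\<theta>\<^sup>2 * v / 2)))
    else (\<Prod>k<fst (snd q). gauss v (s - fst q) (\<theta> * snd (snd (snd q)) k) (\<eta> k)))"
proof -
  have lg: "live_sum 2 s (glue (q, \<eta>)) = (if s < fst q then 1 else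
    (\<Sum>k<fst (snd q). snd (snd (snd q)) k powr 2 * live_sum 2 (s - fst q) (\<eta> k)))"
    using \<eta> q s finite_live(1) by (intro live_sum_glue) (auto simp: well_behaved_def)
  show ?thesis
  proof (cases "s < fst q")
    case False
    have p2: "snd (snd (snd q)) k powr 2 = (snd (snd (snd q)) k)\<^sup>2" for k
      using q[of k] by (simp add: powr_numeral)
    have "- (\<theta>\<^sup>2 * v / 2 * live_sum 2 s (glue (q, \<eta>)))
        = (\<Sum>k<fst (snd q). - ((\<theta> * snd (snd (snd q)) k)\<^sup>2 * v / 2 * live_sum 2 (s - fst q) (\<eta> k)))"
      using False q by (simp add: lg sum_distrib_left sum_negf[symmetric] power_mult_distrib p2 algebra_simps)
    then have "exp (- (\<theta>\<^sup>2 * v / 2 * live_sum 2 s (glue (q, \<eta>))))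
        = (\<Prod>k<fst (snd q). exp (- ((\<theta> * snd (snd (snd q)) k)\<^sup>2 * v / 2 * live_sum 2 (s - fst q) (\<eta> k))))"
      by (simp only: exp_sum[OF finite_lessThan])
    then show ?thesis using False by (simp add: gauss_def)
  qed (simp add: gauss_def lg)
qed

lemma positive_factors: "q \<in> space Q \<Longrightarrow> 0 < snd (snd (snd q)) k"
  using mark_space_A_pos[of "snd q" k] by (simp add: space_Q mem_Times_iff)

lemma integral_glue_inner:
  fixes F :: "config \<Rightarrow> complex"
  assumes "integrable \<Omega> F"
  shows "integrable Q (\<lambda>q. \<integral> \<eta>. F (glue (q, \<eta>)) \<partial>\<Omega>s)"
  using Q\<Omega>s.integrable_fst'[OF integrable_glue[OF assms]] by simp

text \<open>On the event that the root outlives time \<open>s\<close>, of probability \<open>exp (- s)\<close>, its residual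
  lifetime is again exponential, so the window looks like one that starts at time 0.\<close>

lemma integral_phase_renewal:
  assumes u: "0 \<le> u" and s: "0 \<le> s"
  shows "integrable Q (branch_prod (\<lambda>s \<theta>. \<integral> w. phase u s \<theta> w \<partial>\<Omega>) s \<theta>)"
    and "(\<integral> w. phase u s \<theta> w \<partial>\<Omega>) = exp (- s) *\<^sub>R (\<integral> w. phase u 0 \<theta> w \<partial>\<Omega>) + (\<integral> q. branch_prod (\<lambda>s \<theta>. \<integral> w. phase u s \<theta> w \<partial>\<Omega>) s \<theta> q \<partial>Q)"
proof -
  let ?P = "branch_prod (\<lambda>s \<theta>. \<integral> w. phase u s \<theta> w \<partial>\<Omega>) s \<theta>"
  define I where "I q = (\<integral> \<eta>. phase u s \<theta> (glue (q, \<eta>)) \<partial>\<Omega>s)" for q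
  define J where "J q = (\<integral> \<eta>. phase u 0 \<theta> (glue (q, \<eta>)) \<partial>\<Omega>s)" for q
  have intI: "integrable Q I" and intJ: "integrable Q J"
    unfolding I_def[abs_def] J_def[abs_def] by (intro integral_glue_inner; simp)+
  have I: "I q = (if s < fst q then J (fst q - s, snd q) else 0) + ?P q" if q: "q \<in> space Q" for q
  proof (cases "s < fst q")
    case True
    have "AE \<eta> in \<Omega>s. phase u s \<theta> (glue (q, \<eta>)) = phase u 0 \<theta> (glue ((fst q - s, snd q), \<eta>))"
      using AE_well_behaved_subtrees
      by eventually_elim (use True positive_factors[OF q] u in \<open>simp add: phase_glue[of _ q u s]\<close>)
    moreover have "(fst q - s, snd q) \<in> space Q" using q by (auto simp: space_Q mem_Times_iff)
    ultimately have "I q = J (fst q - s, snd q)"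
      unfolding I_def J_def using q
      by (intro integral_cong_AE measurable_compose[OF _ measurable_phase] measurable_compose[OF measurable_Pair1' measurable_glue]) auto
    then show ?thesis using True by (simp add: branch_prod_def)
  next
    case False
    have "AE \<eta> in \<Omega>s. phase u s \<theta> (glue (q, \<eta>))
        = (\<Prod>k<fst (snd q). phase u (s - fst q) (\<theta> * snd (snd (snd q)) k) (\<eta> k))"
      using AE_well_behaved_subtrees
      by eventually_elim (use False positive_factors[OF q] u in \<open>simp add: phase_glue[of _ q u s]\<close>)
    then have "I q = (\<integral> \<eta>. (\<Prod>k<fst (snd q). phase u (s - fst q) (\<theta> * snd (snd (snd q)) k) (\<eta> k)) \<partial>\<Omega>s)"
      unfolding I_def using q
      by (intro integral_cong_AE measurable_compose[OF _ measurable_phase] measurable_compose[OF measurable_Pair1' measurable_glue]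
          borel_measurable_prod measurable_compose[OF measurable_subtree measurable_phase]) auto
    also have "\<dots> = (\<Prod>k<fst (snd q). \<integral> w. phase u (s - fst q) (\<theta> * snd (snd (snd q)) k) w \<partial>\<Omega>)"
      by (rule integral_subtrees) simp
    finally show ?thesis using False by (simp add: branch_prod_def)
  qed
  have Jm [measurable]: "J \<in> borel_measurable (borel \<Otimes>\<^sub>M mark_space)"
    using intJ measurable_cong_sets[OF sets_Q refl] by auto
  have J1: "cmod (J q) \<le> 1" for q
  proof -
    have "cmod (J q) \<le> (\<integral> \<eta>. cmod (phase u 0 \<theta> (glue (q, \<eta>))) \<partial>\<Omega>s)"
      unfolding J_def by (rule integral_norm_bound)
    then show ?thesis by (simp add: norm_phase \<Omega>s.prob_space)
  qed
  define K where "K q = (if s < fst q then J (fst q - s, snd q) else 0)" for q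
  have Km [measurable]: "K \<in> borel_measurable (borel \<Otimes>\<^sub>M mark_space)" unfolding K_def[abs_def] by measurable
  have intK: "integrable Q K"
    by (rule Q.integrable_const_bound[where B=1]) (auto simp: K_def J1)
  have PIK: "?P q = I q - K q" if "q \<in> space Q" for q using I[OF that] by (simp add: K_def)
  show intP: "integrable Q ?P"
    using Bochner_Integration.integrable_diff[OF intI intK] by (subst Bochner_Integration.integrable_cong[OF refl PIK]) auto
  have K: "(\<integral> q. K q \<partial>Q) = exp (- s) *\<^sub>R (\<integral> q. J q \<partial>Q)"
  proof -
    have "(\<integral> q. K q \<partial>Q) = (\<integral> r. \<integral> e. K (e, r) \<partial>unit_exponential \<partial>R)"
      using intK unfolding Q_def by (subst exR.integral_snd) simp_all
    also have "\<dots> = (\<integral> r. exp (- s) *\<^sub>R (\<integral> e. J (e, r) \<partial>unit_exponential) \<partial>R)"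
    proof (intro Bochner_Integration.integral_cong refl)
      fix r assume r: "r \<in> space R"
      have "(\<lambda>e. J (e, r)) \<in> borel_measurable borel"
        using r by (intro measurable_compose[OF measurable_Pair2' Jm]) (simp add: space_R)
      then show "(\<integral> e. K (e, r) \<partial>unit_exponential) = exp (- s) *\<^sub>R (\<integral> e. J (e, r) \<partial>unit_exponential)"
        unfolding K_def fst_conv snd_conv by (rule integral_memoryless[OF _ s])
    qed
    also have "\<dots> = exp (- s) *\<^sub>R (\<integral> r. \<integral> e. J (e, r) \<partial>unit_exponential \<partial>R)" by simp
    also have "(\<integral> r. \<integral> e. J (e, r) \<partial>unit_exponential \<partial>R) = (\<integral> q. J q \<partial>Q)"
      using intJ unfolding Q_def by (subst exR.integral_snd) simp_all
    finally show ?thesis .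
  qed
  have "(\<integral> w. phase u s \<theta> w \<partial>\<Omega>) = (\<integral> q. I q \<partial>Q)"
    unfolding I_def by (rule integral_glue) simp
  also have "\<dots> = (\<integral> q. K q + ?P q \<partial>Q)"
    by (intro Bochner_Integration.integral_cong) (auto simp: I K_def)
  also have "\<dots> = exp (- s) *\<^sub>R (\<integral> q. J q \<partial>Q) + (\<integral> q. ?P q \<partial>Q)"
    using intK intP K by simp
  also have "(\<integral> q. J q \<partial>Q) = (\<integral> w. phase u 0 \<theta> w \<partial>\<Omega>)"
    unfolding J_def by (rule integral_glue[symmetric]) simp
  finally show "(\<integral> w. phase u s \<theta> w \<partial>\<Omega>) = exp (- s) *\<^sub>R (\<integral> w. phase u 0 \<theta> w \<partial>\<Omega>) + (\<integral> q. ?P q \<partial>Q)" .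
qed

lemma integral_gauss_renewal:
  assumes v: "0 \<le> v" and s: "0 \<le> s"
  shows "integrable Q (branch_prod (\<lambda>s \<theta>. \<integral> w. gauss v s \<theta> w \<partial>\<Omega>) s \<theta>)"
    and "(\<integral> w. gauss v s \<theta> w \<partial>\<Omega>) = exp (- s) *\<^sub>R complex_of_real (exp (- (\<theta>\<^sup>2 * v / 2))) + (\<integral> q. branch_prod (\<lambda>s \<theta>. \<integral> w. gauss v s \<theta> w \<partial>\<Omega>) s \<theta> q \<partial>Q)"
proof -
  let ?P = "branch_prod (\<lambda>s \<theta>. \<integral> w. gauss v s \<theta> w \<partial>\<Omega>) s \<theta>"
  define c where "c = complex_of_real (exp (- (\<theta>\<^sup>2 * v / 2)))"
  define I where "I q = (\<integral> \<eta>. gauss v s \<theta> (glue (q, \<eta>)) \<partial>\<Omega>s)" for q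
  have intI: "integrable Q I"
    unfolding I_def[abs_def] by (intro integral_glue_inner integrable_gauss v)
  define K where "K q = (if s < fst q then c else 0)" for q :: mark
  have I: "I q = K q + ?P q" if q: "q \<in> space Q" for q
  proof (cases "s < fst q")
    case True
    have "AE \<eta> in \<Omega>s. gauss v s \<theta> (glue (q, \<eta>)) = c"
      using AE_well_behaved_subtrees
      by eventually_elim (use True positive_factors[OF q] s in \<open>simp add: gauss_glue c_def\<close>)
    then have "I q = (\<integral> \<eta>. c \<partial>\<Omega>s)"
      unfolding I_def using q
      by (intro integral_cong_AE measurable_compose[OF _ measurable_gauss] measurable_compose[OF measurable_Pair1' measurable_glue]) auto
    then show ?thesis using True by (simp add: branch_prod_def K_def \<Omega>s.prob_space)
  next
    case False
    have "AE \<eta> in \<Omega>s. gauss v s \<theta> (glue (q, \<eta>))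
        = (\<Prod>k<fst (snd q). gauss v (s - fst q) (\<theta> * snd (snd (snd q)) k) (\<eta> k))"
      using AE_well_behaved_subtrees
      by eventually_elim (use False positive_factors[OF q] s in \<open>simp add: gauss_glue\<close>)
    then have "I q = (\<integral> \<eta>. (\<Prod>k<fst (snd q). gauss v (s - fst q) (\<theta> * snd (snd (snd q)) k) (\<eta> k)) \<partial>\<Omega>s)"
      unfolding I_def using q
      by (intro integral_cong_AE measurable_compose[OF _ measurable_gauss] measurable_compose[OF measurable_Pair1' measurable_glue]
          borel_measurable_prod measurable_compose[OF measurable_subtree measurable_gauss]) auto
    also have "\<dots> = (\<Prod>k<fst (snd q). \<integral> w. gauss v (s - fst q) (\<theta> * snd (snd (snd q)) k) w \<partial>\<Omega>)"
      by (rule integral_subtrees) (rule integrable_gauss[OF v])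
    finally show ?thesis using False by (simp add: branch_prod_def K_def)
  qed
  have Km [measurable]: "K \<in> borel_measurable (borel \<Otimes>\<^sub>M mark_space)" unfolding K_def[abs_def] by measurable
  have intK: "integrable Q K"
    by (rule Q.integrable_const_bound[where B="cmod c"]) (auto simp: K_def)
  have PIK: "?P q = I q - K q" if "q \<in> space Q" for q using I[OF that] by simp
  show intP: "integrable Q ?P"
    using Bochner_Integration.integrable_diff[OF intI intK] by (subst Bochner_Integration.integrable_cong[OF refl PIK]) auto
  have K: "(\<integral> q. K q \<partial>Q) = exp (- s) *\<^sub>R c"
  proof -
    have "(\<integral> q. K q \<partial>Q) = (\<integral> r. \<integral> e. K (e, r) \<partial>unit_exponential \<partial>R)"
      using intK unfolding Q_def by (subst exR.integral_snd) simp_all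
    also have "\<dots> = (\<integral> r. exp (- s) *\<^sub>R (\<integral> e. c \<partial>unit_exponential) \<partial>R)"
      using integral_memoryless[OF _ s, of "\<lambda>e. c"] by (simp add: K_def)
    finally show ?thesis using ex.prob_space R.prob_space by simp
  qed
  have "(\<integral> w. gauss v s \<theta> w \<partial>\<Omega>) = (\<integral> q. I q \<partial>Q)"
    unfolding I_def by (rule integral_glue) (rule integrable_gauss[OF v])
  also have "\<dots> = (\<integral> q. K q + ?P q \<partial>Q)"
    by (intro Bochner_Integration.integral_cong) (auto simp: I)
  also have "\<dots> = exp (- s) *\<^sub>R c + (\<integral> q. ?P q \<partial>Q)"
    using intK intP K by simp
  finally show "(\<integral> w. gauss v s \<theta> w \<partial>\<Omega>) = exp (- s) *\<^sub>R complex_of_real (exp (- (\<theta>\<^sup>2 * v / 2))) + (\<integral> q. ?P q \<partial>Q)"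
    by (simp add: c_def)
qed

text \<open>The functions \<open>\<bar>\<theta>\<bar> powr \<gamma> * exp (l * s)\<close> are reproduced by averaging over the children of
  the root, up to the factor \<open>m(\<gamma>) / (1 + l)\<close> and an initial term. The factor is at most 1 iff
  \<open>l \<ge> \<Phi>(\<gamma>)\<close>.\<close>

lemma integral_branching_majorant:
  assumes m: "mom \<gamma> = ennreal m" "0 \<le> m" and l: "-1 < l" and s: "0 \<le> s"
  shows "(\<integral>\<^sup>+ q. ennreal (if fst q \<le> s then exp (l * (s - fst q)) * power_sum \<gamma> (snd q) else 0) \<partial>Q)
    = ennreal (m / (1 + l) * (exp (l * s) - exp (- s)))"
proof -
  have "(\<integral>\<^sup>+ q. ennreal (if fst q \<le> s then exp (l * (s - fst q)) * power_sum \<gamma> (snd q) else 0) \<partial>Q)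
      = (\<integral>\<^sup>+ q. ennreal (if fst q \<le> s then exp (l * (s - fst q)) else 0) * ennreal (power_sum \<gamma> (snd q)) \<partial>Q)"
    by (intro nn_integral_cong) (auto simp: ennreal_mult)
  also have "\<dots> = (\<integral>\<^sup>+ e. ennreal (if e \<le> s then exp (l * (s - e)) else 0) \<partial>unit_exponential) * mom \<gamma>"
    unfolding mom_def by (rule nn_integral_Q_times) measurable
  also have "(\<integral>\<^sup>+ e. ennreal (if e \<le> s then exp (l * (s - e)) else 0) \<partial>unit_exponential)
      = (\<integral>\<^sup>+ e. ennreal (exp (l * s) / (1 + l)) *
          (if e \<le> s then ennreal ((1 + l) * exp (- ((1 + l) - 1) * e)) else 0) \<partial>unit_exponential)"
  proof (rule nn_integral_cong)
    fix e :: real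
    have "exp (l * (s - e)) = exp (l * s) * exp (- l * e)"
      by (simp add: exp_add[symmetric] right_diff_distrib)
    then have "exp (l * (s - e)) = exp (l * s) / (1 + l) * ((1 + l) * exp (- ((1 + l) - 1) * e))"
      using l by simp
    then show "ennreal (if e \<le> s then exp (l * (s - e)) else 0) = ennreal (exp (l * s) / (1 + l)) *
          (if e \<le> s then ennreal ((1 + l) * exp (- ((1 + l) - 1) * e)) else 0)"
      using l by (simp only: ennreal_mult[symmetric] split: if_split) (simp add: ennreal_mult[symmetric])
  qed
  also have "\<dots> = ennreal (exp (l * s) / (1 + l)) * ennreal (1 - exp (- (1 + l) * s))"
    using l s by (subst nn_integral_cmult) (auto simp: nn_integral_exp_upto[of "1 + l" s, simplified])
  also have "\<dots> * mom \<gamma> = ennreal (exp (l * s) / (1 + l) * (1 - exp (- (1 + l) * s)) * m)"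
  proof -
    have "0 \<le> exp (l * s) / (1 + l)" "0 \<le> 1 - exp (- (1 + l) * s)"
      using l s by (auto simp: mult_nonpos_nonneg)
    then show ?thesis
      unfolding m(1) using m(2) by (simp only: ennreal_mult[symmetric] mult_nonneg_nonneg)
  qed
  also have "exp (l * s) / (1 + l) * (1 - exp (- (1 + l) * s)) * m = m / (1 + l) * (exp (l * s) - exp (- s))"
  proof -
    have "exp (l * s) * exp (- (1 + l) * s) = exp (- s)" by (simp add: exp_add[symmetric] algebra_simps)
    then show ?thesis by (simp add: right_diff_distrib diff_divide_distrib algebra_simps)
  qed
  finally show ?thesis .
qed

end

context nonexplosive_branching
begin

definition majorant :: "real \<Rightarrow> real \<Rightarrow> real \<Rightarrow> mark \<Rightarrow> real" where
  "majorant \<gamma> l s q = (if fst q \<le> s then exp (l * (s - fst q)) * power_sum \<gamma> (snd q) else 0)"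

lemma integral_majorant:
  assumes m: "mom \<gamma> = ennreal m" "0 \<le> m" and l: "-1 < l" and s: "0 \<le> s"
  shows "integrable Q (majorant \<gamma> l s)"
    "(\<integral> q. majorant \<gamma> l s q \<partial>Q) = m / (1 + l) * (exp (l * s) - exp (- s))"
proof -
  have nonneg: "0 \<le> majorant \<gamma> l s q" for q by (simp add: majorant_def)
  have le: "- s \<le> l * s" using mult_right_mono[of "-1" l s] l s by simp
  have meas [measurable]: "majorant \<gamma> l s \<in> borel_measurable Q"
    unfolding majorant_def[abs_def] by measurable
  have nn: "(\<integral>\<^sup>+ q. ennreal (majorant \<gamma> l s q) \<partial>Q) = ennreal (m / (1 + l) * (exp (l * s) - exp (- s)))"
    using integral_branching_majorant[OF m l s] by (simp add: majorant_def)
  show "integrable Q (majorant \<gamma> l s)"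
    using nn nonneg by (intro integrableI_bounded) auto
  show "(\<integral> q. majorant \<gamma> l s q \<partial>Q) = m / (1 + l) * (exp (l * s) - exp (- s))"
    using nn nonneg m l le by (subst integral_eq_nn_integral) auto
qed

definition phase_gauss_gap :: "real \<Rightarrow> real \<Rightarrow> real \<Rightarrow> real \<Rightarrow> real" where
  "phase_gauss_gap u v s \<theta> = cmod ((\<integral> w. phase u s \<theta> w \<partial>\<Omega>) - (\<integral> w. gauss v s \<theta> w \<partial>\<Omega>))"

lemma norm_integral_phase: "cmod (\<integral> w. phase u s \<theta> w \<partial>\<Omega>) \<le> 1"
  using integral_norm_bound[of \<Omega> "phase u s \<theta>"] by (simp add: norm_phase \<Omega>.prob_space)

lemma norm_integral_gauss: "0 \<le> v \<Longrightarrow> cmod (\<integral> w. gauss v s \<theta> w \<partial>\<Omega>) \<le> 1"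
proof -
  assume v: "0 \<le> v"
  have "cmod (\<integral> w. gauss v s \<theta> w \<partial>\<Omega>) \<le> (\<integral> w. cmod (gauss v s \<theta> w) \<partial>\<Omega>)"
    by (rule integral_norm_bound)
  also have "\<dots> \<le> (\<integral> w. 1 \<partial>\<Omega>)"
    using integrable_gauss[OF v] norm_gauss[OF v] by (intro integral_mono) auto
  finally show ?thesis by (simp add: \<Omega>.prob_space)
qed

text \<open>The two renewal equations have the same form, and the products over the children have
  factors in the unit disc, so their difference is at most the sum of the differences of the
  factors.\<close>

lemma gap_recursion:
  assumes uvs: "0 \<le> u" "0 \<le> v" "0 \<le> s" and b: "integrable Q b"
    and le: "\<And>q. q \<in> space Q \<Longrightarrow> (if fst q \<le> s then
       \<Sum>k<fst (snd q). phase_gauss_gap u v (s - fst q) (\<theta> * snd (snd (snd q)) k) else 0) \<le> b q"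
  shows "phase_gauss_gap u v s \<theta> \<le> exp (- s) * cmod ((\<integral> w. phase u 0 \<theta> w \<partial>\<Omega>) - exp (- (\<theta>\<^sup>2 * v / 2)))
    + (\<integral> q. b q \<partial>Q)"
proof -
  let ?f = "\<lambda>s \<theta>. \<integral> w. phase u s \<theta> w \<partial>\<Omega>" and ?g = "\<lambda>s \<theta>. \<integral> w. gauss v s \<theta> w \<partial>\<Omega>"
  let ?P = "branch_prod ?f s \<theta>" and ?G = "branch_prod ?g s \<theta>"
  have intP: "integrable Q ?P" by (rule integral_phase_renewal(1)[OF uvs(1,3)])
  have intG: "integrable Q ?G" by (rule integral_gauss_renewal(1)[OF uvs(2,3)])
  have diff: "cmod (?P q - ?G q) \<le> b q" if q: "q \<in> space Q" for q
  proof (cases "fst q \<le> s")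
    case True
    have "cmod (?P q - ?G q) \<le> (\<Sum>k<fst (snd q). cmod (?f (s - fst q) (\<theta> * snd (snd (snd q)) k) -
        ?g (s - fst q) (\<theta> * snd (snd (snd q)) k)))"
      using True by (simp add: branch_prod_def) (intro norm_prod_diff norm_integral_phase norm_integral_gauss uvs)
    then show ?thesis using le[OF q] True by (simp add: phase_gauss_gap_def)
  next
    case False
    then show ?thesis using le[OF q] by (simp add: branch_prod_def)
  qed
  have "?f s \<theta> - ?g s \<theta> = exp (- s) *\<^sub>R (?f 0 \<theta> - exp (- (\<theta>\<^sup>2 * v / 2))) + (\<integral> q. ?P q - ?G q \<partial>Q)"
    using integral_phase_renewal(2)[OF uvs(1,3), of \<theta>] integral_gauss_renewal(2)[OF uvs(2,3), of \<theta>] intP intG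
    by (simp add: scaleR_diff_right)
  then have "phase_gauss_gap u v s \<theta> \<le> cmod (exp (- s) *\<^sub>R (?f 0 \<theta> - exp (- (\<theta>\<^sup>2 * v / 2)))) + cmod (\<integral> q. ?P q - ?G q \<partial>Q)"
    unfolding phase_gauss_gap_def by (simp only: norm_triangle_ineq)
  moreover have "cmod (\<integral> q. ?P q - ?G q \<partial>Q) \<le> (\<integral> q. b q \<partial>Q)"
  proof -
    have "cmod (\<integral> q. ?P q - ?G q \<partial>Q) \<le> (\<integral> q. cmod (?P q - ?G q) \<partial>Q)" by (rule integral_norm_bound)
    also have "\<dots> \<le> (\<integral> q. b q \<partial>Q)"
      using intP intG diff b by (intro integral_mono) auto
    finally show ?thesis .
  qed
  ultimately show ?thesis by simp
qed

lemma sum_majorant: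
  assumes q: "q \<in> space Q" and "fst q \<le> s"
  shows "(\<Sum>k<fst (snd q). \<bar>\<theta> * snd (snd (snd q)) k\<bar> powr \<gamma> * exp (l * (s - fst q)))
    = \<bar>\<theta>\<bar> powr \<gamma> * majorant \<gamma> l s q"
proof -
  have "\<bar>\<theta> * snd (snd (snd q)) k\<bar> powr \<gamma> = \<bar>\<theta>\<bar> powr \<gamma> * snd (snd (snd q)) k powr \<gamma>" for k
    using positive_factors[OF q, of k] by (simp add: abs_mult powr_mult)
  then show ?thesis
    using assms(2) by (simp add: majorant_def power_sum_def sum_distrib_left sum_distrib_right mult_ac)
qed

lemma expectation_live_sum:
  assumes m: "mom \<gamma> = ennreal m" "0 \<le> m" and \<phi>: "\<phi> = m - 1" and t: "0 \<le> t"
  shows "integrable \<Omega> (live_sum \<gamma> t)" "(\<integral> w. live_sum \<gamma> t w \<partial>\<Omega>) = exp (\<phi> * t)"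
proof -
  have eq: "live_sum \<gamma> t = (\<lambda>w. exp (\<phi> * t) * additive_process \<phi> \<gamma> t w)"
    by (auto simp: additive_eq mult.assoc[symmetric] exp_add[symmetric])
  show "integrable \<Omega> (live_sum \<gamma> t)"
    unfolding eq by (intro integrable_mult_right expectation_additive[OF m \<phi> t])
  show "(\<integral> w. live_sum \<gamma> t w \<partial>\<Omega>) = exp (\<phi> * t)"
    unfolding eq using expectation_additive[OF m \<phi> t] by simp
qed

lemma norm_expectation_iexp_minus_1:
  assumes X: "integrable \<Omega> X" "(\<integral> w. X w \<partial>\<Omega>) = 0" "integrable \<Omega> (\<lambda>w. (X w)\<^sup>2)"
  shows "cmod ((\<integral> w. iexp (\<theta> * X w) \<partial>\<Omega>) - 1) \<le> \<theta>\<^sup>2 / 2 * (\<integral> w. (X w)\<^sup>2 \<partial>\<Omega>)"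
proof -
  have [measurable]: "X \<in> borel_measurable \<Omega>" using X by auto
  have int: "integrable \<Omega> (\<lambda>w. iexp (\<theta> * X w))"
    by (rule \<Omega>.integrable_const_bound[where B=1]) (auto simp: norm_exp_i_times)
  have int2: "integrable \<Omega> (\<lambda>w. \<i> * complex_of_real (\<theta> * X w))"
    using X(1) by (intro integrable_mult_right integrable_of_real) simp
  have "(\<integral> w. \<i> * complex_of_real (\<theta> * X w) \<partial>\<Omega>) = \<i> * complex_of_real (\<integral> w. \<theta> * X w \<partial>\<Omega>)"
    by (subst integral_mult_right_zero, subst integral_complex_of_real) (rule refl)
  then have z: "(\<integral> w. \<i> * complex_of_real (\<theta> * X w) \<partial>\<Omega>) = 0" using X(2) by simp
  have "(\<integral> w. iexp (\<theta> * X w) \<partial>\<Omega>) - 1 = (\<integral> w. iexp (\<theta> * X w) - 1 - \<i> * complex_of_real (\<theta> * X w) \<partial>\<Omega>)"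
    using int int2 z by (simp add: \<Omega>.prob_space)
  also have "cmod \<dots> \<le> (\<integral> w. cmod (iexp (\<theta> * X w) - 1 - \<i> * complex_of_real (\<theta> * X w)) \<partial>\<Omega>)"
    by (rule integral_norm_bound)
  also have "\<dots> \<le> (\<integral> w. \<theta>\<^sup>2 / 2 * (X w)\<^sup>2 \<partial>\<Omega>)"
  proof (rule integral_mono)
    show "integrable \<Omega> (\<lambda>w. cmod (iexp (\<theta> * X w) - 1 - \<i> * complex_of_real (\<theta> * X w)))"
      using int int2 by auto
    show "integrable \<Omega> (\<lambda>w. \<theta>\<^sup>2 / 2 * (X w)\<^sup>2)" using X(3) by simp
    fix w
    show "cmod (iexp (\<theta> * X w) - 1 - \<i> * complex_of_real (\<theta> * X w)) \<le> \<theta>\<^sup>2 / 2 * (X w)\<^sup>2"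
      using iexp_approx1[of "\<theta> * X w" 1] by (simp add: power2_eq_square abs_mult diff_diff_eq mult_ac)
  qed
  finally show ?thesis by simp
qed

context
  fixes \<sigma>2 m \<phi> :: real
  assumes C: "integrable R (\<lambda>r. fst (snd r))" "(\<integral> r. fst (snd r) \<partial>R) = 0"
      "integrable R (\<lambda>r. (fst (snd r))\<^sup>2)" "(\<integral> r. (fst (snd r))\<^sup>2 \<partial>R) = \<sigma>2"
    and m: "mom 2 = ennreal m" "0 \<le> m" and \<phi>: "\<phi> = m - 1" "0 < \<phi>"
begin

lemma \<sigma>2_nonneg: "0 \<le> \<sigma>2"
  unfolding C(4)[symmetric] by simp

text \<open>Both functions differ from 1 by at most a multiple of \<open>\<theta>^2 exp (\<Phi>(2) s)\<close>. The growth rate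
  is relaxed from \<open>\<Phi>(2) = m - 1\<close> to \<open>m\<close>, since iterating the renewal equation contracts a bound
  only if its rate exceeds \<open>\<Phi>(2)\<close>.\<close>

lemma gap_crude_bound:
  assumes u: "0 \<le> u" and v: "0 \<le> v"
  shows "\<exists>\<rho>\<ge>0. \<forall>s\<ge>0. \<forall>\<theta>. phase_gauss_gap u v s \<theta> \<le> \<rho> * (\<theta>\<^sup>2 * exp (m * s))"
proof (intro exI[of _ "\<sigma>2 * exp (\<phi> * u) / \<phi> / 2 + v / 2"] conjI allI impI)
  show "0 \<le> \<sigma>2 * exp (\<phi> * u) / \<phi> / 2 + v / 2" using \<sigma>2_nonneg v \<phi> by simp
  fix s \<theta> :: real assume s: "0 \<le> s"
  have \<phi>0: "\<phi> \<noteq> 0" using \<phi> by simp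
  note X = total_increment_moments[OF C m \<phi>(1) \<phi>0 s, of "s + u"]
  have su: "s \<le> s + u" using u by simp
  have exp_le: "exp (\<phi> * s) \<le> exp (m * s)" using s by (simp add: \<phi>(1) mult_right_mono)
  have "cmod ((\<integral> w. phase u s \<theta> w \<partial>\<Omega>) - 1) \<le> \<theta>\<^sup>2 / 2 * (\<sigma>2 * ((exp (\<phi> * (s + u)) - exp (\<phi> * s)) / \<phi>))"
    using norm_expectation_iexp_minus_1[OF X(3)[OF su] X(4)[OF su] X(1)[OF su], of \<theta>] X(2)[OF su]
    by (simp add: phase_def)
  also have "\<dots> \<le> \<theta>\<^sup>2 / 2 * (\<sigma>2 * (exp (\<phi> * u) * exp (m * s) / \<phi>))"
  proof -
    have "exp (\<phi> * (s + u)) - exp (\<phi> * s) \<le> exp (\<phi> * u) * exp (\<phi> * s)"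
      by (simp add: exp_add[symmetric] algebra_simps)
    also have "\<dots> \<le> exp (\<phi> * u) * exp (m * s)" using exp_le by simp
    finally show ?thesis using \<phi>(2) \<sigma>2_nonneg by (intro mult_left_mono divide_right_mono) auto
  qed
  finally have 1: "cmod ((\<integral> w. phase u s \<theta> w \<partial>\<Omega>) - 1) \<le> \<theta>\<^sup>2 / 2 * (\<sigma>2 * (exp (\<phi> * u) * exp (m * s) / \<phi>))" .
  note L = expectation_live_sum[OF m \<phi>(1) s]
  have "(\<integral> w. gauss v s \<theta> w \<partial>\<Omega>) - 1 = (\<integral> w. gauss v s \<theta> w - 1 \<partial>\<Omega>)"
    using integrable_gauss[OF v] by (simp add: \<Omega>.prob_space)
  also have "cmod \<dots> \<le> (\<integral> w. cmod (gauss v s \<theta> w - 1) \<partial>\<Omega>)" by (rule integral_norm_bound)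
  also have "\<dots> \<le> (\<integral> w. \<theta>\<^sup>2 * v / 2 * live_sum 2 s w \<partial>\<Omega>)"
  proof (rule integral_mono)
    show "integrable \<Omega> (\<lambda>w. cmod (gauss v s \<theta> w - 1))" using integrable_gauss[OF v] by auto
    show "integrable \<Omega> (\<lambda>w. \<theta>\<^sup>2 * v / 2 * live_sum 2 s w)" using L by simp
    fix w
    define y where "y = \<theta>\<^sup>2 * v / 2 * live_sum 2 s w"
    have "0 \<le> y" using v by (simp add: y_def)
    then have "\<bar>exp (- y) - 1\<bar> \<le> y" using exp_ge_add_one_self[of "- y"] by (simp add: abs_real_def)
    moreover have "cmod (gauss v s \<theta> w - 1) = \<bar>exp (- y) - 1\<bar>"
      unfolding gauss_def y_def by (metis norm_of_real of_real_1 of_real_diff)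
    ultimately show "cmod (gauss v s \<theta> w - 1) \<le> \<theta>\<^sup>2 * v / 2 * live_sum 2 s w" by (simp add: y_def)
  qed
  also have "\<dots> = \<theta>\<^sup>2 * v / 2 * exp (\<phi> * s)" using L by simp
  also have "\<dots> \<le> \<theta>\<^sup>2 * v / 2 * exp (m * s)" using exp_le v by (intro mult_left_mono) auto
  finally have 2: "cmod ((\<integral> w. gauss v s \<theta> w \<partial>\<Omega>) - 1) \<le> \<theta>\<^sup>2 * v / 2 * exp (m * s)" .
  have "phase_gauss_gap u v s \<theta> \<le> cmod ((\<integral> w. phase u s \<theta> w \<partial>\<Omega>) - 1) + cmod ((\<integral> w. gauss v s \<theta> w \<partial>\<Omega>) - 1)"
    unfolding phase_gauss_gap_def
    using norm_triangle_ineq4[of "(\<integral> w. phase u s \<theta> w \<partial>\<Omega>) - 1" "(\<integral> w. gauss v s \<theta> w \<partial>\<Omega>) - 1"] by simp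
  also have "\<dots> \<le> \<theta>\<^sup>2 / 2 * (\<sigma>2 * (exp (\<phi> * u) * exp (m * s) / \<phi>)) + \<theta>\<^sup>2 * v / 2 * exp (m * s)"
    using 1 2 by (rule add_mono)
  also have "\<dots> = (\<sigma>2 * exp (\<phi> * u) / \<phi> / 2 + v / 2) * (\<theta>\<^sup>2 * exp (m * s))"
    using \<phi>(2) by (simp add: field_simps)
  finally show "phase_gauss_gap u v s \<theta> \<le> (\<sigma>2 * exp (\<phi> * u) / \<phi> / 2 + v / 2) * (\<theta>\<^sup>2 * exp (m * s))" .
qed

text \<open>Substituting a bound into \<open>gap_recursion\<close> yields a new one. The two target terms reproduce
  themselves, since their growth rates are at least \<open>\<Phi>(2)\<close> and \<open>\<Phi>(p)\<close>, whereas the crude bound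
  shrinks by the factor \<open>m / (1 + m)\<close> in every iteration and disappears in the limit.\<close>

lemma gap_bound:
  assumes u: "0 \<le> u" and v: "v = \<sigma>2 * ((exp (\<phi> * u) - 1) / \<phi>)" and \<epsilon>: "0 < \<epsilon>"
    and p: "mom p = ennreal mp" "0 \<le> mp" "mp \<le> 1 + l" "-1 < l" "0 < p"
  shows "\<exists>K\<ge>0. \<forall>s\<ge>0. \<forall>\<theta>. phase_gauss_gap u v s \<theta> \<le> \<epsilon> * \<theta>\<^sup>2 * exp (\<phi> * s) + K * \<bar>\<theta>\<bar> powr p * exp (l * s)"
proof -
  have \<phi>0: "\<phi> \<noteq> 0" using \<phi> by simp
  have v0: "0 \<le> v" unfolding v using \<sigma>2_nonneg \<phi> u by (intro mult_nonneg_nonneg divide_nonneg_nonneg) auto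
  note X = total_increment_moments[OF C m \<phi>(1) \<phi>0 order_refl, of u]
  obtain K where K: "0 \<le> K" "\<And>r. cmod ((\<integral> w. iexp (r * (total_reward u w - total_reward 0 w)) \<partial>\<Omega>) - exp (- (r\<^sup>2 * v / 2)))
      \<le> \<epsilon> * r\<^sup>2 + K * \<bar>r\<bar> powr p"
  proof -
    have "(\<integral> w. (total_reward u w - total_reward 0 w)\<^sup>2 \<partial>\<Omega>) = v" using X(2)[OF u] by (simp add: v)
    from \<Omega>.characteristic_function_near_gaussian[OF X(3)[OF u] X(4)[OF u] X(1)[OF u] this \<epsilon> p(5)]
    show ?thesis using that by blast
  qed
  obtain \<rho> where \<rho>: "0 \<le> \<rho>" "\<And>s \<theta>. 0 \<le> s \<Longrightarrow> phase_gauss_gap u v s \<theta> \<le> \<rho> * (\<theta>\<^sup>2 * exp (m * s))"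
    using gap_crude_bound[OF u v0] by blast
  define r where "r = m / (1 + m)"
  have r: "0 \<le> r" "r < 1" using m(2) by (auto simp: r_def)
  define B where "B s \<theta> = \<epsilon> * \<theta>\<^sup>2 * exp (\<phi> * s) + K * \<bar>\<theta>\<bar> powr p * exp (l * s)" for s \<theta>
  have iter: "phase_gauss_gap u v s \<theta> \<le> B s \<theta> + \<rho> * r ^ n * (\<theta>\<^sup>2 * exp (m * s))" if "0 \<le> s" for n s \<theta>
    using that
  proof (induction n arbitrary: s \<theta>)
    case 0
    have "0 \<le> B s \<theta>" using K(1) \<epsilon> by (simp add: B_def)
    then show ?case using \<rho>(2)[OF 0, of \<theta>] by simp
  next
    case (Suc n)
    note s = Suc.prems
    define b where "b q = \<epsilon> * \<theta>\<^sup>2 * majorant 2 \<phi> s q + K * \<bar>\<theta>\<bar> powr p * majorant p l s q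
        + \<rho> * r ^ n * \<theta>\<^sup>2 * majorant 2 m s q" for q
    note M1 = integral_majorant[OF m _ s, of \<phi>]
    note M2 = integral_majorant[OF p(1,2,4) s]
    note M3 = integral_majorant[OF m _ s, of m]
    have \<phi>1: "-1 < \<phi>" "-1 < m" using \<phi> m by auto
    have intb: "integrable Q b"
      unfolding b_def[abs_def]
      by (intro Bochner_Integration.integrable_add integrable_mult_right M1(1) M2(1) M3(1) \<phi>1)
    \<comment> \<open>the subtracted terms exp (- s) make room for the initial difference\<close>
    have "(\<integral> q. b q \<partial>Q) = \<epsilon> * \<theta>\<^sup>2 * (m / (1 + \<phi>) * (exp (\<phi> * s) - exp (- s)))
        + K * \<bar>\<theta>\<bar> powr p * (mp / (1 + l) * (exp (l * s) - exp (- s)))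
        + \<rho> * r ^ n * \<theta>\<^sup>2 * (m / (1 + m) * (exp (m * s) - exp (- s)))"
      unfolding b_def using M1 M2 M3 \<phi>1 by simp
    also have "\<dots> \<le> \<epsilon> * \<theta>\<^sup>2 * (exp (\<phi> * s) - exp (- s)) + K * \<bar>\<theta>\<bar> powr p * (exp (l * s) - exp (- s))
        + \<rho> * r ^ n * \<theta>\<^sup>2 * (r * exp (m * s))"
    proof (intro add_mono mult_left_mono)
      show "m / (1 + \<phi>) * (exp (\<phi> * s) - exp (- s)) \<le> exp (\<phi> * s) - exp (- s)"
        using \<phi> by simp
      have "- s \<le> l * s" using mult_right_mono[of "-1" l s] p s by simp
      then have "0 \<le> exp (l * s) - exp (- s)" by simp
      moreover have "mp / (1 + l) \<le> 1" using p by simp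
      ultimately show "mp / (1 + l) * (exp (l * s) - exp (- s)) \<le> exp (l * s) - exp (- s)"
        using mult_right_mono[of "mp / (1 + l)" 1] by simp
      show "m / (1 + m) * (exp (m * s) - exp (- s)) \<le> r * exp (m * s)"
        using r(1) by (simp add: r_def[symmetric] right_diff_distrib)
    qed (use \<epsilon> K(1) \<rho>(1) r in auto)
    finally have int_le: "(\<integral> q. b q \<partial>Q) \<le> \<epsilon> * \<theta>\<^sup>2 * (exp (\<phi> * s) - exp (- s)) + K * \<bar>\<theta>\<bar> powr p * (exp (l * s) - exp (- s))
        + \<rho> * r ^ n * \<theta>\<^sup>2 * (r * exp (m * s))" .
    have "(if fst q \<le> s then \<Sum>k<fst (snd q). phase_gauss_gap u v (s - fst q) (\<theta> * snd (snd (snd q)) k) else 0) \<le> b q"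
      if q: "q \<in> space Q" for q
    proof (cases "fst q \<le> s")
      case True
      let ?a = "\<lambda>k. \<theta> * snd (snd (snd q)) k"
      have "(\<Sum>k<fst (snd q). phase_gauss_gap u v (s - fst q) (?a k))
          \<le> (\<Sum>k<fst (snd q). B (s - fst q) (?a k) + \<rho> * r ^ n * ((?a k)\<^sup>2 * exp (m * (s - fst q))))"
        using True by (intro sum_mono Suc.IH) simp
      also have "\<dots> = \<epsilon> * (\<Sum>k<fst (snd q). \<bar>?a k\<bar> powr 2 * exp (\<phi> * (s - fst q)))
          + K * (\<Sum>k<fst (snd q). \<bar>?a k\<bar> powr p * exp (l * (s - fst q)))
          + \<rho> * r ^ n * (\<Sum>k<fst (snd q). \<bar>?a k\<bar> powr 2 * exp (m * (s - fst q)))"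
        by (simp add: B_def abs_powr_2 sum.distrib sum_distrib_left mult.assoc)
      also have "\<dots> = b q"
        unfolding sum_majorant[OF q True] by (simp add: b_def abs_powr_2 mult_ac)
      finally show ?thesis using True by simp
    next
      case False
      then show ?thesis by (simp add: b_def majorant_def)
    qed
    then have "phase_gauss_gap u v s \<theta> \<le> exp (- s) * cmod ((\<integral> w. phase u 0 \<theta> w \<partial>\<Omega>) - exp (- (\<theta>\<^sup>2 * v / 2)))
        + (\<integral> q. b q \<partial>Q)"
      by (rule gap_recursion[OF u v0 s intb])
    also have "\<dots> \<le> exp (- s) * (\<epsilon> * \<theta>\<^sup>2 + K * \<bar>\<theta>\<bar> powr p) +
        (\<epsilon> * \<theta>\<^sup>2 * (exp (\<phi> * s) - exp (- s)) + K * \<bar>\<theta>\<bar> powr p * (exp (l * s) - exp (- s))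
        + \<rho> * r ^ n * \<theta>\<^sup>2 * (r * exp (m * s)))"
      using K(2)[of \<theta>] int_le by (intro add_mono mult_left_mono) (auto simp: phase_def)
    also have "\<dots> = B s \<theta> + \<rho> * r ^ Suc n * (\<theta>\<^sup>2 * exp (m * s))"
      by (simp add: B_def algebra_simps)
    finally show ?case .
  qed
  have "phase_gauss_gap u v s \<theta> \<le> B s \<theta>" if s: "0 \<le> s" for s \<theta>
  proof (rule LIMSEQ_le_const)
    have lim_r: "(\<lambda>n. r ^ n) \<longlonglongrightarrow> 0" using r by (intro LIMSEQ_power_zero) simp
    have "(\<lambda>n. B s \<theta> + \<rho> * r ^ n * (\<theta>\<^sup>2 * exp (m * s))) \<longlonglongrightarrow> B s \<theta> + \<rho> * 0 * (\<theta>\<^sup>2 * exp (m * s))"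
      by (intro tendsto_add tendsto_mult tendsto_const lim_r)
    then show "(\<lambda>n. B s \<theta> + \<rho> * r ^ n * (\<theta>\<^sup>2 * exp (m * s))) \<longlonglongrightarrow> B s \<theta>" by simp
  qed (use iter[OF s] in blast)
  then show ?thesis using K(1) unfolding B_def by blast
qed

text \<open>Split at time \<open>s = t - u\<close>. The normalised reward collected before \<open>s\<close> is of order
  \<open>exp (- \<phi> u / 2)\<close> in \<open>L\<^sup>1\<close>, the characteristic function of the window is replaced by the
  Gaussian functional through \<open>gap_bound\<close>, and the latter converges with the additive martingale
  as \<open>t\<close> grows. The normalised variance of the window tends to \<open>\<sigma>2 / \<phi>\<close> as \<open>u\<close> grows. The
  absolute value of the limit matters on a null set only.\<close>

theorem characteristic_function_limit:
  assumes p: "2 < p" "mom p = ennreal mp" "0 \<le> mp" "mp - 1 < p / 2 * \<phi>"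
  shows "((\<lambda>t. \<integral> w. iexp (\<theta> * (exp (- (\<phi> / 2) * t) * total_reward t w)) \<partial>\<Omega>) \<longlongrightarrow>
    (\<integral> w. complex_of_real (exp (- (\<theta>\<^sup>2 / 2 * (\<sigma>2 / \<phi>) * \<bar>limit_additive 2 \<phi> w\<bar>))) \<partial>\<Omega>)) at_top"
    (is "(?A \<longlongrightarrow> ?L) at_top")
proof (rule tendstoI)
  fix e :: real assume e: "0 < e"
  define W where "W = limit_additive 2 \<phi>"
  have Wm [measurable]: "W \<in> borel_measurable \<Omega>"
    unfolding W_def by (rule measurable_limit_additive[OF m \<phi>(1)])
  define g where "g a w = complex_of_real (exp (- (\<theta>\<^sup>2 / 2 * a * \<bar>W w\<bar>)))" for a w
  have gm [measurable]: "g a \<in> borel_measurable \<Omega>" for a unfolding g_def[abs_def] by measurable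
  \<comment> \<open>the variance of the reward collected up to time u, normalised by exp (\<phi> u)\<close>
  define vn where "vn u = \<sigma>2 / \<phi> * (1 - exp (- \<phi> * u))" for u
  have expneg: "((\<lambda>u. exp (- c * u)) \<longlongrightarrow> 0) at_top" if "0 < c" for c :: real
  proof -
    have "LIM t at_top. - c * t :> at_bot"
      by (rule filterlim_tendsto_neg_mult_at_bot[OF tendsto_const _ filterlim_ident]) (use that in simp)
    then show ?thesis by (rule filterlim_compose[OF exp_at_bot])
  qed
  have \<sigma>\<phi>: "0 \<le> \<sigma>2 / \<phi>" using \<sigma>2_nonneg \<phi> by simp
  have vn0: "0 \<le> vn u" if "0 \<le> u" for u
  proof -
    have "0 \<le> \<phi> * u" using that \<phi>(2) by (intro mult_nonneg_nonneg) auto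
    then have "exp (- \<phi> * u) \<le> 1" by simp
    then show ?thesis using \<sigma>\<phi> unfolding vn_def by (intro mult_nonneg_nonneg) auto
  qed
  have vn_lim: "(vn \<longlongrightarrow> \<sigma>2 / \<phi>) at_top"
  proof -
    have "((\<lambda>u. \<sigma>2 / \<phi> * (1 - exp (- \<phi> * u))) \<longlongrightarrow> \<sigma>2 / \<phi> * (1 - 0)) at_top"
      by (intro tendsto_intros expneg \<phi>)
    then show ?thesis by (simp add: vn_def[abs_def])
  qed
  have glim: "((\<lambda>u. \<integral> w. g (vn u) w \<partial>\<Omega>) \<longlongrightarrow> (\<integral> w. g (\<sigma>2 / \<phi>) w \<partial>\<Omega>)) at_top"
  proof (rule integral_dominated_convergence_at_top[where w="\<lambda>_. 1"])
    show "AE w in \<Omega>. ((\<lambda>u. g (vn u) w) \<longlongrightarrow> g (\<sigma>2 / \<phi>) w) at_top"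
      unfolding g_def by (intro AE_I2 tendsto_intros vn_lim)
    show "\<forall>\<^sub>F u in at_top. AE w in \<Omega>. norm (g (vn u) w) \<le> 1"
      using eventually_ge_at_top[of "0::real"] by eventually_elim (simp add: g_def vn0)
  qed auto
  define c1 where "c1 = \<bar>\<theta>\<bar> * (1 + \<sigma>2 / \<phi>)"
  have "((\<lambda>u. c1 * exp (- (\<phi> / 2) * u)) \<longlongrightarrow> c1 * 0) at_top"
    by (intro tendsto_intros expneg) (use \<phi> in simp)
  then have ev1: "\<forall>\<^sub>F u in at_top. c1 * exp (- (\<phi> / 2) * u) < e / 5"
    using e by (intro order_tendstoD) auto
  have ev2: "\<forall>\<^sub>F u in at_top. dist (\<integral> w. g (vn u) w \<partial>\<Omega>) (\<integral> w. g (\<sigma>2 / \<phi>) w \<partial>\<Omega>) < e / 5"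
    using e by (intro tendstoD[OF glim]) simp
  obtain u where u: "0 \<le> u" "c1 * exp (- (\<phi> / 2) * u) < e / 5"
      "dist (\<integral> w. g (vn u) w \<partial>\<Omega>) (\<integral> w. g (\<sigma>2 / \<phi>) w \<partial>\<Omega>) < e / 5"
    using eventually_conj[OF eventually_conj[OF ev1 ev2] eventually_ge_at_top[of 0]]
    by (auto simp: eventually_at_top_linorder)
  define v where "v = \<sigma>2 * ((exp (\<phi> * u) - 1) / \<phi>)"
  have v0: "0 \<le> v" unfolding v_def using \<sigma>2_nonneg \<phi> u by (intro mult_nonneg_nonneg divide_nonneg_nonneg) auto
  \<comment> \<open>a nonnegative growth rate, so that exp (l s) is at most exp (l t)\<close>
  define l where "l = max (mp - 1) 0"
  have "0 < p / 2 * \<phi>" using p(1) \<phi>(2) by (intro mult_pos_pos) auto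
  then have l: "0 \<le> l" "mp \<le> 1 + l" "l < p / 2 * \<phi>"
    using p(4) unfolding l_def max_less_iff_conj by linarith+
  define \<epsilon> where "\<epsilon> = e / (5 * (1 + \<theta>\<^sup>2))"
  have \<theta>1: "0 < 1 + \<theta>\<^sup>2" by (rule add_pos_nonneg) auto
  have \<epsilon>: "0 < \<epsilon>" "\<epsilon> * \<theta>\<^sup>2 \<le> e / 5"
  proof -
    show "0 < \<epsilon>" using e \<theta>1 by (simp add: \<epsilon>_def)
    have "\<epsilon> * \<theta>\<^sup>2 \<le> \<epsilon> * (1 + \<theta>\<^sup>2)" using \<open>0 < \<epsilon>\<close> by (intro mult_left_mono) auto
    also have "\<dots> = e / 5"
    proof -
      have "e / (5 * c) * c = e / 5" if "0 < c" for c using that by (simp add: field_simps)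
      then show ?thesis unfolding \<epsilon>_def using \<theta>1 .
    qed
    finally show "\<epsilon> * \<theta>\<^sup>2 \<le> e / 5" .
  qed
  obtain K where K: "0 \<le> K" "\<And>s \<theta>. 0 \<le> s \<Longrightarrow>
      phase_gauss_gap u v s \<theta> \<le> \<epsilon> * \<theta>\<^sup>2 * exp (\<phi> * s) + K * \<bar>\<theta>\<bar> powr p * exp (l * s)"
    using gap_bound[OF u(1) v_def \<epsilon>(1) p(2,3) l(2)] l p by force
  have "((\<lambda>t. K * \<bar>\<theta>\<bar> powr p * exp (- (p / 2 * \<phi> - l) * t)) \<longlongrightarrow> K * \<bar>\<theta>\<bar> powr p * 0) at_top"
    by (intro tendsto_intros expneg) (use l in simp)
  then have ev3: "\<forall>\<^sub>F t in at_top. K * \<bar>\<theta>\<bar> powr p * exp (- (p / 2 * \<phi> - l) * t) < e / 5"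
    using e by (intro order_tendstoD) auto
  define th where "th t = \<theta> * exp (- (\<phi> / 2) * t)" for t
  have th2: "(th t)\<^sup>2 = \<theta>\<^sup>2 * exp (- \<phi> * t)" for t
    by (simp add: th_def power_mult_distrib power2_eq_square exp_add[symmetric])
  have gauss_eq: "gauss v (t - u) (th t) w = complex_of_real (exp (- (\<theta>\<^sup>2 / 2 * vn u * additive_process \<phi> 2 (t - u) w)))" for t w
  proof -
    have e: "exp (- \<phi> * t) * (exp (\<phi> * u) - 1) = (1 - exp (- \<phi> * u)) * exp (- \<phi> * (t - u))"
      by (simp add: left_diff_distrib right_diff_distrib exp_add[symmetric])
    have "(th t)\<^sup>2 * v / 2 * live_sum 2 (t - u) w
        = \<theta>\<^sup>2 / 2 * (\<sigma>2 / \<phi>) * (exp (- \<phi> * t) * (exp (\<phi> * u) - 1)) * live_sum 2 (t - u) w"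
      unfolding th2 v_def by (simp add: field_simps)
    also have "\<dots> = \<theta>\<^sup>2 / 2 * vn u * additive_process \<phi> 2 (t - u) w"
      unfolding e by (simp add: vn_def additive_eq mult_ac)
    finally show ?thesis by (simp add: gauss_def)
  qed
  have shift: "filterlim (\<lambda>t::real. t - u) at_top at_top"
    by (rule filterlim_at_top_mono[where f="\<lambda>t. t - u", OF _ always_eventually])
       (use filterlim_tendsto_add_at_top[OF tendsto_const[of "- u"] filterlim_ident] in \<open>auto simp: add.commute\<close>)
  have "((\<lambda>t. \<integral> w. gauss v (t - u) (th t) w \<partial>\<Omega>) \<longlongrightarrow> (\<integral> w. g (vn u) w \<partial>\<Omega>)) at_top"
  proof (rule integral_dominated_convergence_at_top[where w="\<lambda>_. 1"])
    show "AE w in \<Omega>. ((\<lambda>t. gauss v (t - u) (th t) w) \<longlongrightarrow> g (vn u) w) at_top"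
      using AE_additive_converges[OF m \<phi>(1)]
    proof eventually_elim
      case (elim w)
      have lim: "((\<lambda>t. additive_process \<phi> 2 (t - u) w) \<longlongrightarrow> W w) at_top"
        unfolding W_def by (rule filterlim_compose[OF elim shift])
      have "0 \<le> W w"
        by (rule tendsto_lowerbound[OF lim]) auto
      then show ?case
        unfolding gauss_eq g_def using lim by (auto intro!: tendsto_intros)
    qed
    show "\<forall>\<^sub>F t in at_top. AE w in \<Omega>. norm (gauss v (t - u) (th t) w) \<le> 1"
      using norm_gauss[OF v0] by auto
  qed auto
  then have ev4: "\<forall>\<^sub>F t in at_top. dist (\<integral> w. gauss v (t - u) (th t) w \<partial>\<Omega>) (\<integral> w. g (vn u) w \<partial>\<Omega>) < e / 5"
    using e by (intro tendstoD) auto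
  show "\<forall>\<^sub>F t in at_top. dist (?A t) ?L < e"
    using ev3 ev4 eventually_ge_at_top[of u]
  proof eventually_elim
    case (elim t)
    define s where "s = t - u"
    have s: "0 \<le> s" "s \<le> t" using elim u by (auto simp: s_def)
    have \<phi>0: "\<phi> \<noteq> 0" using \<phi> by simp
    note X = total_increment_moments[OF C m \<phi>(1) \<phi>0 order_refl s(1)]
    have AEts: "AE w in \<Omega>. total_reward s w = total_reward s w - total_reward 0 w"
      using AE_total_0 by eventually_elim simp
    \<comment> \<open>the rewards collected before time s are negligible\<close>
    have early: "cmod (?A t - (\<integral> w. phase u s (th t) w \<partial>\<Omega>)) \<le> c1 * exp (- (\<phi> / 2) * u)"
    proof -
      have int: "integrable \<Omega> (\<lambda>w. iexp (\<theta> * (exp (- (\<phi> / 2) * t) * total_reward t w)))"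
        by (rule \<Omega>.integrable_const_bound[where B=1]) (auto simp: norm_exp_i_times)
      let ?h = "\<lambda>w. total_reward s w - total_reward 0 w"
      have pt: "cmod (iexp (\<theta> * (exp (- (\<phi> / 2) * t) * total_reward t w)) - phase u s (th t) w) \<le> \<bar>th t\<bar> * \<bar>?h w\<bar>"
        if "total_reward s w = ?h w" for w
      proof -
        define a where "a = th t * total_reward s w"
        define b where "b = th t * (total_reward t w - total_reward s w)"
        have ab: "iexp (\<theta> * (exp (- (\<phi> / 2) * t) * total_reward t w)) = iexp b * iexp a"
          by (simp add: a_def b_def th_def exp_add[symmetric] algebra_simps)
        have "phase u s (th t) w = iexp b" by (simp add: phase_def b_def s_def)
        then have "iexp (\<theta> * (exp (- (\<phi> / 2) * t) * total_reward t w)) - phase u s (th t) w = iexp b * (iexp a - 1)"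
          unfolding ab by (simp add: right_diff_distrib)
        then have "cmod (iexp (\<theta> * (exp (- (\<phi> / 2) * t) * total_reward t w)) - phase u s (th t) w) = cmod (iexp a - 1)"
          by (simp add: norm_mult norm_exp_i_times)
        also have "\<dots> \<le> \<bar>a\<bar>" using iexp_approx1[of a 0] by simp
        finally show ?thesis using that by (simp add: a_def abs_mult)
      qed
      have "cmod (?A t - (\<integral> w. phase u s (th t) w \<partial>\<Omega>))
          = cmod (\<integral> w. iexp (\<theta> * (exp (- (\<phi> / 2) * t) * total_reward t w)) - phase u s (th t) w \<partial>\<Omega>)"
        using int by simp
      also have "\<dots> \<le> (\<integral> w. cmod (iexp (\<theta> * (exp (- (\<phi> / 2) * t) * total_reward t w)) - phase u s (th t) w) \<partial>\<Omega>)"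
        by (rule integral_norm_bound)
      also have "\<dots> \<le> (\<integral> w. \<bar>th t\<bar> * \<bar>?h w\<bar> \<partial>\<Omega>)"
        using int X(3) by (intro integral_mono_AE) (use AEts pt in \<open>auto elim!: eventually_mono\<close>)
      also have "\<dots> = \<bar>th t\<bar> * (\<integral> w. \<bar>?h w\<bar> \<partial>\<Omega>)" by simp
      also have "(\<integral> w. \<bar>?h w\<bar> \<partial>\<Omega>) \<le> (1 + \<sigma>2 / \<phi>) * exp (\<phi> / 2 * s)"
      proof -
        define d where "d = exp (\<phi> / 2 * s)"
        have d: "0 < d" "d * d = exp (\<phi> * s)" by (simp_all add: d_def exp_add[symmetric])
        have "(\<integral> w. \<bar>?h w\<bar> \<partial>\<Omega>) \<le> (\<integral> w. d + (?h w)\<^sup>2 / d \<partial>\<Omega>)"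
          using X abs_le_add_square_divide[OF d(1)] by (intro integral_mono) auto
        also have "\<dots> = d + \<sigma>2 * ((exp (\<phi> * s) - exp (\<phi> * 0)) / \<phi>) / d"
          using X(1,2) by (simp add: \<Omega>.prob_space)
        also have "\<dots> \<le> d + \<sigma>2 * (d * d / \<phi>) / d"
          unfolding d(2) using d \<sigma>2_nonneg \<phi>
          by (intro add_left_mono divide_right_mono mult_left_mono) auto
        also have "\<dots> = (1 + \<sigma>2 / \<phi>) * d" using d(1) by (simp add: distrib_right)
        finally show ?thesis by (simp add: d_def)
      qed
      also have "\<bar>th t\<bar> * ((1 + \<sigma>2 / \<phi>) * exp (\<phi> / 2 * s)) = c1 * exp (- (\<phi> / 2) * u)"
      proof -
        have "exp (- (\<phi> / 2) * t) * exp (\<phi> / 2 * s) = exp (- (\<phi> / 2) * u)"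
          by (simp add: exp_add[symmetric] s_def field_simps)
        then show ?thesis by (simp add: th_def c1_def abs_mult mult_ac)
      qed
      finally show ?thesis by (simp add: mult_left_mono)
    qed
    have gap: "cmod ((\<integral> w. phase u s (th t) w \<partial>\<Omega>) - (\<integral> w. gauss v s (th t) w \<partial>\<Omega>)) < 2 * (e / 5)"
    proof -
      have "cmod ((\<integral> w. phase u s (th t) w \<partial>\<Omega>) - (\<integral> w. gauss v s (th t) w \<partial>\<Omega>))
          \<le> \<epsilon> * (th t)\<^sup>2 * exp (\<phi> * s) + K * \<bar>th t\<bar> powr p * exp (l * s)"
        using K(2)[OF s(1), of "th t"] by (simp add: phase_gauss_gap_def)
      also have "\<epsilon> * (th t)\<^sup>2 * exp (\<phi> * s) \<le> e / 5"
      proof -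
        have "\<phi> * s \<le> \<phi> * t" using s(2) \<phi>(2) by (intro mult_left_mono) auto
        then have "exp (- \<phi> * t) * exp (\<phi> * s) \<le> 1" by (simp add: exp_add[symmetric])
        then have "\<epsilon> * \<theta>\<^sup>2 * (exp (- \<phi> * t) * exp (\<phi> * s)) \<le> \<epsilon> * \<theta>\<^sup>2 * 1"
          using \<epsilon>(1) by (intro mult_left_mono) auto
        then show ?thesis using \<epsilon>(2) by (simp add: th2 mult.assoc)
      qed
      also have "K * \<bar>th t\<bar> powr p * exp (l * s) \<le> K * \<bar>\<theta>\<bar> powr p * exp (- (p / 2 * \<phi> - l) * t)"
      proof -
        have "\<bar>th t\<bar> powr p = \<bar>\<theta>\<bar> powr p * exp (- (p / 2 * \<phi>) * t)"
          by (simp add: th_def abs_mult powr_mult) (simp add: powr_def mult_ac)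
        moreover have "exp (- (p / 2 * \<phi>) * t) * exp (l * s) \<le> exp (- (p / 2 * \<phi> - l) * t)"
          using mult_left_mono[OF s(2) l(1)] by (simp add: exp_add[symmetric] algebra_simps)
        ultimately show ?thesis
          using K(1) mult_left_mono[of "exp (- (p / 2 * \<phi>) * t) * exp (l * s)" "exp (- (p / 2 * \<phi> - l) * t)" "K * \<bar>\<theta>\<bar> powr p"]
          by (simp add: mult_ac)
      qed
      finally show ?thesis using elim(1) by simp
    qed
    have "cmod (?A t - ?L) \<le> cmod (?A t - (\<integral> w. phase u s (th t) w \<partial>\<Omega>))
        + cmod ((\<integral> w. phase u s (th t) w \<partial>\<Omega>) - (\<integral> w. gauss v s (th t) w \<partial>\<Omega>))
        + cmod ((\<integral> w. gauss v s (th t) w \<partial>\<Omega>) - (\<integral> w. g (vn u) w \<partial>\<Omega>))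
        + cmod ((\<integral> w. g (vn u) w \<partial>\<Omega>) - ?L)"
    proof -
      have "dist a x \<le> dist a b + dist b c + dist c d + dist d x" for a b c d x :: complex
        using dist_triangle[of a x b] dist_triangle[of b x c] dist_triangle[of c x d] by linarith
      then show ?thesis unfolding dist_norm .
    qed
    moreover have "cmod ((\<integral> w. gauss v s (th t) w \<partial>\<Omega>) - (\<integral> w. g (vn u) w \<partial>\<Omega>)) < e / 5"
      using elim(2) by (simp add: dist_norm s_def)
    moreover have "cmod ((\<integral> w. g (vn u) w \<partial>\<Omega>) - ?L) < e / 5"
      using u(3) by (simp add: dist_norm g_def W_def)
    ultimately show ?case using early gap u(2) by (simp add: dist_norm)
  qed
qed

end

end

section \<open>Convergence in distribution to a normal mixture\<close>

text \<open>Levy's continuity theorem concerns sequences, but a limit as the real parameter \<open>t\<close> tends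
  to infinity can be tested along sequences.\<close>

lemma tendsto_in_distr_of_char:
  fixes X :: "real \<Rightarrow> 'b \<Rightarrow> real"
  assumes M: "prob_space M" and X: "\<And>t. X t \<in> borel_measurable M" and L: "real_distribution L"
    and lim: "\<And>\<theta>. ((\<lambda>t. char (distr M borel (X t)) \<theta>) \<longlongrightarrow> char L \<theta>) at_top"
  shows "tendsto_in_distr M X L at_top"
  unfolding tendsto_in_distr_def
proof (intro conjI allI impI)
  show "\<forall>\<^sub>F t in at_top. X t \<in> borel_measurable M" using X by simp
  fix x assume x: "isCont (cdf L) x"
  show "((\<lambda>t. cdf (distr M borel (X t)) x) \<longlongrightarrow> cdf L x) at_top"
  proof (rule tendsto_at_topI_sequentially)
    fix T :: "nat \<Rightarrow> real" assume T: "filterlim T at_top sequentially"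
    have "weak_conv_m (\<lambda>n. distr M borel (X (T n))) L"
    proof (rule levy_continuity[OF _ L])
      show "real_distribution (distr M borel (X (T n)))" for n
        using prob_space.real_distribution_distr[OF M] X by simp
      show "(\<lambda>n. char (distr M borel (X (T n))) \<theta>) \<longlonglongrightarrow> char L \<theta>" for \<theta>
        by (rule filterlim_compose[OF lim T])
    qed
    then show "(\<lambda>n. cdf (distr M borel (X (T n))) x) \<longlonglongrightarrow> cdf L x"
      using x by (simp add: weak_conv_m_def weak_conv_def)
  qed
qed

text \<open>Given \<open>W\<close>, the mixture is a centred normal variable. Its variance is \<open>\<bar>W c\<bar>\<close> even where
  \<open>W < 0\<close>, since real square roots are odd functions.\<close>

lemma normal_mixture_char:
  assumes M: "prob_space M" and W [measurable]: "W \<in> borel_measurable M" and c: "0 \<le> c"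
  shows "real_distribution (normal_mixture M W c)"
    "char (normal_mixture M W c) \<theta> = (\<integral> w. complex_of_real (exp (- (\<theta>\<^sup>2 / 2 * c * \<bar>W w\<bar>))) \<partial>M)"
proof -
  interpret M: prob_space M by fact
  interpret Z: real_distribution std_normal_distribution by (rule real_dist_normal_dist)
  interpret MZ: pair_prob_space M std_normal_distribution ..
  have meas [measurable]: "(\<lambda>(w, z). sqrt (W w * c) * z) \<in> borel_measurable (M \<Otimes>\<^sub>M std_normal_distribution)"
  proof -
    have [measurable]: "(\<lambda>p. W (fst p)) \<in> borel_measurable (M \<Otimes>\<^sub>M std_normal_distribution)" by measurable
    have [measurable]: "snd \<in> borel_measurable (M \<Otimes>\<^sub>M std_normal_distribution)"
      using measurable_snd[of M std_normal_distribution] by simp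
    show ?thesis unfolding split_beta' by measurable
  qed
  show "real_distribution (normal_mixture M W c)"
    unfolding normal_mixture_def by (rule MZ.real_distribution_distr) (rule meas)
  have int: "integrable (M \<Otimes>\<^sub>M std_normal_distribution) (\<lambda>p. iexp (\<theta> * (\<lambda>(w, z). sqrt (W w * c) * z) p))"
  proof (rule MZ.integrable_const_bound[where B=1])
    have "(\<lambda>x::real. iexp (\<theta> * x)) \<in> borel_measurable borel" by measurable
    from measurable_compose[OF meas this]
    show "(\<lambda>p. iexp (\<theta> * (\<lambda>(w, z). sqrt (W w * c) * z) p)) \<in> borel_measurable (M \<Otimes>\<^sub>M std_normal_distribution)" .
  qed (simp add: norm_exp_i_times del: of_real_mult)
  have "char (normal_mixture M W c) \<theta>
      = (\<integral> p. iexp (\<theta> * (\<lambda>(w, z). sqrt (W w * c) * z) p) \<partial>(M \<Otimes>\<^sub>M std_normal_distribution))"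
    unfolding char_def normal_mixture_def by (rule integral_distr[OF meas]) measurable
  also have "\<dots> = (\<integral> w. \<integral> z. iexp (\<theta> * (sqrt (W w * c) * z)) \<partial>std_normal_distribution \<partial>M)"
    using MZ.integral_fst'[OF int] by simp
  also have "\<dots> = (\<integral> w. complex_of_real (exp (- (\<theta>\<^sup>2 / 2 * c * \<bar>W w\<bar>))) \<partial>M)"
  proof (intro Bochner_Integration.integral_cong refl)
    fix w
    have sq: "(sqrt y)\<^sup>2 = \<bar>y\<bar>" for y :: real
    proof (cases "0 \<le> y")
      case False
      then have "sqrt y = - sqrt (- y)" by (simp add: real_sqrt_minus)
      then show ?thesis using False by simp
    qed simp
    have "(\<integral> z. iexp (\<theta> * (sqrt (W w * c) * z)) \<partial>std_normal_distribution)
        = char std_normal_distribution (\<theta> * sqrt (W w * c))"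
      by (simp add: char_def mult.assoc)
    also have "\<dots> = complex_of_real (exp (- (\<theta>\<^sup>2 * \<bar>W w * c\<bar>) / 2))"
      by (simp only: char_std_normal_distribution power_mult_distrib sq)
    also have "- (\<theta>\<^sup>2 * \<bar>W w * c\<bar>) / 2 = - (\<theta>\<^sup>2 / 2 * c * \<bar>W w\<bar>)"
      using c by (simp add: abs_mult)
    finally show "(\<integral> z. iexp (\<theta> * (sqrt (W w * c) * z)) \<partial>std_normal_distribution)
      = complex_of_real (exp (- (\<theta>\<^sup>2 / 2 * c * \<bar>W w\<bar>)))" .
  qed
  finally show "char (normal_mixture M W c) \<theta> = (\<integral> w. complex_of_real (exp (- (\<theta>\<^sup>2 / 2 * c * \<bar>W w\<bar>))) \<partial>M)" .
qed

section \<open>Transfer to an arbitrary probability space\<close>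

definition configuration ::
    "(nat list \<Rightarrow> 'b \<Rightarrow> real) \<Rightarrow> (nat list \<Rightarrow> 'b \<Rightarrow> nat) \<Rightarrow> (nat list \<Rightarrow> 'b \<Rightarrow> real) \<Rightarrow>
     (nat list \<Rightarrow> 'b \<Rightarrow> nat \<Rightarrow> real) \<Rightarrow> 'b \<Rightarrow> config" where
  "configuration E N C A \<omega> = (\<lambda>x. (E x \<omega>, N x \<omega>, C x \<omega>, A x \<omega>))"

lemma coords_configuration [simp]:
  "lifetime x (configuration E N C A \<omega>) = E x \<omega>"
  "offspring x (configuration E N C A \<omega>) = N x \<omega>"
  "reward x (configuration E N C A \<omega>) = C x \<omega>"
  "factor x (configuration E N C A \<omega>) = A x \<omega>"
  by (simp_all add: configuration_def lifetime_def offspring_def reward_def factor_def)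

lemma tree_configuration [simp]: "x \<in> tree (configuration E N C A \<omega>) \<longleftrightarrow> x \<in> gw_tree N \<omega>"
  by (induction x) auto

lemma born_configuration [simp]: "born x (configuration E N C A \<omega>) = birth E x \<omega>"
  by (induction x) auto

lemma pos_configuration [simp]: "pos factor x (configuration E N C A \<omega>) = pos A x \<omega>"
  by (induction x) auto

lemma total_configuration: "total_reward t (configuration E N C A \<omega>) = Ctot E N C A t \<omega>"
  by (simp add: Ctot_def dead_def death_def)

lemma additive_configuration: "additive_process \<phi> \<gamma> t (configuration E N C A \<omega>) = Mart \<phi> E N A \<gamma> t \<omega>"
  by (simp add: Mart_def alive_def death_def)

theorem theorem2p4:
  fixes P :: "'a measure" and M :: "'b measure"
    and E\<^sub>0 :: "'a \<Rightarrow> real" and N\<^sub>0 :: "'a \<Rightarrow> nat" and C\<^sub>0 :: "'a \<Rightarrow> real" and A\<^sub>0 :: "'a \<Rightarrow> nat \<Rightarrow> real"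
    and E :: "nat list \<Rightarrow> 'b \<Rightarrow> real" and N :: "nat list \<Rightarrow> 'b \<Rightarrow> nat"
    and C :: "nat list \<Rightarrow> 'b \<Rightarrow> real" and A :: "nat list \<Rightarrow> 'b \<Rightarrow> nat \<Rightarrow> real"
  assumes "prob_space P" and "prob_space M"
    and "(\<lambda>\<omega>. (N\<^sub>0 \<omega>, C\<^sub>0 \<omega>, A\<^sub>0 \<omega>)) \<in> measurable P mark_space"
    and "distributed P lborel E\<^sub>0 (exponential_density 1)"
    and "prob_space.indep_set P (sets (vimage_algebra (space P) E\<^sub>0 borel))
           (sets (vimage_algebra (space P) (\<lambda>\<omega>. (N\<^sub>0 \<omega>, C\<^sub>0 \<omega>, A\<^sub>0 \<omega>)) mark_space))"
    and "independent_copies M (\<lambda>x \<omega>. (E x \<omega>, N x \<omega>, C x \<omega>, A x \<omega>))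
           P (\<lambda>\<omega>. (E\<^sub>0 \<omega>, N\<^sub>0 \<omega>, C\<^sub>0 \<omega>, A\<^sub>0 \<omega>)) (borel \<Otimes>\<^sub>M mark_space)"
    and i: "\<forall>\<^sub>F \<epsilon> in at_right (0::real).
              (\<integral>\<^sup>+ s\<in>{1 - \<epsilon>..1}. ennreal (1 / (s - (\<integral>\<omega>. s ^ N\<^sub>0 \<omega> \<partial>P))) \<partial>lborel) = \<infinity>"
    and ii: "\<forall>m. \<P>(\<omega> in P. N\<^sub>0 \<omega> = m) > 0 \<longrightarrow>
              \<P>(\<omega> in P. (\<forall>k<m. A\<^sub>0 \<omega> k > 0) \<bar> N\<^sub>0 \<omega> = m) = 1"
    and iii: "\<exists>m. \<P>(\<omega> in P. N\<^sub>0 \<omega> = m) > 0 \<and>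
              \<P>(\<omega> in P. (\<forall>k<m. A\<^sub>0 \<omega> k = 1) \<bar> N\<^sub>0 \<omega> = m) < 1"
    and iv: "(\<integral>\<^sup>+ \<omega>. ennreal (real (N\<^sub>0 \<omega>)) \<partial>P) > 1"
  shows
    "((integrable P C\<^sub>0 \<and> (\<integral>\<omega>. C\<^sub>0 \<omega> \<partial>P) = 0 \<and> mu_deriv_neg P N\<^sub>0 A\<^sub>0 1 \<and>
       (\<exists>p. 1 < p \<and> p \<le> 2 \<and> integrable P (\<lambda>\<omega>. \<bar>C\<^sub>0 \<omega>\<bar> powr p) \<and> Phi P N\<^sub>0 A\<^sub>0 p < 0)) \<longrightarrow>
      (\<exists>C_inf. tendsto_in_prob M (Ctot E N C A) C_inf at_top))
     \<and>
     ((integrable P C\<^sub>0 \<and> (\<integral>\<omega>. C\<^sub>0 \<omega> \<partial>P) = 0 \<and> 2 \<in> interior (Dset P N\<^sub>0 A\<^sub>0) \<and>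
       0 < Phi P N\<^sub>0 A\<^sub>0 2 \<and> mu_deriv_neg P N\<^sub>0 A\<^sub>0 2 \<and>
       integrable P (\<lambda>\<omega>. (C\<^sub>0 \<omega>)\<^sup>2) \<and> 0 < (\<integral>\<omega>. (C\<^sub>0 \<omega>)\<^sup>2 \<partial>P)) \<longrightarrow>
      (\<exists>M_inf \<in> borel_measurable M.
         (AE \<omega> in M. ((\<lambda>t. Mart (real_of_ereal (Phi P N\<^sub>0 A\<^sub>0 2)) E N A 2 t \<omega>)
                        \<longlongrightarrow> M_inf \<omega>) at_top) \<and>
         tendsto_in_distr M
           (\<lambda>t \<omega>. exp (- mu P N\<^sub>0 A\<^sub>0 2 * t) * Ctot E N C A t \<omega>)
           (normal_mixture M M_inf
              ((\<integral>\<omega>. (C\<^sub>0 \<omega>)\<^sup>2 \<partial>P) / real_of_ereal (Phi P N\<^sub>0 A\<^sub>0 2)))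
           at_top))"
proof -
  interpret P: prob_space P by fact
  interpret M: prob_space M by fact
  note Y = assms(3)
  let ?Y = "\<lambda>\<omega>. (N\<^sub>0 \<omega>, C\<^sub>0 \<omega>, A\<^sub>0 \<omega>)"
  let ?S = "borel \<Otimes>\<^sub>M mark_space :: mark measure"
  define R where "R = distr P mark_space ?Y"
  interpret R: prob_space R unfolding R_def by (rule P.prob_space_distr[OF Y])
  interpret marked_branching R
    by unfold_locales (simp_all add: R_def)
  have E0: "E\<^sub>0 \<in> borel_measurable P"
    using assms(4) by (simp add: distributed_def)
  \<comment> \<open>lifetime and the rest of the generic mark are independent, so their joint law is the
    product\<close>
  have Q: "Q = distr P ?S (\<lambda>\<omega>. (E\<^sub>0 \<omega>, ?Y \<omega>))"
  proof -
    interpret dE: prob_space "distr P borel E\<^sub>0" by (rule P.prob_space_distr[OF E0])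
    have pair: "(\<lambda>\<omega>. (E\<^sub>0 \<omega>, ?Y \<omega>)) \<in> P \<rightarrow>\<^sub>M ?S" using E0 Y by (rule measurable_Pair)
    have "distr P borel E\<^sub>0 \<Otimes>\<^sub>M R = distr P ?S (\<lambda>\<omega>. (E\<^sub>0 \<omega>, ?Y \<omega>))"
    proof (rule pair_measure_eqI)
      show "sigma_finite_measure (distr P borel E\<^sub>0)" "sigma_finite_measure R" by unfold_locales
      show "sets (distr P borel E\<^sub>0 \<Otimes>\<^sub>M R) = sets (distr P ?S (\<lambda>\<omega>. (E\<^sub>0 \<omega>, ?Y \<omega>)))"
        by (simp add: R_def cong: sets_pair_measure_cong)
      fix a b assume "a \<in> sets (distr P borel E\<^sub>0)" "b \<in> sets R"
      then have a: "a \<in> sets borel" and b: "b \<in> sets mark_space" by (simp_all add: R_def)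
      let ?a = "E\<^sub>0 -` a \<inter> space P" and ?b = "?Y -` b \<inter> space P"
      have ab: "?a \<in> sets P" "?b \<in> sets P" using E0 Y a b by (auto intro: measurable_sets)
      have "?a \<in> sets (vimage_algebra (space P) E\<^sub>0 borel)" "?b \<in> sets (vimage_algebra (space P) ?Y mark_space)"
        using a b by (auto intro: in_vimage_algebra)
      then have "P.prob (?a \<inter> ?b) = P.prob ?a * P.prob ?b"
        by (rule P.indep_setD[OF assms(5)])
      moreover have "(\<lambda>\<omega>. (E\<^sub>0 \<omega>, ?Y \<omega>)) -` (a \<times> b) \<inter> space P = ?a \<inter> ?b" by auto
      ultimately show "emeasure (distr P borel E\<^sub>0) a * emeasure R b
          = emeasure (distr P ?S (\<lambda>\<omega>. (E\<^sub>0 \<omega>, ?Y \<omega>))) (a \<times> b)"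
        unfolding R_def using a b
        by (simp add: emeasure_distr E0 Y pair P.emeasure_eq_measure ennreal_mult)
    qed
    moreover have "distr P borel E\<^sub>0 = unit_exponential"
    proof -
      have "distr P borel E\<^sub>0 = distr P lborel E\<^sub>0" by (rule distr_cong) auto
      also have "\<dots> = unit_exponential"
        using assms(4) by (simp add: distributed_def unit_exponential_def)
      finally show ?thesis .
    qed
    ultimately show ?thesis by (simp add: Q_def)
  qed
  let ?X = "configuration E N C A"
  have indep: "M.indep_vars (\<lambda>_. ?S) (\<lambda>x \<omega>. (E x \<omega>, N x \<omega>, C x \<omega>, A x \<omega>)) UNIV"
    and copies: "\<And>x. distr M ?S (\<lambda>\<omega>. (E x \<omega>, N x \<omega>, C x \<omega>, A x \<omega>)) = Q"
    using assms(6) unfolding independent_copies_def Q by auto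
  have rv: "(\<lambda>\<omega>. (E x \<omega>, N x \<omega>, C x \<omega>, A x \<omega>)) \<in> M \<rightarrow>\<^sub>M ?S" for x
    using indep unfolding M.indep_vars_def by auto
  have X [measurable]: "?X \<in> M \<rightarrow>\<^sub>M \<Omega>"
  proof -
    have "?X \<in> M \<rightarrow>\<^sub>M (\<Pi>\<^sub>M x\<in>UNIV. ?S)"
      unfolding configuration_def
      by (rule measurable_PiM_single') (use rv measurable_space[OF rv] in \<open>auto simp: PiE_iff\<close>)
    then show ?thesis using measurable_cong_sets[OF refl sets_\<Omega>] by blast
  qed
  have law: "distr M \<Omega> ?X = \<Omega>"
  proof -
    have "distr M (\<Pi>\<^sub>M x\<in>UNIV. ?S) (\<lambda>\<omega>. \<lambda>x\<in>UNIV. (E x \<omega>, N x \<omega>, C x \<omega>, A x \<omega>)) = (\<Pi>\<^sub>M x\<in>UNIV. Q)"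
      using M.indep_vars_iff_distr_eq_PiM[where I="UNIV :: nat list set" and M'="\<lambda>_. ?S" and
          X="\<lambda>x \<omega>. (E x \<omega>, N x \<omega>, C x \<omega>, A x \<omega>)", OF _ rv] indep copies by simp
    moreover have "distr M \<Omega> ?X = distr M (\<Pi>\<^sub>M x\<in>UNIV. ?S) (\<lambda>\<omega>. \<lambda>x\<in>UNIV. (E x \<omega>, N x \<omega>, C x \<omega>, A x \<omega>))"
      by (rule distr_cong) (auto simp: sets_\<Omega> configuration_def)
    ultimately show ?thesis by (simp add: \<Omega>_def)
  qed
  have moment: "moment P N\<^sub>0 A\<^sub>0 s = mom s" for s
    unfolding mom_def moment_def unfolding R_def by (subst nn_integral_distr[OF Y]) (auto simp: power_sum_def)
  have gen: "gen_fun s = (\<integral>\<omega>. s ^ N\<^sub>0 \<omega> \<partial>P)" for s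
    unfolding gen_fun_def unfolding R_def by (subst integral_distr[OF Y]) auto
  interpret nonexplosive_branching R
    by unfold_locales (rule AE_finite_past, use i in \<open>simp only: gen\<close>)
  have C_int: "integrable R (\<lambda>r. f (fst (snd r))) \<longleftrightarrow> integrable P (\<lambda>\<omega>. f (C\<^sub>0 \<omega>))"
      "(\<integral> r. f (fst (snd r)) \<partial>R) = (\<integral>\<omega>. f (C\<^sub>0 \<omega>) \<partial>P)"
    if "f \<in> borel_measurable borel" for f :: "real \<Rightarrow> real"
  proof -
    have "(\<lambda>r. f (fst (snd r))) \<in> borel_measurable mark_space"
      using that by measurable
    then show "integrable R (\<lambda>r. f (fst (snd r))) \<longleftrightarrow> integrable P (\<lambda>\<omega>. f (C\<^sub>0 \<omega>))"
      "(\<integral> r. f (fst (snd r)) \<partial>R) = (\<integral>\<omega>. f (C\<^sub>0 \<omega>) \<partial>P)"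
      unfolding R_def by (simp_all add: integrable_distr_eq[OF Y] integral_distr[OF Y])
  qed
  have Cm: "Ctot E N C A t \<in> borel_measurable M" for t
  proof -
    have "(\<lambda>\<omega>. total_reward t (?X \<omega>)) \<in> borel_measurable M" by measurable
    then show ?thesis by (simp add: total_configuration)
  qed
  show ?thesis
  proof (intro conjI impI; elim conjE exE)
    fix p :: real
    assume C: "integrable P C\<^sub>0" "(\<integral>\<omega>. C\<^sub>0 \<omega> \<partial>P) = 0"
      and p: "1 < p" "p \<le> 2" "integrable P (\<lambda>\<omega>. \<bar>C\<^sub>0 \<omega>\<bar> powr p)" "Phi P N\<^sub>0 A\<^sub>0 p < 0"
    have "mom p < 1"
      using p(4) by (cases "mom p") (auto simp: Phi_def moment one_ereal_def ennreal_less_one_iff)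
    then obtain C_inf where C_inf: "tendsto_in_prob \<Omega> total_reward C_inf at_top"
      using total_converges_in_probability[of p] C p C_int[of "\<lambda>x. x"] C_int[of "\<lambda>x. \<bar>x\<bar> powr p"] by auto
    then have [measurable]: "C_inf \<in> borel_measurable \<Omega>" by (simp add: tendsto_in_prob_def)
    have "measure M {\<omega> \<in> space M. \<delta> < \<bar>Ctot E N C A t \<omega> - C_inf (?X \<omega>)\<bar>}
        = measure \<Omega> {w \<in> space \<Omega>. \<delta> < \<bar>total_reward t w - C_inf w\<bar>}" for \<delta> t
    proof -
      have "measure \<Omega> {w \<in> space \<Omega>. \<delta> < \<bar>total_reward t w - C_inf w\<bar>}
          = measure M (?X -` {w \<in> space \<Omega>. \<delta> < \<bar>total_reward t w - C_inf w\<bar>} \<inter> space M)"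
        by (subst (1) law[symmetric], rule measure_distr) measurable
      also have "?X -` {w \<in> space \<Omega>. \<delta> < \<bar>total_reward t w - C_inf w\<bar>} \<inter> space M
          = {\<omega> \<in> space M. \<delta> < \<bar>Ctot E N C A t \<omega> - C_inf (?X \<omega>)\<bar>}"
        using measurable_space[OF X] by (auto simp: total_configuration)
      finally show ?thesis by simp
    qed
    then have "tendsto_in_prob M (Ctot E N C A) (\<lambda>\<omega>. C_inf (?X \<omega>)) at_top"
      using C_inf Cm unfolding tendsto_in_prob_def by simp
    then show "\<exists>C_inf. tendsto_in_prob M (Ctot E N C A) C_inf at_top" by blast
  next
    assume C: "integrable P C\<^sub>0" "(\<integral>\<omega>. C\<^sub>0 \<omega> \<partial>P) = 0" "integrable P (\<lambda>\<omega>. (C\<^sub>0 \<omega>)\<^sup>2)"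
      and interior: "2 \<in> interior (Dset P N\<^sub>0 A\<^sub>0)" and Phi_pos: "0 < Phi P N\<^sub>0 A\<^sub>0 2"
      and decr: "mu_deriv_neg P N\<^sub>0 A\<^sub>0 2"
    define \<sigma>2 where "\<sigma>2 = (\<integral>\<omega>. (C\<^sub>0 \<omega>)\<^sup>2 \<partial>P)"
    have D_mom: "\<exists>a. mom s = ennreal a \<and> 0 \<le> a \<and> real_of_ereal (Phi P N\<^sub>0 A\<^sub>0 s) = a - 1"
      if "s \<in> Dset P N\<^sub>0 A\<^sub>0" for s
      using that by (cases "mom s") (auto simp: Dset_def Phi_def moment one_ereal_def)
    have "2 \<in> Dset P N\<^sub>0 A\<^sub>0" using interior interior_subset by blast
    then obtain m where m: "mom 2 = ennreal m" "0 \<le> m" "real_of_ereal (Phi P N\<^sub>0 A\<^sub>0 2) = m - 1"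
      using D_mom by blast
    define \<phi> where "\<phi> = m - 1"
    have \<phi>: "0 < \<phi>" "real_of_ereal (Phi P N\<^sub>0 A\<^sub>0 2) = \<phi>"
      using Phi_pos m by (auto simp: \<phi>_def Phi_def moment one_ereal_def)
    \<comment> \<open>as \<open>\<mu>\<close> decreases at 2, it is smaller at a slightly larger exponent p\<close>
    obtain p mp where p: "2 < p" "mom p = ennreal mp" "0 \<le> mp" "mp - 1 < p / 2 * \<phi>"
    proof -
      obtain d where "d < 0" "(mu P N\<^sub>0 A\<^sub>0 has_real_derivative d) (at 2 within Dset P N\<^sub>0 A\<^sub>0)"
        using decr unfolding mu_deriv_neg_def by blast
      then obtain \<delta> where \<delta>: "0 < \<delta>"
          "\<And>h. 0 < h \<Longrightarrow> 2 + h \<in> Dset P N\<^sub>0 A\<^sub>0 \<Longrightarrow> h < \<delta> \<Longrightarrow> mu P N\<^sub>0 A\<^sub>0 (2 + h) < mu P N\<^sub>0 A\<^sub>0 2"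
        using has_real_derivative_neg_dec_right by blast
      obtain r where r: "0 < r" "ball 2 r \<subseteq> Dset P N\<^sub>0 A\<^sub>0"
        using interior unfolding mem_interior by blast
      define h where "h = min \<delta> r / 2"
      have h: "0 < h" "h < \<delta>" "h < r" using \<delta>(1) r(1) by (auto simp: h_def)
      have D: "2 + h \<in> Dset P N\<^sub>0 A\<^sub>0" using r(2) h by (auto simp: dist_real_def)
      obtain mp where mp: "mom (2 + h) = ennreal mp" "0 \<le> mp" "real_of_ereal (Phi P N\<^sub>0 A\<^sub>0 (2 + h)) = mp - 1"
        using D_mom[OF D] by blast
      have "(mp - 1) / (2 + h) < \<phi> / 2"
        using \<delta>(2)[OF h(1) D h(2)] by (simp add: mu_def mp \<phi>)
      then have "mp - 1 < (2 + h) / 2 * \<phi>" using h by (simp add: pos_divide_less_eq mult.commute)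
      then show ?thesis using that[of "2 + h" mp] h mp by simp
    qed
    have mu2: "mu P N\<^sub>0 A\<^sub>0 2 = \<phi> / 2" by (simp add: mu_def \<phi>)
    have CR: "integrable R (\<lambda>r. fst (snd r))" "(\<integral> r. fst (snd r) \<partial>R) = 0"
      "integrable R (\<lambda>r. (fst (snd r))\<^sup>2)" "(\<integral> r. (fst (snd r))\<^sup>2 \<partial>R) = \<sigma>2"
      using C C_int[of "\<lambda>x. x"] C_int[of "\<lambda>x. x\<^sup>2"] by (auto simp: \<sigma>2_def)
    define W where "W = limit_additive 2 \<phi>"
    have Wm [measurable]: "W \<in> borel_measurable \<Omega>"
      unfolding W_def by (rule measurable_limit_additive[OF m(1,2) \<phi>_def])
    let ?M_inf = "\<lambda>\<omega>. W (?X \<omega>)"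
    have "AE w in distr M \<Omega> ?X. ((\<lambda>t. additive_process \<phi> 2 t w) \<longlongrightarrow> W w) at_top"
      unfolding law W_def by (rule AE_additive_converges[OF m(1,2) \<phi>_def])
    then have conv: "AE \<omega> in M. ((\<lambda>t. Mart \<phi> E N A 2 t \<omega>) \<longlongrightarrow> ?M_inf \<omega>) at_top"
      unfolding additive_configuration[of _ _ _ E N C A, symmetric] by (rule AE_distrD[OF X])
    have \<sigma>\<phi>: "0 \<le> \<sigma>2 / \<phi>" using \<phi>(1) by (simp add: \<sigma>2_def)
    have distr: "tendsto_in_distr M (\<lambda>t \<omega>. exp (- mu P N\<^sub>0 A\<^sub>0 2 * t) * Ctot E N C A t \<omega>)
        (normal_mixture M ?M_inf (\<sigma>2 / \<phi>)) at_top"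
    proof (rule tendsto_in_distr_of_char)
      let ?V = "\<lambda>t w. exp (- (\<phi> / 2) * t) * total_reward t w"
      show meas: "(\<lambda>\<omega>. exp (- mu P N\<^sub>0 A\<^sub>0 2 * t) * Ctot E N C A t \<omega>) \<in> borel_measurable M" for t
        using Cm by measurable
      show "real_distribution (normal_mixture M ?M_inf (\<sigma>2 / \<phi>))"
        by (rule normal_mixture_char(1)[OF M.prob_space_axioms _ \<sigma>\<phi>]) measurable
      fix \<theta>
      have left: "char (distr M borel (\<lambda>\<omega>. exp (- mu P N\<^sub>0 A\<^sub>0 2 * t) * Ctot E N C A t \<omega>)) \<theta>
          = (\<integral> w. iexp (\<theta> * ?V t w) \<partial>\<Omega>)" for t
      proof -
        have "char (distr M borel (\<lambda>\<omega>. exp (- mu P N\<^sub>0 A\<^sub>0 2 * t) * Ctot E N C A t \<omega>)) \<theta>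
            = (\<integral> \<omega>. iexp (\<theta> * ?V t (?X \<omega>)) \<partial>M)"
          unfolding char_def
          by (subst integral_distr[OF meas]) (auto simp: mu2 total_configuration)
        also have "\<dots> = (\<integral> w. iexp (\<theta> * ?V t w) \<partial>distr M \<Omega> ?X)"
          by (rule integral_distr[symmetric, OF X]) measurable
        finally show ?thesis by (simp only: law)
      qed
      have right: "char (normal_mixture M ?M_inf (\<sigma>2 / \<phi>)) \<theta>
          = (\<integral> w. complex_of_real (exp (- (\<theta>\<^sup>2 / 2 * (\<sigma>2 / \<phi>) * \<bar>W w\<bar>))) \<partial>\<Omega>)"
      proof -
        have "char (normal_mixture M ?M_inf (\<sigma>2 / \<phi>)) \<theta>
            = (\<integral> \<omega>. complex_of_real (exp (- (\<theta>\<^sup>2 / 2 * (\<sigma>2 / \<phi>) * \<bar>?M_inf \<omega>\<bar>))) \<partial>M)"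
          by (rule normal_mixture_char(2)[OF M.prob_space_axioms _ \<sigma>\<phi>]) measurable
        also have "\<dots> = (\<integral> w. complex_of_real (exp (- (\<theta>\<^sup>2 / 2 * (\<sigma>2 / \<phi>) * \<bar>W w\<bar>))) \<partial>distr M \<Omega> ?X)"
          by (rule integral_distr[symmetric, OF X]) measurable
        finally show ?thesis by (simp only: law)
      qed
      show "((\<lambda>t. char (distr M borel (\<lambda>\<omega>. exp (- mu P N\<^sub>0 A\<^sub>0 2 * t) * Ctot E N C A t \<omega>)) \<theta>)
          \<longlongrightarrow> char (normal_mixture M ?M_inf (\<sigma>2 / \<phi>)) \<theta>) at_top"
        unfolding left right unfolding W_def
        by (rule characteristic_function_limit[OF CR m(1,2) \<phi>_def \<phi>(1) p])
    qed (rule M.prob_space_axioms)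
    show "\<exists>M_inf\<in>borel_measurable M.
        (AE \<omega> in M. ((\<lambda>t. Mart (real_of_ereal (Phi P N\<^sub>0 A\<^sub>0 2)) E N A 2 t \<omega>) \<longlongrightarrow> M_inf \<omega>) at_top) \<and>
        tendsto_in_distr M (\<lambda>t \<omega>. exp (- mu P N\<^sub>0 A\<^sub>0 2 * t) * Ctot E N C A t \<omega>)
          (normal_mixture M M_inf ((\<integral>\<omega>. (C\<^sub>0 \<omega>)\<^sup>2 \<partial>P) / real_of_ereal (Phi P N\<^sub>0 A\<^sub>0 2))) at_top"
    proof (intro bexI[of _ ?M_inf] conjI)
      show "AE \<omega> in M. ((\<lambda>t. Mart (real_of_ereal (Phi P N\<^sub>0 A\<^sub>0 2)) E N A 2 t \<omega>) \<longlongrightarrow> ?M_inf \<omega>) at_top"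
        unfolding \<phi>(2) by (rule conv)
      show "tendsto_in_distr M (\<lambda>t \<omega>. exp (- mu P N\<^sub>0 A\<^sub>0 2 * t) * Ctot E N C A t \<omega>)
          (normal_mixture M ?M_inf ((\<integral>\<omega>. (C\<^sub>0 \<omega>)\<^sup>2 \<partial>P) / real_of_ereal (Phi P N\<^sub>0 A\<^sub>0 2))) at_top"
        using distr unfolding \<phi>(2) \<sigma>2_def .
      show "?M_inf \<in> borel_measurable M" by measurable
    qed
  qed
qed

end
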